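(* Let $d\ge3$, $s\ge\frac d2+1$, $1\le r<d$, $1\le q<\frac{2d}3$ with $\frac1d+\frac1{2r}<\frac1q$, $1=\frac1r+\frac2p$, $\frac1p+\frac1{p'}=1$. Let $\varepsilon_0>0$ be small enough, $w\in\mathcal{M}+L^q$ and $\psi_0\in H^s\cap H^{s,p'}$ with $\|w\|_{\mathcal{M}+L^q}\|\psi_0\|^2_{H^s\cap H^{s,p'}}\le\varepsilon_0$ and, in addition, $\|\langle x\rangle\psi_0\|_{L^2}<\infty$. Let $\psi\in S^{s,r,p}$ be the unique global solution of $i\partial_t\psi=(\langle\nabla\rangle+w*|\psi|^2)\psi$, $\psi|_{t=0}=\psi_0$. Then for all $f,g\in\mathcal{C}^\infty_0(\mathbb{R})$ with $\mathrm{supp}(f)\cap\mathrm{supp}(g)=\emptyset$, $$\Big\|g\Big(\frac{x^2}{t^2}\Big)f(\Theta^2)\psi_t\Big\|_{L^2}\to0,\qquad t\to\infty.$$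
   Context: $\langle\nabla\rangle^s:=\mathcal{F}^{-1}(1+|\xi|^2)^{s/2}\mathcal{F}$ with $\mathcal{F}$ the unitary Fourier transform; $\langle x\rangle=\sqrt{1+|x|^2}$. $\Theta:=-i\nabla\langle\nabla\rangle^{-1}$ is the instantaneous velocity operator (so $\Theta^2=-\Delta(1-\Delta)^{-1}$), and $f(\Theta^2)$, $g(x^2/t^2)$ are defined by functional calculus. $H^{s,p}=\{f:\langle\nabla\rangle^sf\in L^p\}$, $H^s=H^{s,2}$, $\|f\|_{H^s\cap H^{s,p'}}=\|f\|_{H^s}+\|f\|_{H^{s,p'}}$. $\mathcal{M}$ = finite signed Radon measures (total variation norm), $w$ real, $\|w\|_{\mathcal{M}+L^q}$ the infimal decomposition norm. $S^{s,r,p}$ is the space of $\varphi\in L^\infty([0,\infty),H^s)$ with $\sup_t\|\varphi_t\|_{H^s}+\sup_t\langle t\rangle^{\frac d{2r}}(\|\varphi_t\|_{L^\infty}+\|\varphi_t\|_{L^p})<\infty$; solutions are in the Duhamel sense. *)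

theory Defs
  imports "HOL-Probability.Probability"
begin

definition jbr :: "'a::real_normed_vector \<Rightarrow> real" where
  "jbr x = sqrt (1 + (norm x)\<^sup>2)"

definition in_Lp :: "ereal \<Rightarrow> (real^'n::finite \<Rightarrow> complex) \<Rightarrow> bool" where
  "in_Lp p f \<longleftrightarrow> f \<in> borel_measurable lborel \<and>
     (if p = \<infinity> then esssup lborel (\<lambda>x. ereal (norm (f x))) < \<infinity>
      else integrable lborel (\<lambda>x. norm (f x) powr real_of_ereal p))"

definition lp_norm :: "ereal \<Rightarrow> (real^'n::finite \<Rightarrow> complex) \<Rightarrow> real" where
  "lp_norm p f =
     (if p = \<infinity> then real_of_ereal (esssup lborel (\<lambda>x. ereal (norm (f x))))
      else (\<integral>x. norm (f x) powr real_of_ereal p \<partial>lborel) powr (1 / real_of_ereal p))"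

definition tsupport :: "('a::topological_space \<Rightarrow> 'b::zero) \<Rightarrow> 'a set" where
  "tsupport f = closure {x. f x \<noteq> 0}"

definition pdiff :: "'n \<Rightarrow> (real^'n::finite \<Rightarrow> complex) \<Rightarrow> real^'n \<Rightarrow> complex" where
  "pdiff i F x = vector_derivative (\<lambda>h. F (x + h *\<^sub>R axis i 1)) (at 0)"

fun pd_iter :: "'n list \<Rightarrow> (real^'n::finite \<Rightarrow> complex) \<Rightarrow> real^'n \<Rightarrow> complex" where
  "pd_iter [] F = F"
| "pd_iter (i # is) F = pdiff i (pd_iter is F)"

definition smooth_Rd :: "(real^'n::finite \<Rightarrow> complex) \<Rightarrow> bool" where
  "smooth_Rd F \<longleftrightarrow> (\<forall>is. continuous_on UNIV (pd_iter is F) \<and>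
      (\<forall>i x. (\<lambda>h::real. pd_iter is F (x + h *\<^sub>R axis i 1)) differentiable (at 0)))"

definition test_fun :: "(real^'n::finite \<Rightarrow> complex) \<Rightarrow> bool" where
  "test_fun F \<longleftrightarrow> smooth_Rd F \<and> compact (tsupport F)"

definition smooth_R :: "(real \<Rightarrow> real) \<Rightarrow> bool" where
  "smooth_R f \<longleftrightarrow> (\<forall>k x. ((deriv ^^ k) f) differentiable (at x))"

definition Cc_inf_R :: "(real \<Rightarrow> complex) \<Rightarrow> bool" where
  "Cc_inf_R f \<longleftrightarrow> smooth_R (\<lambda>x. Re (f x)) \<and> smooth_R (\<lambda>x. Im (f x)) \<and> compact (tsupport f)"

definition FT :: "(real^'n::finite \<Rightarrow> complex) \<Rightarrow> real^'n \<Rightarrow> complex" where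
  "FT f \<xi> = (2 * pi) powr (- real CARD('n) / 2) *
     (\<integral>x. cis (- (x \<bullet> \<xi>)) * f x \<partial>lborel)"

definition IFT :: "(real^'n::finite \<Rightarrow> complex) \<Rightarrow> real^'n \<Rightarrow> complex" where
  "IFT f x = (2 * pi) powr (- real CARD('n) / 2) *
     (\<integral>\<xi>. cis (x \<bullet> \<xi>) * f \<xi> \<partial>lborel)"

definition mult_test :: "(real^'n::finite \<Rightarrow> complex) \<Rightarrow> (real^'n \<Rightarrow> complex) \<Rightarrow> real^'n \<Rightarrow> complex" where
  "mult_test m \<phi> = IFT (\<lambda>\<xi>. m \<xi> * FT \<phi> \<xi>)"

definition weak_mult :: "(real^'n::finite \<Rightarrow> complex) \<Rightarrow> (real^'n \<Rightarrow> complex) \<Rightarrow> (real^'n \<Rightarrow> complex) \<Rightarrow> bool" where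
  "weak_mult m u v \<longleftrightarrow> (\<forall>\<phi>. test_fun \<phi> \<longrightarrow>
     (\<integral>x. cnj (\<phi> x) * v x \<partial>lborel) =
     (\<integral>x. cnj (mult_test (\<lambda>\<xi>. cnj (m \<xi>)) \<phi> x) * u x \<partial>lborel))"

text \<open>m(-i\<nabla>) as an operator on L^2 (m bounded).\<close>
definition L2_mult :: "(real^'n::finite \<Rightarrow> complex) \<Rightarrow> (real^'n \<Rightarrow> complex) \<Rightarrow> real^'n \<Rightarrow> complex" where
  "L2_mult m u = (SOME v. in_Lp 2 v \<and> weak_mult m u v)"

text \<open>f(\<Theta>^2), \<Theta>^2 = -\<Delta>(1-\<Delta>)^{-1}, i.e. symbol |\<xi>|^2/(1+|\<xi>|^2).\<close>
definition f_Theta2 :: "(real \<Rightarrow> complex) \<Rightarrow> (real^'n::finite \<Rightarrow> complex) \<Rightarrow> real^'n \<Rightarrow> complex" where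
  "f_Theta2 f = L2_mult (\<lambda>\<xi>. f ((norm \<xi>)\<^sup>2 / (1 + (norm \<xi>)\<^sup>2)))"

definition bessel_sym :: "real \<Rightarrow> real^'n::finite \<Rightarrow> complex" where
  "bessel_sym s \<xi> = complex_of_real (jbr \<xi> powr s)"

definition in_Hsp :: "real \<Rightarrow> ereal \<Rightarrow> (real^'n::finite \<Rightarrow> complex) \<Rightarrow> bool" where
  "in_Hsp s p f \<longleftrightarrow> in_Lp p f \<and> (\<exists>g. in_Lp p g \<and> weak_mult (bessel_sym s) f g)"

definition Hsp_norm :: "real \<Rightarrow> ereal \<Rightarrow> (real^'n::finite \<Rightarrow> complex) \<Rightarrow> real" where
  "Hsp_norm s p f = lp_norm p (SOME g. in_Lp p g \<and> weak_mult (bessel_sym s) f g)"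

definition U_test :: "real \<Rightarrow> (real^'n::finite \<Rightarrow> complex) \<Rightarrow> real^'n \<Rightarrow> complex" where
  "U_test t = mult_test (\<lambda>\<xi>. cis (- t * jbr \<xi>))"

text \<open>w is a real distribution (functional on real test functions).
  A decomposition w = (\<mu>1 - \<mu>2) + h with \<mu>1, \<mu>2 finite Borel measures
  (hence a finite signed Radon measure) and h \<in> L^q real.\<close>
definition decomp :: "ereal \<Rightarrow> ((real^'n::finite \<Rightarrow> real) \<Rightarrow> real) \<Rightarrow> (real^'n) measure \<Rightarrow> (real^'n) measure
     \<Rightarrow> (real^'n \<Rightarrow> real) \<Rightarrow> bool" where
  "decomp q w \<mu>1 \<mu>2 h \<longleftrightarrow>
     finite_measure \<mu>1 \<and> sets \<mu>1 = sets borel \<and>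
     finite_measure \<mu>2 \<and> sets \<mu>2 = sets borel \<and>
     in_Lp q (\<lambda>x. complex_of_real (h x)) \<and>
     (\<forall>\<phi>. test_fun (\<lambda>x. complex_of_real (\<phi> x)) \<longrightarrow>
        w \<phi> = (\<integral>x. \<phi> x \<partial>\<mu>1) - (\<integral>x. \<phi> x \<partial>\<mu>2) + (\<integral>x. \<phi> x * h x \<partial>lborel))"

definition in_MLq :: "ereal \<Rightarrow> ((real^'n::finite \<Rightarrow> real) \<Rightarrow> real) \<Rightarrow> bool" where
  "in_MLq q w \<longleftrightarrow> (\<exists>\<mu>1 \<mu>2 h. decomp q w \<mu>1 \<mu>2 h)"

text \<open>Infimal decomposition norm; inf over \<mu>1(R^d)+\<mu>2(R^d) equals the total variation norm.\<close>
definition MLq_norm :: "ereal \<Rightarrow> ((real^'n::finite \<Rightarrow> real) \<Rightarrow> real) \<Rightarrow> real" where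
  "MLq_norm q w = Inf {measure \<mu>1 UNIV + measure \<mu>2 UNIV + lp_norm q (\<lambda>x. complex_of_real (h x))
                        | \<mu>1 \<mu>2 h. decomp q w \<mu>1 \<mu>2 h}"

definition conv_w :: "(real^'n::finite) measure \<Rightarrow> (real^'n) measure \<Rightarrow> (real^'n \<Rightarrow> real)
     \<Rightarrow> (real^'n \<Rightarrow> real) \<Rightarrow> real^'n \<Rightarrow> real" where
  "conv_w \<mu>1 \<mu>2 h \<rho> x = (\<integral>y. \<rho> (x - y) \<partial>\<mu>1) - (\<integral>y. \<rho> (x - y) \<partial>\<mu>2)
                          + (\<integral>y. h y * \<rho> (x - y) \<partial>lborel)"

definition in_S :: "real \<Rightarrow> real \<Rightarrow> ereal \<Rightarrow> (real \<Rightarrow> real^'n::finite \<Rightarrow> complex) \<Rightarrow> bool" where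
  "in_S s r p \<psi> \<longleftrightarrow>
     (\<lambda>(t, x). \<psi> t x) \<in> borel_measurable (restrict_space borel ({0..} \<times> UNIV)) \<and>
     (\<forall>t\<ge>0. in_Hsp s 2 (\<psi> t) \<and> in_Lp \<infinity> (\<psi> t) \<and> in_Lp p (\<psi> t)) \<and>
     (\<exists>C. \<forall>t\<ge>0. Hsp_norm s 2 (\<psi> t) \<le> C) \<and>
     (\<exists>C. \<forall>t\<ge>0. jbr t powr (real CARD('n) / (2 * r)) *
                   (lp_norm \<infinity> (\<psi> t) + lp_norm p (\<psi> t)) \<le> C)"

definition nonlin :: "(real^'n::finite) measure \<Rightarrow> (real^'n) measure \<Rightarrow> (real^'n \<Rightarrow> real)
     \<Rightarrow> (real^'n \<Rightarrow> complex) \<Rightarrow> real^'n \<Rightarrow> complex" where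
  "nonlin \<mu>1 \<mu>2 h u x = complex_of_real (conv_w \<mu>1 \<mu>2 h (\<lambda>y. (cmod (u y))\<^sup>2) x) * u x"

text \<open>Duhamel formulation of i\<partial>_t\<psi> = (\<langle>\<nabla>\<rangle> + w*|\<psi>|^2)\<psi>, \<psi>(0)=\<psi>0, tested against
  test functions: \<psi>_t = U(t)\<psi>0 - i \<integral>_0^t U(t-\<tau>) N(\<tau>) d\<tau>.\<close>
definition duhamel_sol :: "ereal \<Rightarrow> ((real^'n::finite \<Rightarrow> real) \<Rightarrow> real) \<Rightarrow> (real^'n \<Rightarrow> complex)
     \<Rightarrow> (real \<Rightarrow> real^'n \<Rightarrow> complex) \<Rightarrow> bool" where
  "duhamel_sol q w \<psi>0 \<psi> \<longleftrightarrow> (\<exists>\<mu>1 \<mu>2 h. decomp q w \<mu>1 \<mu>2 h \<and>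
     (\<forall>t\<ge>0. \<forall>\<phi>. test_fun \<phi> \<longrightarrow>
        set_integrable lborel {0..t}
          (\<lambda>\<tau>. \<integral>x. cnj (U_test (\<tau> - t) \<phi> x) * nonlin \<mu>1 \<mu>2 h (\<psi> \<tau>) x \<partial>lborel) \<and>
        (\<integral>x. cnj (\<phi> x) * \<psi> t x \<partial>lborel) =
          (\<integral>x. cnj (U_test (- t) \<phi> x) * \<psi>0 x \<partial>lborel)
          - \<i> * (LINT \<tau>:{0..t}|lborel.
                   \<integral>x. cnj (U_test (\<tau> - t) \<phi> x) * nonlin \<mu>1 \<mu>2 h (\<psi> \<tau>) x \<partial>lborel)))"

end

theory Submission
  imports Defs
begin

text \<open>The decay built into \<open>S\<close> bounds the potential \<open>w * |\<psi>|\<^sup>2\<close> by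
  \<open>K \<langle>t\<rangle> powr (- \<alpha>)\<close> with \<open>\<alpha> = min (d / r) (d / q) > 1\<close>: the measure part decays like \<open>\<parallel>\<psi>\<parallel>\<^sup>2\<close>
  in \<open>L\<^sup>\<infinity>\<close>, and the \<open>L\<^sup>q\<close> part is handled by interpolating \<open>\<psi>\<close> between \<open>L\<^sup>2\<close>, \<open>L\<^sup>p\<close> and \<open>L\<^sup>\<infinity>\<close>.
  This is integrable in time, so Duhamel's formula is Cauchy in the interaction picture and \<open>\<psi>\<close> scatters in \<open>L\<^sup>2\<close>.
  It remains to treat a free solution with Fourier profile \<open>a\<close>. On the Fourier side \<open>cis (y \<bullet> x / t)\<close> is the
  translation by \<open>y / t\<close>, and \<open>t (\<langle>\<xi>\<rangle> - \<langle>\<xi> - y / t\<rangle>)\<close> tends to \<open>y \<bullet> \<xi> / \<langle>\<xi>\<rangle>\<close>. Hence the distribution of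
  \<open>x / t\<close> converges to that of the velocity \<open>\<xi> / \<langle>\<xi>\<rangle>\<close>, on which \<open>f\<close> and \<open>g\<close> have no common support.\<close>

section \<open>Test functions\<close>

text \<open>The operators in the statement are given only weakly: \<open>L2_mult\<close> and
  \<open>Hsp_norm\<close> choose a function by its pairings with test functions, while the integrals
  \<open>FT\<close> and \<open>IFT\<close> converge for integrable functions alone. Plancherel's
  theorem and the uniqueness of weak multipliers therefore carry much of the proof; they turn each
  multiplier into pointwise multiplication of a square-integrable transform. Both cutoffs are
  bounded on L^2, so the conclusion survives small L^2 errors. Hence no scattering state is
  constructed: it is enough that from some time on \<open>\<psi>\<close> stays within a prescribed
  error of a free solution whose profile is a test function, and for such profiles all integrals
  converge absolutely. The limit law of x / t is computed on characters. Averaging them against an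
  integrable \<open>k\<close> gives the observables \<open>FT k\<close>, and Gaussian damping shows
  that these approximate uniformly every continuous observable of bounded support, in particular
  |g(|v|^2)|^2. The uniform errors are harmless because the mass of a free solution is constant in
  time.\<close>

fun diffk :: "nat \<Rightarrow> (real^'n::finite \<Rightarrow> complex) \<Rightarrow> bool" where
  "diffk 0 F \<longleftrightarrow> continuous_on UNIV F"
| "diffk (Suc k) F \<longleftrightarrow> continuous_on UNIV F \<and>
     (\<forall>i. \<exists>F'. (\<forall>x. ((\<lambda>h. F (x + h *\<^sub>R axis i 1)) has_vector_derivative F' x) (at 0)) \<and> diffk k F')"

lemma diffk_SucE:
  assumes "diffk (Suc k) F"
  obtains F' where "\<And>x. ((\<lambda>h. F (x + h *\<^sub>R axis i 1)) has_vector_derivative F' x) (at 0)" "diffk k F'"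
  using assms unfolding diffk.simps(2) by blast

lemma diffk_cont: "diffk k F \<Longrightarrow> continuous_on UNIV F"
  by (cases k) auto

lemma diffk_Suc_D: "diffk (Suc k) F \<Longrightarrow> diffk k F"
proof (induction k arbitrary: F)
  case (Suc k)
  then show ?case by (metis diffk.simps(2))
qed simp

lemma diffk_SucI:
  assumes "continuous_on UNIV F"
    and "\<And>i x. ((\<lambda>h. F (x + h *\<^sub>R axis i 1)) has_vector_derivative F' i x) (at 0)"
    and "\<And>i. diffk k (F' i)"
  shows "diffk (Suc k) F"
  unfolding diffk.simps(2) by (intro conjI allI exI) (rule assms)+

lemma diffk_const: "diffk k (\<lambda>_::real^'n::finite. c)"
proof (induction k arbitrary: c)
  case (Suc k)
  show ?case
    by (rule diffk_SucI[where F' = "\<lambda>_ _. 0"]) (intro continuous_on_const has_vector_derivative_const Suc)+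
qed simp

lemma diffk_add: "diffk k F \<Longrightarrow> diffk k G \<Longrightarrow> diffk k (\<lambda>x. F x + G x)"
proof (induction k arbitrary: F G)
  case 0
  then show ?case by (auto intro: continuous_intros)
next
  case (Suc k)
  have "\<exists>F'. (\<forall>x. ((\<lambda>h. F (x + h *\<^sub>R axis i 1)) has_vector_derivative F' x) (at 0)) \<and> diffk k F'" for i
    using Suc.prems(1) unfolding diffk.simps by blast
  then obtain F' where F': "((\<lambda>h. F (x + h *\<^sub>R axis i 1)) has_vector_derivative F' i x) (at 0)" "diffk k (F' i)" for i x
    by metis
  have "\<exists>G'. (\<forall>x. ((\<lambda>h. G (x + h *\<^sub>R axis i 1)) has_vector_derivative G' x) (at 0)) \<and> diffk k G'" for i
    using Suc.prems(2) unfolding diffk.simps by blast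
  then obtain G' where G': "((\<lambda>h. G (x + h *\<^sub>R axis i 1)) has_vector_derivative G' i x) (at 0)" "diffk k (G' i)" for i x
    by metis
  show ?case
  proof (rule diffk_SucI[where F' = "\<lambda>i x. F' i x + G' i x"])
    show "continuous_on UNIV (\<lambda>x. F x + G x)"
      using Suc.prems[THEN diffk_cont] by (intro continuous_intros)
  qed (rule has_vector_derivative_add Suc.IH F' G')+
qed

lemma diffk_mult: "diffk k F \<Longrightarrow> diffk k G \<Longrightarrow> diffk k (\<lambda>x. F x * G x)"
proof (induction k arbitrary: F G)
  case 0
  then show ?case by (auto intro: continuous_intros)
next
  case (Suc k)
  have "\<exists>F'. (\<forall>x. ((\<lambda>h. F (x + h *\<^sub>R axis i 1)) has_vector_derivative F' x) (at 0)) \<and> diffk k F'" for i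
    using Suc.prems(1) unfolding diffk.simps by blast
  then obtain F' where F': "((\<lambda>h. F (x + h *\<^sub>R axis i 1)) has_vector_derivative F' i x) (at 0)" "diffk k (F' i)" for i x
    by metis
  have "\<exists>G'. (\<forall>x. ((\<lambda>h. G (x + h *\<^sub>R axis i 1)) has_vector_derivative G' x) (at 0)) \<and> diffk k G'" for i
    using Suc.prems(2) unfolding diffk.simps by blast
  then obtain G' where G': "((\<lambda>h. G (x + h *\<^sub>R axis i 1)) has_vector_derivative G' i x) (at 0)" "diffk k (G' i)" for i x
    by metis
  show ?case
  proof (rule diffk_SucI[where F' = "\<lambda>i x. F x * G' i x + F' i x * G x"])
    show "continuous_on UNIV (\<lambda>x. F x * G x)"
      using Suc.prems[THEN diffk_cont] by (intro continuous_intros)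
    show "((\<lambda>h. F (x + h *\<^sub>R axis i 1) * G (x + h *\<^sub>R axis i 1)) has_vector_derivative F x * G' i x + F' i x * G x) (at 0)" for i x
      using has_vector_derivative_mult[OF F'(1)[of x i] G'(1)[of x i]] by simp
    show "diffk k (\<lambda>x. F x * G' i x + F' i x * G x)" for i
      using Suc.prems[THEN diffk_Suc_D] F'(2) G'(2) by (intro diffk_add Suc.IH)
  qed
qed

lemma diffk_prod: "finite A \<Longrightarrow> (\<And>i. i \<in> A \<Longrightarrow> diffk k (F i)) \<Longrightarrow> diffk k (\<lambda>x. \<Prod>i\<in>A. F i x)"
  by (induction A rule: finite_induct) (auto intro: diffk_const diffk_mult)

text \<open>Derivatives are unique, so any witness in \<open>diffk\<close> must agree with
  \<open>pdiff\<close>; each letter of the list uses up one order of differentiability.\<close>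

lemma diffk_pd_iter: "diffk k F \<Longrightarrow> length is \<le> k \<Longrightarrow> diffk (k - length is) (pd_iter is F)"
proof (induction "is")
  case (Cons i "is")
  then obtain m where m: "k - length is = Suc m" "k - length (i # is) = m"
    by (metis Suc_diff_le diff_Suc_Suc length_Cons)
  have "diffk (Suc m) (pd_iter is F)"
    using Cons m by simp
  then obtain F' where F': "\<And>x. ((\<lambda>h. pd_iter is F (x + h *\<^sub>R axis i 1)) has_vector_derivative F' x) (at 0)" "diffk m F'"
    by (rule diffk_SucE[where i = i]) (rule that)
  have "pdiff i (pd_iter is F) = F'"
    unfolding pdiff_def by (rule ext) (rule vector_derivative_at[OF F'(1)])
  then show ?case using F' m by simp
qed simp

lemma smooth_Rd_if_diffk:
  assumes "\<And>k. diffk k F"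
  shows "smooth_Rd F"
  unfolding smooth_Rd_def
proof (intro allI conjI)
  fix "is" :: "'a list" and i :: 'a and x
  have *: "diffk (Suc 0) (pd_iter is F)"
    using diffk_pd_iter[OF assms[of "Suc (length is)"], of "is"] by simp
  then show "continuous_on UNIV (pd_iter is F)" by (rule diffk_cont)
  show "(\<lambda>h::real. pd_iter is F (x + h *\<^sub>R axis i 1)) differentiable (at 0)"
    using * by (rule diffk_SucE) (rule differentiableI_vector)
qed

lemma smooth_Rd_pdiff:
  assumes "smooth_Rd F"
  shows "((\<lambda>h. pd_iter is F (x + h *\<^sub>R axis i 1)) has_vector_derivative pd_iter (i # is) F x) (at 0)"
  using assms unfolding smooth_Rd_def by (simp add: pdiff_def vector_derivative_works)

lemma diffk_if_smooth_Rd: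
  assumes "smooth_Rd F"
  shows "diffk k (pd_iter is F)"
proof (induction k arbitrary: "is")
  case 0
  then show ?case using assms by (simp add: smooth_Rd_def)
next
  case (Suc k)
  have "continuous_on UNIV (pd_iter is F)"
    using assms by (simp add: smooth_Rd_def)
  moreover have "\<forall>i. \<exists>F'. (\<forall>x. ((\<lambda>h. pd_iter is F (x + h *\<^sub>R axis i 1)) has_vector_derivative F' x) (at 0)) \<and> diffk k F'"
    using smooth_Rd_pdiff[OF assms] Suc by blast
  ultimately show ?case by simp
qed

text \<open>\<open>diffk\<close> asserts that partial derivatives exist without naming them. Sum and
  product rules then go through by induction on the order, which would be awkward with the iterated
  \<open>vector_derivative\<close> inside \<open>smooth_Rd\<close>.\<close>

lemma smooth_Rd_iff_diffk: "smooth_Rd F \<longleftrightarrow> (\<forall>k. diffk k F)"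
  using smooth_Rd_if_diffk diffk_if_smooth_Rd[of F _ "[]"] by auto

lemma tsupport_bounded_iff: "compact (tsupport F) \<longleftrightarrow> bounded {x. F x \<noteq> 0}"
  for F :: "'a::euclidean_space \<Rightarrow> 'b::zero"
  unfolding tsupport_def using bounded_subset[OF _ closure_subset]
  by (auto simp: compact_eq_bounded_closed intro: bounded_closure)

lemma test_fun_iff: "test_fun F \<longleftrightarrow> (\<forall>k. diffk k F) \<and> bounded {x. F x \<noteq> 0}"
  by (simp add: test_fun_def smooth_Rd_iff_diffk tsupport_bounded_iff)

lemma test_fun_cont: "test_fun F \<Longrightarrow> continuous_on UNIV F"
  using diffk_cont by (auto simp: test_fun_iff)

lemma test_fun_zero: "test_fun (\<lambda>_. 0)"
  by (simp add: test_fun_iff diffk_const)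

lemma test_fun_add:
  assumes "test_fun F" "test_fun G"
  shows "test_fun (\<lambda>x. F x + G x)"
proof -
  have "bounded ({x. F x \<noteq> 0} \<union> {x. G x \<noteq> 0})"
    using assms by (simp add: test_fun_iff)
  then have "bounded {x. F x + G x \<noteq> 0}"
    by (rule bounded_subset) auto
  then show ?thesis
    using assms by (simp add: test_fun_iff diffk_add)
qed

lemma test_fun_cmult: "test_fun F \<Longrightarrow> test_fun (\<lambda>x. c * F x)"
  using bounded_subset[of "{x. F x \<noteq> 0}" "{x. c * F x \<noteq> 0}"]
  by (auto simp: test_fun_iff intro: diffk_mult diffk_const)

text \<open>A derivative may be nonzero where \<open>F\<close> vanishes, but only inside the closed
  support: off it, \<open>F\<close> vanishes on a whole neighbourhood.\<close>

lemma test_fun_pdiff: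
  assumes "test_fun F"
  shows "test_fun (pdiff i F)"
proof -
  have "pdiff i F x = 0" if "x \<notin> tsupport F" for x
  proof -
    have "open (- tsupport F)" by (simp add: tsupport_def open_Compl)
    moreover have cont: "continuous_on UNIV (\<lambda>h::real. x + h *\<^sub>R axis i 1)"
      by (intro continuous_intros)
    ultimately have "open ((\<lambda>h::real. x + h *\<^sub>R axis i 1) -` (- tsupport F))"
      by (rule open_vimage)
    then have "\<forall>\<^sub>F h in nhds 0. x + h *\<^sub>R axis i 1 \<notin> tsupport F"
      using eventually_nhds_in_open[of _ "0::real"] that by fastforce
    then have "\<forall>\<^sub>F h in nhds 0. F (x + h *\<^sub>R axis i 1) = 0"
      by (rule eventually_mono) (use closure_subset[of "{x. F x \<noteq> 0}"] in \<open>auto simp: tsupport_def\<close>)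
    then have "((\<lambda>h. F (x + h *\<^sub>R axis i 1)) has_vector_derivative 0) (at 0)"
      by (subst has_vector_derivative_cong_ev[where g = "\<lambda>_. 0"]) (auto dest: eventually_nhds_x_imp_x)
    then show ?thesis unfolding pdiff_def by (rule vector_derivative_at)
  qed
  then have "{x. pdiff i F x \<noteq> 0} \<subseteq> tsupport F" by auto
  then have "bounded {x. pdiff i F x \<noteq> 0}"
    using assms by (meson bounded_subset compact_imp_bounded test_fun_def)
  moreover have "\<forall>k. diffk k (pdiff i F)"
    using diffk_if_smooth_Rd[of F _ "[i]"] assms by (simp add: test_fun_def)
  ultimately show ?thesis by (simp add: test_fun_iff)
qed

lemma test_fun_pd_iter: "test_fun F \<Longrightarrow> test_fun (pd_iter is F)"
  by (induction "is") (auto intro: test_fun_pdiff)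

section \<open>Smooth bumps on boxes, built from the flat exponential\<close>

definition flat_exp :: "nat \<Rightarrow> real \<Rightarrow> real" where
  "flat_exp k t = (if t > 0 then exp (- 1 / t) / t ^ k else 0)"

lemma flat_exp_tendsto_0: "flat_exp k \<midarrow>0\<rightarrow> 0"
proof -
  have "((\<lambda>x::real. x ^ k / exp x) \<longlongrightarrow> 0) at_top"
    by (rule tendsto_power_div_exp_0)
  then have "((\<lambda>t::real. inverse t ^ k / exp (inverse t)) \<longlongrightarrow> 0) (at_right 0)"
    using filterlim_compose[OF _ filterlim_inverse_at_top_right] by blast
  moreover have "\<forall>\<^sub>F t in at_right 0. inverse t ^ k / exp (inverse t) = flat_exp k t"
    using eventually_at_right_less[of "0::real"]
    by eventually_elim (simp add: flat_exp_def exp_minus field_simps)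
  ultimately have "(flat_exp k \<longlongrightarrow> 0) (at_right 0)"
    by (rule Lim_transform_eventually)
  moreover have "(flat_exp k \<longlongrightarrow> 0) (at_left 0)"
    by (rule Lim_transform_eventually[OF tendsto_const])
       (auto simp: flat_exp_def eventually_at_filter)
  ultimately show ?thesis by (simp add: filterlim_split_at)
qed

text \<open>The powers of t in the denominator make the family closed under differentiation up to
  linear combinations, so smoothness of exp(-1/t) becomes a plain induction over
  \<open>diffk\<close>.\<close>

lemma flat_exp_deriv:
  "(flat_exp k has_real_derivative flat_exp (k + 2) t - real k * flat_exp (k + 1) t) (at t)"
proof -
  consider "t > 0" | "t < 0" | "t = 0" by linarith
  then show ?thesis
  proof cases
    case 1
    have "((\<lambda>t. exp (- 1 / t) / t ^ k) has_real_derivative flat_exp (k + 2) t - real k * flat_exp (k + 1) t) (at t)"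
    proof (cases k)
      case (Suc m)
      have "t * t ^ (m - Suc 0) = t ^ m" if "m \<noteq> 0"
        using that by (metis Suc_pred' power_Suc neq0_conv One_nat_def)
      then show ?thesis
        using 1 Suc by (cases "m = 0") (auto intro!: derivative_eq_intros simp: flat_exp_def field_simps power2_eq_square)
    qed (use 1 in \<open>auto intro!: derivative_eq_intros simp: flat_exp_def field_simps power2_eq_square\<close>)
    then show ?thesis
      by (rule has_field_derivative_transform_within_open[of _ _ _ "{0<..}"])
         (use 1 in \<open>auto simp: flat_exp_def\<close>)
  next
    case 2
    have "((\<lambda>t. 0) has_real_derivative flat_exp (k + 2) t - real k * flat_exp (k + 1) t) (at t)"
      using 2 by (simp add: flat_exp_def)
    then show ?thesis
      by (rule has_field_derivative_transform_within_open[of _ _ _ "{..<0}"])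
         (use 2 in \<open>auto simp: flat_exp_def\<close>)
  next
    case 3
    \<comment> \<open>At the origin the difference quotient of one member is the next member, which
      tends to 0 because exponentials beat powers.\<close>
    have "flat_exp k h / h = flat_exp (Suc k) h" for h
      by (simp add: flat_exp_def)
    then show ?thesis
      using 3 flat_exp_tendsto_0[of "Suc k"] by (simp add: DERIV_def) (simp add: flat_exp_def[of _ 0])
  qed
qed

lemma flat_exp_bounds: "0 \<le> flat_exp 0 t" "flat_exp 0 t \<le> 1"
  by (auto simp: flat_exp_def)

lemma flat_exp_cont: "continuous_on UNIV (flat_exp k)"
  using flat_exp_deriv by (meson DERIV_isCont continuous_at_imp_continuous_on)

lemma diffk_flat_exp: "diffk k (\<lambda>x. complex_of_real (flat_exp m (N * x $ i + b)))"
proof (induction k arbitrary: m)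
  case 0
  show ?case
    by (auto intro!: continuous_intros continuous_on_compose2[OF flat_exp_cont])
next
  case (Suc k)
  have deriv: "((\<lambda>h. complex_of_real (flat_exp m (N * (x + h *\<^sub>R axis j 1) $ i + b))) has_vector_derivative
      (if i = j then of_real N else 0) *
      (complex_of_real (flat_exp (m + 2) (N * x $ i + b)) + complex_of_real (- real m) * complex_of_real (flat_exp (m + 1) (N * x $ i + b)))) (at 0)"
    for x and j
  proof -
    have 1: "((\<lambda>h. N * (x + h *\<^sub>R axis j 1) $ i + b) has_real_derivative (if i = j then N else 0)) (at 0)"
      by (auto simp: axis_def intro!: derivative_eq_intros)
    have "((\<lambda>h. flat_exp m (N * (x + h *\<^sub>R axis j 1) $ i + b)) has_real_derivative
       (flat_exp (m + 2) (N * x $ i + b) - real m * flat_exp (m + 1) (N * x $ i + b)) * (if i = j then N else 0)) (at 0)"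
      using DERIV_chain2[where f = "flat_exp m", OF _ 1] flat_exp_deriv[of m "N * x $ i + b"] by simp
    from has_vector_derivative_of_real[OF this, where 'a = complex] show ?thesis
      by (auto simp: algebra_simps split: if_splits)
  qed
  have diff: "diffk k (\<lambda>x::real^'a. (if i = j then of_real N else 0) *
      (complex_of_real (flat_exp (m + 2) (N * x $ i + b)) + complex_of_real (- real m) * complex_of_real (flat_exp (m + 1) (N * x $ i + b))))" for j
    by (rule diffk_mult[OF diffk_const diffk_add[OF Suc diffk_mult[OF diffk_const Suc]]])
  have cont: "continuous_on UNIV (\<lambda>x::real^'a. complex_of_real (flat_exp m (N * x $ i + b)))"
    by (auto intro!: continuous_intros continuous_on_compose2[OF flat_exp_cont])
  show ?case
    unfolding diffk.simps
  proof (intro conjI allI)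
    show "\<exists>F'. (\<forall>x::real^'a. ((\<lambda>h. complex_of_real (flat_exp m (N * (x + h *\<^sub>R axis j 1) $ i + b)))
        has_vector_derivative F' x) (at 0)) \<and> diffk k F'" for j
      by (rule exI, rule conjI, rule allI, rule deriv, rule diff)
  qed (rule cont)
qed

text \<open>Each coordinate contributes one flat factor per face of the box, so the product is
  nonzero exactly in the open interior. The scale \<open>N\<close> sharpens the faces: as it grows
  the bumps converge pointwise to the indicator of the open box.\<close>

definition box_bump :: "real \<Rightarrow> real^'n \<Rightarrow> real^'n \<Rightarrow> real^'n::finite \<Rightarrow> complex" where
  "box_bump N a c x = (\<Prod>i\<in>UNIV. complex_of_real (flat_exp 0 (N * x $ i + - N * a $ i)) *
     complex_of_real (flat_exp 0 (- N * x $ i + N * c $ i)))"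

lemma box_bump_nonzero_iff:
  assumes "N > 0"
  shows "box_bump N a c x \<noteq> 0 \<longleftrightarrow> x \<in> box a c"
  using assms by (auto simp: box_bump_def prod_zero_iff flat_exp_def mem_box_cart)

lemma test_fun_box_bump:
  assumes "N > 0"
  shows "test_fun (box_bump N a c)"
proof -
  have "{x. box_bump N a c x \<noteq> 0} \<subseteq> box a c"
    using box_bump_nonzero_iff[OF assms] by auto
  then have "bounded {x. box_bump N a c x \<noteq> 0}"
    using bounded_box bounded_subset by blast
  then show ?thesis
    unfolding test_fun_iff box_bump_def[abs_def]
    by (intro conjI allI diffk_prod diffk_mult diffk_flat_exp) auto
qed

lemma box_bump_real:
  "box_bump N a c x = of_real (Re (box_bump N a c x))" "0 \<le> Re (box_bump N a c x)" "norm (box_bump N a c x) \<le> 1"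
proof -
  let ?r = "\<Prod>i\<in>UNIV. flat_exp 0 (N * x $ i + - N * a $ i) * flat_exp 0 (- N * x $ i + N * c $ i)"
  have eq: "box_bump N a c x = of_real ?r"
    by (simp add: box_bump_def)
  have 01: "0 \<le> ?r" "?r \<le> 1"
    by (auto intro!: prod_nonneg prod_le_1 mult_nonneg_nonneg mult_le_one flat_exp_bounds)
  show "box_bump N a c x = of_real (Re (box_bump N a c x))" "0 \<le> Re (box_bump N a c x)" "norm (box_bump N a c x) \<le> 1"
    using 01 unfolding eq by (auto simp del: of_real_prod of_real_mult)
qed

lemma box_bump_tendsto: "(\<lambda>N. box_bump (real (Suc N)) a c x) \<longlonglongrightarrow> indicator (box a c) x"
proof (cases "x \<in> box a c")
  case False
  then show ?thesis
    using box_bump_nonzero_iff[of "real (Suc _)" a c x] by (simp del: of_nat_Suc)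
next
  case True
  have 1: "(\<lambda>N. complex_of_real (flat_exp 0 (real (Suc N) * d))) \<longlonglongrightarrow> 1" if "d > 0" for d
  proof -
    have "(\<lambda>N. complex_of_real (exp (- ((1 / d) * inverse (real (Suc N)))))) \<longlonglongrightarrow> of_real (exp (- ((1 / d) * 0)))"
      by (intro tendsto_intros LIMSEQ_inverse_real_of_nat)
    moreover have "exp (- ((1 / d) * inverse (real (Suc N)))) = flat_exp 0 (real (Suc N) * d)" for N
      using that by (simp add: flat_exp_def field_simps del: of_nat_Suc)
    ultimately show ?thesis by simp
  qed
  have "(\<lambda>N. \<Prod>i\<in>UNIV. complex_of_real (flat_exp 0 (real (Suc N) * (x $ i - a $ i))) *
     complex_of_real (flat_exp 0 (real (Suc N) * (c $ i - x $ i)))) \<longlonglongrightarrow> (\<Prod>i\<in>(UNIV::'a set). 1 * 1)"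
    using True by (intro tendsto_prod tendsto_mult 1) (auto simp: mem_box_cart)
  moreover have "(\<Prod>i\<in>UNIV. complex_of_real (flat_exp 0 (real (Suc N) * (x $ i - a $ i))) *
     complex_of_real (flat_exp 0 (real (Suc N) * (c $ i - x $ i)))) = box_bump (real (Suc N)) a c x" for N
    unfolding box_bump_def by (intro prod.cong refl) (simp add: algebra_simps)
  ultimately show ?thesis using True by simp
qed

text \<open>Translates stay in the family, so a translated bump is again a test function without a
  separate closure property.\<close>

lemma box_bump_shift: "box_bump N a c (x + y) = box_bump N (a - y) (c - y) x"
  unfolding box_bump_def by (intro prod.cong refl) (simp add: algebra_simps)

section \<open>The space \<open>L\<^sup>2\<close>\<close>

definition l2 :: "(real^'n::finite \<Rightarrow> complex) \<Rightarrow> bool" where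
  "l2 u \<longleftrightarrow> u \<in> borel_measurable lborel \<and> integrable lborel (\<lambda>x. (cmod (u x))\<^sup>2)"

definition l2norm :: "(real^'n::finite \<Rightarrow> complex) \<Rightarrow> real" where
  "l2norm u = sqrt (\<integral>x. (cmod (u x))\<^sup>2 \<partial>lborel)"

definition l2inner :: "(real^'n::finite \<Rightarrow> complex) \<Rightarrow> (real^'n \<Rightarrow> complex) \<Rightarrow> complex" where
  "l2inner u v = (\<integral>x. cnj (u x) * v x \<partial>lborel)"

lemma l2_measurable: "l2 u \<Longrightarrow> u \<in> borel_measurable lborel"
  by (simp add: l2_def)

lemma l2_borel_measurable [measurable_dest]: "l2 u \<Longrightarrow> u \<in> borel_measurable borel"
  by (simp add: l2_def)

lemma l2_integrable: "l2 u \<Longrightarrow> integrable lborel (\<lambda>x. (cmod (u x))\<^sup>2)"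
  by (simp add: l2_def)

lemma l2norm_nonneg [simp]: "0 \<le> l2norm u"
  by (simp add: l2norm_def)

lemma l2norm_sq: "(l2norm u)\<^sup>2 = (\<integral>x. (cmod (u x))\<^sup>2 \<partial>lborel)"
  by (simp add: l2norm_def)

lemma borel_measurable_cnj [measurable]: "cnj \<in> borel_measurable borel"
  by (intro borel_measurable_continuous_onI continuous_intros)

lemma l2_dominated:
  assumes "l2 v" "u \<in> borel_measurable lborel" "AE x in lborel. cmod (u x) \<le> c * cmod (v x)"
  shows "l2 u"
  unfolding l2_def
proof
  note [measurable] = assms(2) l2_measurable[OF assms(1)]
  show "integrable lborel (\<lambda>x. (cmod (u x))\<^sup>2)"
  proof (rule Bochner_Integration.integrable_bound)
    show "integrable lborel (\<lambda>x. c\<^sup>2 * (cmod (v x))\<^sup>2)"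
      using l2_integrable[OF assms(1)] by simp
    show "AE x in lborel. norm ((cmod (u x))\<^sup>2) \<le> norm (c\<^sup>2 * (cmod (v x))\<^sup>2)"
      using assms(3)
    proof eventually_elim
      case (elim x)
      then have "(cmod (u x))\<^sup>2 \<le> (c * cmod (v x))\<^sup>2" by (intro power_mono) auto
      then show ?case by (simp add: power_mult_distrib)
    qed
  qed simp
qed (rule assms)

lemma l2_zero [simp]: "l2 (\<lambda>_. 0)"
  by (simp add: l2_def)

lemma l2_add:
  assumes "l2 u" "l2 v"
  shows "l2 (\<lambda>x. u x + v x)"
  unfolding l2_def
proof
  note [measurable] = assms[THEN l2_measurable]
  show "(\<lambda>x. u x + v x) \<in> borel_measurable lborel" by simp
  show "integrable lborel (\<lambda>x. (cmod (u x + v x))\<^sup>2)"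
  proof (rule Bochner_Integration.integrable_bound)
    show "integrable lborel (\<lambda>x. 2 * (cmod (u x))\<^sup>2 + 2 * (cmod (v x))\<^sup>2)"
      using assms[THEN l2_integrable] by simp
    have "(cmod (u x + v x))\<^sup>2 \<le> 2 * (cmod (u x))\<^sup>2 + 2 * (cmod (v x))\<^sup>2" for x
    proof -
      have "(cmod (u x + v x))\<^sup>2 \<le> (cmod (u x) + cmod (v x))\<^sup>2"
        by (intro power_mono norm_triangle_ineq) auto
      also have "\<dots> \<le> 2 * (cmod (u x))\<^sup>2 + 2 * (cmod (v x))\<^sup>2"
        using zero_le_power2[of "cmod (u x) - cmod (v x)"] by (simp add: power2_eq_square algebra_simps)
      finally show ?thesis .
    qed
    then show "AE x in lborel. norm ((cmod (u x + v x))\<^sup>2) \<le> norm (2 * (cmod (u x))\<^sup>2 + 2 * (cmod (v x))\<^sup>2)"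
      by simp
  qed simp
qed

lemma l2_cmult: "l2 u \<Longrightarrow> l2 (\<lambda>x. c * u x)"
  by (auto simp: l2_def norm_mult power_mult_distrib)

lemma l2_diff: "l2 u \<Longrightarrow> l2 v \<Longrightarrow> l2 (\<lambda>x. u x - v x)"
  using l2_add[of u "\<lambda>x. (-1) * v x"] l2_cmult[of v "-1"] by simp

lemma l2_cnj: "l2 u \<Longrightarrow> l2 (\<lambda>x. cnj (u x))"
  by (auto simp: l2_def intro: measurable_compose[OF _ borel_measurable_cnj])

lemma l2_norm_mult_integrable:
  assumes "l2 u" "l2 v"
  shows "integrable lborel (\<lambda>x. cmod (u x) * cmod (v x))"
proof (rule Bochner_Integration.integrable_bound)
  note [measurable] = assms[THEN l2_measurable]
  show "integrable lborel (\<lambda>x. (cmod (u x))\<^sup>2 + (cmod (v x))\<^sup>2)"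
    using assms[THEN l2_integrable] by simp
  have "a * b \<le> a\<^sup>2 + b\<^sup>2" if "0 \<le> a" "0 \<le> b" for a b :: real
    using zero_le_power2[of "a - b"] zero_le_power2[of "a + b"] by (simp add: power2_eq_square algebra_simps)
  then show "AE x in lborel. norm (cmod (u x) * cmod (v x)) \<le> norm ((cmod (u x))\<^sup>2 + (cmod (v x))\<^sup>2)"
    by simp
  show "(\<lambda>x. cmod (u x) * cmod (v x)) \<in> borel_measurable lborel" by simp
qed

lemma l2_inner_integrable:
  assumes "l2 u" "l2 v"
  shows "integrable lborel (\<lambda>x. cnj (u x) * v x)"
proof (rule Bochner_Integration.integrable_bound[OF l2_norm_mult_integrable[OF assms]])
  note [measurable] = assms[THEN l2_measurable]
  show "(\<lambda>x. cnj (u x) * v x) \<in> borel_measurable lborel" by simp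
qed (simp add: norm_mult)

text \<open>The weighted inequality 2 a b <= s a^2 + b^2 / s is integrated with the weight that
  balances the two norms.\<close>

lemma l2_norm_mult_le:
  assumes "l2 u" "l2 v"
  shows "(\<integral>x. cmod (u x) * cmod (v x) \<partial>lborel) \<le> l2norm u * l2norm v"
proof -
  define A B where "A = l2norm u" and "B = l2norm v"
  have AB: "0 \<le> A" "0 \<le> B" by (auto simp: A_def B_def)
  have *: "(\<integral>x. cmod (u x) * cmod (v x) \<partial>lborel) \<le> (A * (B + e) + B * (A + e)) / 2" if "e > 0" for e
  proof -
    \<comment> \<open>The ideal weight is B / A; adding \<open>e\<close> keeps it positive and
      finite when one of the norms vanishes.\<close>
    define s where "s = (B + e) / (A + e)"
    have s: "s > 0" using AB that by (auto simp: s_def)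
    have "(\<integral>x. cmod (u x) * cmod (v x) \<partial>lborel) \<le>
        (\<integral>x. (s * (cmod (u x))\<^sup>2 + (cmod (v x))\<^sup>2 / s) / 2 \<partial>lborel)"
    proof (rule integral_mono[OF l2_norm_mult_integrable[OF assms]])
      show "integrable lborel (\<lambda>x. (s * (cmod (u x))\<^sup>2 + (cmod (v x))\<^sup>2 / s) / 2)"
        using assms[THEN l2_integrable] by simp
      show "cmod (u x) * cmod (v x) \<le> (s * (cmod (u x))\<^sup>2 + (cmod (v x))\<^sup>2 / s) / 2" for x
      proof -
        have "0 \<le> (s * cmod (u x) - cmod (v x))\<^sup>2 / s" using s by simp
        also have "\<dots> = s * (cmod (u x))\<^sup>2 + (cmod (v x))\<^sup>2 / s - 2 * cmod (u x) * cmod (v x)"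
          using s by (simp add: power2_eq_square field_simps)
        finally show ?thesis by simp
      qed
    qed
    also have "\<dots> = (s * A\<^sup>2 + B\<^sup>2 / s) / 2"
      using assms[THEN l2_integrable] by (simp add: A_def B_def l2norm_sq)
    also have "s * A\<^sup>2 \<le> A * (B + e)"
    proof -
      have "s * A\<^sup>2 = (B + e) * A * (A / (A + e))"
        using AB that by (simp add: s_def power2_eq_square field_simps)
      also have "\<dots> \<le> (B + e) * A * 1"
        using AB that by (intro mult_left_mono) auto
      finally show ?thesis by (simp add: algebra_simps)
    qed
    also have "B\<^sup>2 / s \<le> B * (A + e)"
    proof -
      have "B\<^sup>2 / s = (A + e) * B * (B / (B + e))"
        using AB that by (simp add: s_def power2_eq_square field_simps)
      also have "\<dots> \<le> (A + e) * B * 1"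
        using AB that by (intro mult_left_mono) auto
      finally show ?thesis by (simp add: algebra_simps)
    qed
    finally show ?thesis by simp
  qed
  have "(\<integral>x. cmod (u x) * cmod (v x) \<partial>lborel) \<le> A * B + e" if "e > 0" for e
  proof -
    define d where "d = 2 * e / (A + B + 1)"
    have "d > 0" using AB that by (simp add: d_def)
    have "(A + B) * d \<le> (A + B + 1) * d" using \<open>d > 0\<close> by simp
    also have "\<dots> = 2 * e" using AB by (simp add: d_def)
    finally have "(A * (B + d) + B * (A + d)) / 2 \<le> A * B + e" by (simp add: algebra_simps)
    then show ?thesis using *[OF \<open>d > 0\<close>] by linarith
  qed
  then show ?thesis
    unfolding A_def B_def by (rule field_le_epsilon)
qed

lemma l2_cauchy_schwarz:
  assumes "l2 u" "l2 v"
  shows "cmod (l2inner u v) \<le> l2norm u * l2norm v"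
proof -
  have "cmod (l2inner u v) \<le> (\<integral>x. cmod (cnj (u x) * v x) \<partial>lborel)"
    unfolding l2inner_def by (rule integral_norm_bound)
  also have "\<dots> = (\<integral>x. cmod (u x) * cmod (v x) \<partial>lborel)"
    by (simp add: norm_mult)
  finally show ?thesis using l2_norm_mult_le[OF assms] by simp
qed

lemma l2norm_triangle:
  assumes "l2 u" "l2 v"
  shows "l2norm (\<lambda>x. u x + v x) \<le> l2norm u + l2norm v"
proof (rule power2_le_imp_le)
  have "(l2norm (\<lambda>x. u x + v x))\<^sup>2 \<le> (\<integral>x. (cmod (u x))\<^sup>2 + 2 * (cmod (u x) * cmod (v x)) + (cmod (v x))\<^sup>2 \<partial>lborel)"
    unfolding l2norm_sq
  proof (rule integral_mono[OF l2_integrable[OF l2_add[OF assms]]])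
    show "integrable lborel (\<lambda>x. (cmod (u x))\<^sup>2 + 2 * (cmod (u x) * cmod (v x)) + (cmod (v x))\<^sup>2)"
      using assms[THEN l2_integrable] l2_norm_mult_integrable[OF assms] by simp
    show "(cmod (u x + v x))\<^sup>2 \<le> (cmod (u x))\<^sup>2 + 2 * (cmod (u x) * cmod (v x)) + (cmod (v x))\<^sup>2" for x
      using power_mono[OF norm_triangle_ineq[of "u x" "v x"], of 2]
      by (simp add: power2_sum algebra_simps)
  qed
  also have "\<dots> = (l2norm u)\<^sup>2 + 2 * (\<integral>x. cmod (u x) * cmod (v x) \<partial>lborel) + (l2norm v)\<^sup>2"
    using assms[THEN l2_integrable] l2_norm_mult_integrable[OF assms] by (simp add: l2norm_sq)
  also have "\<dots> \<le> (l2norm u + l2norm v)\<^sup>2"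
    using l2_norm_mult_le[OF assms] by (simp add: power2_sum algebra_simps)
  finally show "(l2norm (\<lambda>x. u x + v x))\<^sup>2 \<le> (l2norm u + l2norm v)\<^sup>2" .
qed simp

lemma l2norm_cmult: "l2norm (\<lambda>x. c * u x) = cmod c * l2norm u"
  by (simp add: l2norm_def norm_mult power_mult_distrib real_sqrt_mult)

lemma l2norm_minus_commute: "l2norm (\<lambda>x. u x - v x) = l2norm (\<lambda>x. v x - u x)"
  by (simp add: l2norm_def norm_minus_commute)

lemma l2norm_diff_triangle:
  assumes "l2 u" "l2 v" "l2 w"
  shows "l2norm (\<lambda>x. u x - w x) \<le> l2norm (\<lambda>x. u x - v x) + l2norm (\<lambda>x. v x - w x)"
  using l2norm_triangle[OF l2_diff[OF assms(1,2)] l2_diff[OF assms(2,3)]] by simp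

lemma l2norm_triangle_sub:
  assumes "l2 u" "l2 v"
  shows "l2norm u \<le> l2norm v + l2norm (\<lambda>x. u x - v x)"
  using l2norm_triangle[OF assms(2) l2_diff[OF assms]] by simp

lemma l2norm_mono_AE:
  assumes "l2 v" "u \<in> borel_measurable lborel" "AE x in lborel. cmod (u x) \<le> c * cmod (v x)" "0 \<le> c"
  shows "l2norm u \<le> c * l2norm v"
proof -
  have "(\<integral>x. (cmod (u x))\<^sup>2 \<partial>lborel) \<le> (\<integral>x. c\<^sup>2 * (cmod (v x))\<^sup>2 \<partial>lborel)"
  proof (rule integral_mono_AE)
    show "integrable lborel (\<lambda>x. (cmod (u x))\<^sup>2)"
      using l2_dominated[OF assms(1-3)] by (rule l2_integrable)
    show "integrable lborel (\<lambda>x. c\<^sup>2 * (cmod (v x))\<^sup>2)"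
      using l2_integrable[OF assms(1)] by simp
    show "AE x in lborel. (cmod (u x))\<^sup>2 \<le> c\<^sup>2 * (cmod (v x))\<^sup>2"
      using assms(3)
    proof eventually_elim
      case (elim x)
      then have "(cmod (u x))\<^sup>2 \<le> (c * cmod (v x))\<^sup>2" by (intro power_mono) auto
      then show ?case by (simp add: power_mult_distrib)
    qed
  qed
  then have "l2norm u \<le> sqrt (c\<^sup>2 * (\<integral>x. (cmod (v x))\<^sup>2 \<partial>lborel))"
    by (simp add: l2norm_def)
  then show ?thesis
    using assms(4) by (simp add: l2norm_def real_sqrt_mult)
qed

lemma l2norm_cong_AE:
  assumes "u \<in> borel_measurable lborel" "v \<in> borel_measurable lborel" "AE x in lborel. u x = v x"
  shows "l2norm u = l2norm v"
  unfolding l2norm_def using assms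
  by (intro arg_cong[where f = sqrt] integral_cong_AE) auto

lemma l2norm_eq_0_AE:
  assumes "l2 u" "l2norm u = 0"
  shows "AE x in lborel. u x = 0"
proof -
  have "(\<integral>x. (cmod (u x))\<^sup>2 \<partial>lborel) = 0"
    using assms(2) by (simp add: l2norm_def)
  then have "AE x in lborel. (cmod (u x))\<^sup>2 = 0"
    using l2_integrable[OF assms(1)] by (subst (asm) integral_nonneg_eq_0_iff_AE) auto
  then show ?thesis by simp
qed

lemma l2inner_self: "l2 u \<Longrightarrow> l2inner u u = of_real ((l2norm u)\<^sup>2)"
  unfolding l2inner_def l2norm_sq integral_complex_of_real[symmetric]
  by (intro Bochner_Integration.integral_cong refl) (simp add: complex_norm_square mult.commute flip: of_real_power)

lemma l2inner_diff_right: "l2 u \<Longrightarrow> l2 v \<Longrightarrow> l2 w \<Longrightarrow> l2inner u (\<lambda>x. v x - w x) = l2inner u v - l2inner u w"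
  unfolding l2inner_def
  by (subst Bochner_Integration.integral_diff[symmetric]) (auto simp: l2_inner_integrable ring_distribs)

lemma l2inner_diff_left: "l2 u \<Longrightarrow> l2 v \<Longrightarrow> l2 w \<Longrightarrow> l2inner (\<lambda>x. v x - w x) u = l2inner v u - l2inner w u"
  unfolding l2inner_def
  by (subst Bochner_Integration.integral_diff[symmetric]) (auto simp: l2_inner_integrable ring_distribs)

lemma l2inner_tendsto_left:
  assumes "\<And>n. l2 (u n)" "l2 v" "l2 w" "(\<lambda>n. l2norm (\<lambda>x. u n x - v x)) \<longlonglongrightarrow> 0"
  shows "(\<lambda>n. l2inner (u n) w) \<longlonglongrightarrow> l2inner v w"
proof (rule LIM_zero_cancel, rule Lim_null_comparison)
  show "\<forall>\<^sub>F n in sequentially. cmod (l2inner (u n) w - l2inner v w) \<le> l2norm (\<lambda>x. u n x - v x) * l2norm w"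
    using l2_cauchy_schwarz[OF l2_diff[OF assms(1,2)] assms(3)]
    by (simp add: l2inner_diff_left assms)
  show "(\<lambda>n. l2norm (\<lambda>x. u n x - v x) * l2norm w) \<longlonglongrightarrow> 0"
    using tendsto_mult_left_zero[OF assms(4)] by simp
qed

lemma l2inner_tendsto_right:
  assumes "\<And>n. l2 (u n)" "l2 v" "l2 w" "(\<lambda>n. l2norm (\<lambda>x. u n x - v x)) \<longlonglongrightarrow> 0"
  shows "(\<lambda>n. l2inner w (u n)) \<longlonglongrightarrow> l2inner w v"
proof (rule LIM_zero_cancel, rule Lim_null_comparison)
  show "\<forall>\<^sub>F n in sequentially. cmod (l2inner w (u n) - l2inner w v) \<le> l2norm w * l2norm (\<lambda>x. u n x - v x)"
    using l2_cauchy_schwarz[OF assms(3) l2_diff[OF assms(1,2)]]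
    by (simp add: l2inner_diff_right assms)
  show "(\<lambda>n. l2norm w * l2norm (\<lambda>x. u n x - v x)) \<longlonglongrightarrow> 0"
    using tendsto_mult_right_zero[OF assms(4)] by simp
qed

lemma l2norm_tendsto:
  assumes "\<And>n. l2 (u n)" "l2 v" "(\<lambda>n. l2norm (\<lambda>x. u n x - v x)) \<longlonglongrightarrow> 0"
  shows "(\<lambda>n. l2norm (u n)) \<longlonglongrightarrow> l2norm v"
proof (rule LIM_zero_cancel, rule Lim_null_comparison[OF _ assms(3)])
  have "\<bar>l2norm (u n) - l2norm v\<bar> \<le> l2norm (\<lambda>x. u n x - v x)" for n
    using l2norm_triangle_sub[OF assms(1)[of n] assms(2)] l2norm_triangle_sub[OF assms(2) assms(1)[of n]]
    by (simp add: l2norm_minus_commute abs_le_iff)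
  then show "\<forall>\<^sub>F n in sequentially. norm (l2norm (u n) - l2norm v) \<le> l2norm (\<lambda>x. u n x - v x)"
    by simp
qed

section \<open>Limit theorems and completeness in L^2\<close>

lemma l2_dominated_convergence:
  assumes meas: "\<And>n. u n \<in> borel_measurable lborel" "v \<in> borel_measurable lborel"
    and lim: "AE x in lborel. (\<lambda>n. u n x) \<longlonglongrightarrow> v x"
    and dom: "integrable lborel (\<lambda>x. (g x)\<^sup>2)" "\<And>n. AE x in lborel. cmod (u n x) \<le> g x"
  shows "l2 v" "(\<lambda>n. l2norm (\<lambda>x. u n x - v x)) \<longlonglongrightarrow> 0"
proof -
  note [measurable] = meas
  have dom': "AE x in lborel. \<forall>n. cmod (u n x) \<le> g x"
    using dom(2) by (simp add: AE_all_countable)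
  have v: "AE x in lborel. cmod (v x) \<le> g x"
    using lim dom'
  proof eventually_elim
    case (elim x)
    then show ?case using LIMSEQ_le_const2[OF tendsto_norm[OF elim(1)]] by auto
  qed
  show "l2 v"
    unfolding l2_def
  proof
    show "integrable lborel (\<lambda>x. (cmod (v x))\<^sup>2)"
      by (rule Bochner_Integration.integrable_bound[OF dom(1)])
         (use v in \<open>auto elim!: eventually_mono intro: power_mono\<close>)
  qed (rule meas)
  have "(\<lambda>n. \<integral>x. (cmod (u n x - v x))\<^sup>2 \<partial>lborel) \<longlonglongrightarrow> (\<integral>x. 0 \<partial>(lborel :: (real^'a) measure))"
  proof (rule integral_dominated_convergence[where w = "\<lambda>x. 4 * (g x)\<^sup>2"])
    show "AE x in lborel. (\<lambda>n. (cmod (u n x - v x))\<^sup>2) \<longlonglongrightarrow> 0"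
      using lim
    proof eventually_elim
      case (elim x)
      then have "(\<lambda>n. (cmod (u n x - v x))\<^sup>2) \<longlonglongrightarrow> (cmod (v x - v x))\<^sup>2"
        by (intro tendsto_intros)
      then show ?case by simp
    qed
    show "AE x in lborel. norm ((cmod (u n x - v x))\<^sup>2) \<le> 4 * (g x)\<^sup>2" for n
      using dom(2)[of n] v
    proof eventually_elim
      case (elim x)
      then have "cmod (u n x - v x) \<le> 2 * g x"
        using norm_triangle_ineq4[of "u n x" "v x"] by linarith
      then have "(cmod (u n x - v x))\<^sup>2 \<le> (2 * g x)\<^sup>2" by (intro power_mono) auto
      then show ?case by (simp add: power_mult_distrib)
    qed
  qed (use dom(1) in auto)
  then have "(\<lambda>n. sqrt (\<integral>x. (cmod (u n x - v x))\<^sup>2 \<partial>lborel)) \<longlonglongrightarrow> sqrt 0"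
    by (intro tendsto_real_sqrt) simp
  then show "(\<lambda>n. l2norm (\<lambda>x. u n x - v x)) \<longlonglongrightarrow> 0"
    by (simp add: l2norm_def)
qed

text \<open>Fatou's lemma for the squared moduli; passing on to the limsup lets a bound that holds
  only eventually control the limit.\<close>

lemma l2_fatou:
  assumes l2: "\<And>n. l2 (w n)" and v: "v \<in> borel_measurable lborel"
    and lim: "AE x in lborel. (\<lambda>n. w n x) \<longlonglongrightarrow> v x" and bd: "\<forall>\<^sub>F n in sequentially. l2norm (w n) \<le> C"
    and C: "0 \<le> C"
  shows "l2 v" "l2norm v \<le> C"
proof -
  note [measurable] = v l2[THEN l2_measurable]
  have eq: "(\<integral>\<^sup>+x. ennreal ((cmod (w n x))\<^sup>2) \<partial>lborel) = ennreal ((l2norm (w n))\<^sup>2)" for n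
    unfolding l2norm_sq using l2_integrable[OF l2[of n]] by (intro nn_integral_eq_integral) auto
  have "(\<integral>\<^sup>+x. ennreal ((cmod (v x))\<^sup>2) \<partial>lborel) = (\<integral>\<^sup>+x. liminf (\<lambda>n. ennreal ((cmod (w n x))\<^sup>2)) \<partial>lborel)"
  proof (rule nn_integral_cong_AE)
    show "AE x in lborel. ennreal ((cmod (v x))\<^sup>2) = liminf (\<lambda>n. ennreal ((cmod (w n x))\<^sup>2))"
      using lim
    proof eventually_elim
      case (elim x)
      then have "(\<lambda>n. ennreal ((cmod (w n x))\<^sup>2)) \<longlonglongrightarrow> ennreal ((cmod (v x))\<^sup>2)"
        by (intro tendsto_intros tendsto_ennrealI)
      then show ?case using lim_imp_Liminf[OF sequentially_bot] by metis
    qed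
  qed
  also have "\<dots> \<le> liminf (\<lambda>n. \<integral>\<^sup>+x. ennreal ((cmod (w n x))\<^sup>2) \<partial>lborel)"
    by (rule nn_integral_liminf) simp
  also have "\<dots> \<le> limsup (\<lambda>n. \<integral>\<^sup>+x. ennreal ((cmod (w n x))\<^sup>2) \<partial>lborel)"
    by (rule Liminf_le_Limsup) simp
  also have "\<dots> \<le> ennreal (C\<^sup>2)"
  proof (rule Limsup_bounded)
    show "\<forall>\<^sub>F n in sequentially. (\<integral>\<^sup>+x. ennreal ((cmod (w n x))\<^sup>2) \<partial>lborel) \<le> ennreal (C\<^sup>2)"
      using bd by eventually_elim (auto simp: eq intro!: ennreal_leI power_mono)
  qed
  finally have le: "(\<integral>\<^sup>+x. ennreal ((cmod (v x))\<^sup>2) \<partial>lborel) \<le> ennreal (C\<^sup>2)" .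
  then have int: "integrable lborel (\<lambda>x. (cmod (v x))\<^sup>2)"
    by (intro integrableI_bounded) (auto simp: le_less_trans)
  then show "l2 v" by (simp add: l2_def v[simplified])
  have "ennreal ((l2norm v)\<^sup>2) \<le> ennreal (C\<^sup>2)"
    unfolding l2norm_sq using le int by (subst nn_integral_eq_integral[symmetric]) auto
  then have "(l2norm v)\<^sup>2 \<le> C\<^sup>2" by simp
  then show "l2norm v \<le> C" using C by (rule power2_le_imp_le)
qed

text \<open>The Riesz-Fischer argument: a subsequence with increments below 2^-k has a
  square-integrable sum of absolute increments, hence converges almost everywhere. Fatou then
  carries the Cauchy estimate over to the pointwise limit, for the full sequence.\<close>

lemma l2_complete:
  assumes l2: "\<And>n. l2 (u n)"
    and cauchy: "\<And>e. e > 0 \<Longrightarrow> \<exists>N. \<forall>m\<ge>N. \<forall>n\<ge>N. l2norm (\<lambda>x. u m x - u n x) < e"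
  obtains v where "l2 v" "(\<lambda>n. l2norm (\<lambda>x. u n x - v x)) \<longlonglongrightarrow> 0"
proof -
  note [measurable] = l2[THEN l2_measurable]
  obtain N where N: "\<And>k m n. m \<ge> N k \<Longrightarrow> n \<ge> N k \<Longrightarrow> l2norm (\<lambda>x. u m x - u n x) < (1/2) ^ k" for k :: nat
  proof -
    have "\<forall>k. \<exists>N. \<forall>m\<ge>N. \<forall>n\<ge>N. l2norm (\<lambda>x. u m x - u n x) < (1/2) ^ k"
      using cauchy by simp
    then show ?thesis using that by metis
  qed
  \<comment> \<open>Partial sums make the indices monotone, so that \<open>R k\<close> and
    \<open>R (Suc k)\<close> both lie beyond \<open>N k\<close>.\<close>
  define R where "R k = (\<Sum>j\<le>k. N j)" for k
  have R: "N k \<le> R j" if "k \<le> j" for k j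
    using that unfolding R_def by (intro member_le_sum) auto
  have RS: "N k \<le> R k" "N k \<le> R (Suc k)" for k
    using R by auto
  \<comment> \<open>The absolute increments are kept complex-valued so that the triangle inequality
    for \<open>l2norm\<close> applies to their sums.\<close>
  define D where "D k x = complex_of_real (cmod (u (R (Suc k)) x - u (R k) x))" for k x
  have Dm: "D k \<in> borel_measurable lborel" for k
    unfolding D_def[abs_def] by measurable
  have l2D: "l2 (D k)" for k
    by (rule l2_dominated[OF l2_diff[OF l2[of "R (Suc k)"] l2[of "R k"]] Dm, where c = 1])
       (simp add: D_def)
  have nD: "l2norm (D k) \<le> (1/2) ^ k" for k
    using N[OF RS(2) RS(1), of k] by (simp add: l2norm_def D_def)
  have S: "l2 (\<lambda>x. \<Sum>k<K. D k x) \<and> l2norm (\<lambda>x. \<Sum>k<K. D k x) \<le> (\<Sum>k<K. (1/2) ^ k)" for K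
  proof (induction K)
    case 0
    then show ?case by (simp add: l2norm_def)
  next
    case (Suc K)
    then show ?case
      using l2norm_triangle[OF conjunct1[OF Suc] l2D[of K]] nD[of K] l2_add[OF conjunct1[OF Suc] l2D[of K]]
      by simp
  qed
  have S2: "l2norm (\<lambda>x. \<Sum>k<K. D k x) \<le> 2" for K
  proof -
    have "(\<Sum>k<K. (1/2::real) ^ k) \<le> (\<Sum>k. (1/2) ^ k)"
      by (intro sum_le_suminf summable_geometric) auto
    also have "\<dots> = 2" by (subst suminf_geometric) auto
    finally show ?thesis using S[of K] by linarith
  qed
  define s where "s K x = (\<Sum>k<K. cmod (u (R (Suc k)) x - u (R k) x))" for K x
  have Ds: "(\<Sum>k<K. D k x) = complex_of_real (s K x)" for K x
    by (simp add: D_def s_def)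
  have s0: "0 \<le> s K x" for K x unfolding s_def by (intro sum_nonneg) auto
  have sm [measurable]: "s K \<in> borel_measurable lborel" for K unfolding s_def by measurable
  have smono: "s K x \<le> s (Suc K) x" for K x unfolding s_def by simp
  have inc: "incseq (\<lambda>K x. ennreal ((s K x)\<^sup>2))"
    by (intro incseq_SucI le_funI ennreal_leI power_mono smono s0)
  have le4: "(\<integral>\<^sup>+x. ennreal ((s K x)\<^sup>2) \<partial>lborel) \<le> ennreal 4" for K
  proof -
    have "(\<integral>\<^sup>+x. ennreal ((s K x)\<^sup>2) \<partial>lborel) = ennreal ((l2norm (\<lambda>x. \<Sum>k<K. D k x))\<^sup>2)"
      unfolding l2norm_sq Ds using l2_integrable[OF conjunct1[OF S[of K]]]
      by (subst nn_integral_eq_integral) (auto simp: Ds)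
    also have "\<dots> \<le> ennreal (2\<^sup>2)"
      by (intro ennreal_leI power_mono S2) auto
    finally show ?thesis by simp
  qed
  have "(\<integral>\<^sup>+x. (SUP K. ennreal ((s K x)\<^sup>2)) \<partial>lborel) = (SUP K. \<integral>\<^sup>+x. ennreal ((s K x)\<^sup>2) \<partial>lborel)"
    using inc by (intro nn_integral_monotone_convergence_SUP) auto
  also have "\<dots> \<le> ennreal 4" using le4 by (intro SUP_least)
  finally have fin: "(\<integral>\<^sup>+x. (SUP K. ennreal ((s K x)\<^sup>2)) \<partial>lborel) \<noteq> \<infinity>"
    unfolding infinity_ennreal_def by (rule neq_top_trans[OF ennreal_neq_top])
  have "AE x in lborel. (SUP K. ennreal ((s K x)\<^sup>2)) \<noteq> \<infinity>"
    using fin by (intro nn_integral_PInf_AE) auto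
  then have conv: "AE x in lborel. convergent (\<lambda>k. u (R k) x)"
  proof eventually_elim
    case (elim x)
    then obtain c where c: "(SUP K. ennreal ((s K x)\<^sup>2)) = ennreal c" "c \<ge> 0"
      by (metis ennreal_cases infinity_ennreal_def)
    have "(s K x)\<^sup>2 \<le> c" for K
    proof -
      have "ennreal ((s K x)\<^sup>2) \<le> ennreal c"
        unfolding c(1)[symmetric] by (intro SUP_upper) auto
      then show ?thesis using c(2) by simp
    qed
    then have sb: "s K x \<le> sqrt c" for K using real_le_rsqrt by blast
    have "summable (\<lambda>k. cmod (u (R (Suc k)) x - u (R k) x))"
      by (rule summableI_nonneg_bounded[where x = "sqrt c"]) (use sb in \<open>auto simp: s_def\<close>)
    then have "summable (\<lambda>k. u (R (Suc k)) x - u (R k) x)"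
      by (rule summable_norm_cancel)
    then have "convergent (\<lambda>n. \<Sum>k<n. u (R (Suc k)) x - u (R k) x)"
      by (simp add: summable_iff_convergent)
    then have "convergent (\<lambda>n. u (R n) x - u (R 0) x)"
      by (simp add: sum_lessThan_telescope[where f = "\<lambda>n. u (R n) x"])
    then have "convergent (\<lambda>n. (u (R n) x - u (R 0) x) + u (R 0) x)"
      by (intro convergent_add convergent_const)
    then show ?case by simp
  qed
  define v where "v x = lim (\<lambda>k. u (R k) x)" for x
  have vm [measurable]: "v \<in> borel_measurable lborel"
    unfolding v_def by (rule borel_measurable_lim_metric) simp
  have lim: "AE x in lborel. (\<lambda>k. u (R k) x) \<longlonglongrightarrow> v x"
    using conv by eventually_elim (simp add: v_def convergent_LIMSEQ_iff)
  have bd: "l2 (\<lambda>x. u n x - v x) \<and> l2norm (\<lambda>x. u n x - v x) \<le> (1/2)^j" if n: "n \<ge> N j" for n j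
  proof -
    have "AE x in lborel. (\<lambda>k. u n x - u (R k) x) \<longlonglongrightarrow> u n x - v x"
      using lim by eventually_elim (intro tendsto_intros)
    moreover have "\<forall>\<^sub>F k in sequentially. l2norm (\<lambda>x. u n x - u (R k) x) \<le> (1/2)^j"
      using eventually_ge_at_top[of j] by eventually_elim (use N[OF n R] in \<open>force intro: less_imp_le\<close>)
    ultimately show ?thesis
      using l2_fatou[of "\<lambda>k x. u n x - u (R k) x" "\<lambda>x. u n x - v x" "(1/2)^j"] l2_diff[OF l2 l2] by simp
  qed
  have "l2 v"
    using l2_diff[OF l2[of "N 0"], of "\<lambda>x. u (N 0) x - v x"] bd[of 0 "N 0"] by simp
  moreover have "(\<lambda>n. l2norm (\<lambda>x. u n x - v x)) \<longlonglongrightarrow> 0"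
  proof (rule LIMSEQ_I)
    fix e :: real assume "e > 0"
    then obtain j where j: "(1/2::real)^j < e" using real_arch_pow_inv[of e "1/2"] by auto
    have "\<forall>n\<ge>N j. norm (l2norm (\<lambda>x. u n x - v x) - 0) < e"
      using bd j by (fastforce intro: le_less_trans)
    then show "\<exists>no. \<forall>n\<ge>no. norm (l2norm (\<lambda>x. u n x - v x) - 0) < e" by blast
  qed
  ultimately show thesis by (rule that)
qed

section \<open>Density of test functions in L^2\<close>

lemma cc_bound:
  fixes F :: "real^'n::finite \<Rightarrow> complex"
  assumes "continuous_on UNIV F" "bounded {x. F x \<noteq> 0}"
  obtains B R where "0 \<le> B" "0 < R" "\<And>x. cmod (F x) \<le> B" "\<And>x. F x \<noteq> 0 \<Longrightarrow> norm x \<le> R"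
proof -
  obtain R where R: "0 < R" "\<And>x. F x \<noteq> 0 \<Longrightarrow> norm x \<le> R"
    using assms(2) by (auto simp: bounded_pos)
  have "bounded (F ` cball 0 R)"
    by (intro compact_imp_bounded compact_continuous_image continuous_on_subset[OF assms(1)]) auto
  then obtain B where B: "0 < B" "\<And>x. x \<in> cball 0 R \<Longrightarrow> cmod (F x) \<le> B"
    by (auto simp: bounded_pos)
  have "cmod (F x) \<le> B" for x
  proof (cases "F x = 0")
    case False
    then show ?thesis using R B by auto
  qed (use B in auto)
  then show thesis using that[of B R] B R by auto
qed

lemma borel_measurable_cont: "continuous_on UNIV F \<Longrightarrow> F \<in> borel_measurable lborel"
  for F :: "real^'n::finite \<Rightarrow> complex"
  by (simp add: borel_measurable_continuous_onI)

lemma integrable_indicator_cball: "integrable lborel (\<lambda>x::'a::euclidean_space. B * indicator (cball a R) x :: real)"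
  by (intro integrable_mult_right integrable_real_indicator) (auto simp: emeasure_bounded_finite[OF bounded_cball, simplified])

lemma integrable_cc:
  fixes F :: "real^'n::finite \<Rightarrow> complex"
  assumes "continuous_on UNIV F" "bounded {x. F x \<noteq> 0}"
  shows "integrable lborel F"
proof -
  obtain B R where BR: "0 \<le> B" "0 < R" "\<And>x. cmod (F x) \<le> B" "\<And>x. F x \<noteq> 0 \<Longrightarrow> norm x \<le> R"
    using cc_bound[OF assms] by blast
  show ?thesis
  proof (rule Bochner_Integration.integrable_bound[OF integrable_indicator_cball[of B 0 R]])
    show "AE x in lborel. norm (F x) \<le> norm (B * indicator (cball 0 R) x :: real)"
      using BR by (intro AE_I2) (force simp: indicator_def)
  qed (rule borel_measurable_cont[OF assms(1)])
qed

lemma l2_if_integrable_bounded: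
  assumes "integrable lborel F" "\<And>x. cmod (F x) \<le> B"
  shows "l2 F"
  unfolding l2_def
proof
  show m: "F \<in> borel_measurable lborel" using assms(1) by auto
  show "integrable lborel (\<lambda>x. (cmod (F x))\<^sup>2)"
  proof (rule Bochner_Integration.integrable_bound)
    show "integrable lborel (\<lambda>x. B * cmod (F x))" using assms(1) by simp
    show "AE x in lborel. norm ((cmod (F x))\<^sup>2) \<le> norm (B * cmod (F x))"
      using assms(2)[THEN order_trans, OF abs_ge_self] by (intro AE_I2) (auto simp: power2_eq_square abs_mult intro!: mult_right_mono)
    show "(\<lambda>x. (cmod (F x))\<^sup>2) \<in> borel_measurable lborel" using m by measurable
  qed
qed

lemma l2_cc:
  fixes F :: "real^'n::finite \<Rightarrow> complex"
  assumes "continuous_on UNIV F" "bounded {x. F x \<noteq> 0}"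
  shows "l2 F"
  using integrable_cc[OF assms] cc_bound[OF assms] l2_if_integrable_bounded by metis

lemma test_fun_cc: "test_fun \<phi> \<Longrightarrow> continuous_on UNIV \<phi>" "test_fun \<phi> \<Longrightarrow> bounded {x. \<phi> x \<noteq> 0}"
  using test_fun_cont by (auto simp: test_fun_iff)

lemma test_fun_l2: "test_fun \<phi> \<Longrightarrow> l2 \<phi>"
  using l2_cc test_fun_cc by blast

lemma test_fun_integrable: "test_fun \<phi> \<Longrightarrow> integrable lborel \<phi>"
  using integrable_cc test_fun_cc by blast

text \<open>This is the L^2 closure of the test functions. As a predicate it can be propagated
  through sums, scalar multiples, limits and an induction over the Borel sets.\<close>

definition l2_approx :: "(real^'n::finite \<Rightarrow> complex) \<Rightarrow> bool" where
  "l2_approx u \<longleftrightarrow> l2 u \<and> (\<forall>e>0. \<exists>\<phi>. test_fun \<phi> \<and> l2norm (\<lambda>x. u x - \<phi> x) < e)"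

lemma l2_approx_l2: "l2_approx u \<Longrightarrow> l2 u"
  by (simp add: l2_approx_def)

lemma l2_approx_test_fun: "test_fun \<phi> \<Longrightarrow> l2_approx \<phi>"
  unfolding l2_approx_def by (intro conjI test_fun_l2 allI impI exI[of _ \<phi>]) (auto simp: l2norm_def)

lemma l2_approx_lim:
  assumes u: "l2 u" and v: "\<And>n. l2_approx (v n)" "(\<lambda>n. l2norm (\<lambda>x. v n x - u x)) \<longlonglongrightarrow> 0"
  shows "l2_approx u"
  unfolding l2_approx_def
proof (intro conjI u allI impI)
  fix e :: real assume e: "e > 0"
  then obtain n where n: "l2norm (\<lambda>x. v n x - u x) < e / 2"
    using LIMSEQ_D[OF v(2), of "e / 2"] by auto
  obtain \<phi> where \<phi>: "test_fun \<phi>" "l2norm (\<lambda>x. v n x - \<phi> x) < e / 2"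
    using v(1)[of n] e half_gt_zero unfolding l2_approx_def by blast
  have "l2norm (\<lambda>x. u x - \<phi> x) \<le> l2norm (\<lambda>x. u x - v n x) + l2norm (\<lambda>x. v n x - \<phi> x)"
    by (rule l2norm_diff_triangle[OF u l2_approx_l2[OF v(1)] test_fun_l2[OF \<phi>(1)]])
  then have "l2norm (\<lambda>x. u x - \<phi> x) < e"
    using n \<phi>(2) l2norm_minus_commute[of u "v n"] by linarith
  then show "\<exists>\<phi>. test_fun \<phi> \<and> l2norm (\<lambda>x. u x - \<phi> x) < e" using \<phi>(1) by blast
qed

lemma l2_approx_add:
  assumes "l2_approx u" "l2_approx v"
  shows "l2_approx (\<lambda>x. u x + v x)"
  unfolding l2_approx_def
proof (intro conjI allI impI)
  show "l2 (\<lambda>x. u x + v x)" using assms l2_approx_l2 l2_add by blast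
  fix e :: real assume "e > 0"
  then obtain \<phi> \<eta> where *: "test_fun \<phi>" "l2norm (\<lambda>x. u x - \<phi> x) < e / 2" "test_fun \<eta>" "l2norm (\<lambda>x. v x - \<eta> x) < e / 2"
    using assms half_gt_zero unfolding l2_approx_def by meson
  have "l2norm (\<lambda>x. (u x - \<phi> x) + (v x - \<eta> x)) \<le> l2norm (\<lambda>x. u x - \<phi> x) + l2norm (\<lambda>x. v x - \<eta> x)"
    using assms * by (intro l2norm_triangle l2_diff) (auto intro: l2_approx_l2 test_fun_l2)
  then have "l2norm (\<lambda>x. (u x + v x) - (\<phi> x + \<eta> x)) < e"
    using * by (simp add: algebra_simps)
  then show "\<exists>\<phi>. test_fun \<phi> \<and> l2norm (\<lambda>x. (u x + v x) - \<phi> x) < e"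
    using test_fun_add[OF *(1,3)] by blast
qed

lemma l2_approx_cmult:
  assumes "l2_approx u"
  shows "l2_approx (\<lambda>x. c * u x)"
  unfolding l2_approx_def
proof (intro conjI allI impI)
  show "l2 (\<lambda>x. c * u x)" using assms l2_approx_l2 l2_cmult by blast
  fix e :: real assume e: "e > 0"
  then have "e / (cmod c + 1) > 0" by (simp add: add_nonneg_pos)
  then obtain \<phi> where *: "test_fun \<phi>" "l2norm (\<lambda>x. u x - \<phi> x) < e / (cmod c + 1)"
    using assms unfolding l2_approx_def by meson
  have "l2norm (\<lambda>x. c * u x - c * \<phi> x) = cmod c * l2norm (\<lambda>x. u x - \<phi> x)"
    using l2norm_cmult[of c "\<lambda>x. u x - \<phi> x"] by (simp add: algebra_simps)
  also have "\<dots> \<le> (cmod c + 1) * l2norm (\<lambda>x. u x - \<phi> x)"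
    by (intro mult_right_mono) auto
  also have "\<dots> < e"
  proof -
    have "cmod c + 1 > 0" by (simp add: add_nonneg_pos)
    then show ?thesis using *(2) by (simp add: pos_less_divide_eq mult.commute)
  qed
  finally show "\<exists>\<phi>. test_fun \<phi> \<and> l2norm (\<lambda>x. c * u x - \<phi> x) < e"
    using test_fun_cmult[OF *(1)] by blast
qed

lemma l2_approx_diff: "l2_approx u \<Longrightarrow> l2_approx v \<Longrightarrow> l2_approx (\<lambda>x. u x - v x)"
  using l2_approx_add[of u "\<lambda>x. (-1) * v x"] l2_approx_cmult[of v "-1"] by simp

lemma l2_approx_zero: "l2_approx (\<lambda>_. 0)"
  by (rule l2_approx_test_fun[OF test_fun_zero])

lemma l2_approx_sum: "(\<And>i. i \<in> I \<Longrightarrow> l2_approx (u i)) \<Longrightarrow> l2_approx (\<lambda>x. \<Sum>i\<in>I. u i x)"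
  by (induction I rule: infinite_finite_induct) (auto intro: l2_approx_zero l2_approx_add)

lemma integrable_indicator_box_sq: "integrable lborel (\<lambda>x::real^'n::finite. (indicator (box a c) x :: real)\<^sup>2)"
proof -
  have "(\<lambda>x::real^'n. (indicator (box a c) x :: real)\<^sup>2) = indicator (box a c)"
    by (auto simp: indicator_def)
  then show ?thesis using emeasure_bounded_finite[OF bounded_box, of a c] by simp
qed

lemma l2_approx_box: "l2_approx (indicator (box a c) :: real^'n::finite \<Rightarrow> complex)"
proof -
  have m: "(indicator (box a c) :: real^'n \<Rightarrow> complex) \<in> borel_measurable lborel" by simp
  have dom: "AE x in lborel. cmod (box_bump (real (Suc n)) a c x) \<le> indicator (box a c) x" for n
    using box_bump_real(3)[of "real (Suc n)" a c] box_bump_nonzero_iff[of "real (Suc n)" a c]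
    by (intro AE_I2) (auto simp: indicator_def simp del: of_nat_Suc)
  have l: "AE x in lborel. (\<lambda>n. box_bump (real (Suc n)) a c x) \<longlonglongrightarrow> indicator (box a c) x"
    by (intro AE_I2 box_bump_tendsto)
  have t: "test_fun (box_bump (real (Suc n)) a c)" for n
    by (rule test_fun_box_bump) (simp del: of_nat_Suc)
  note * = l2_dominated_convergence[OF l2_measurable[OF test_fun_l2[OF t]] m l integrable_indicator_box_sq dom]
  show ?thesis by (rule l2_approx_lim[OF *(1) l2_approx_test_fun[OF t] *(2)])
qed

text \<open>A Dynkin argument: boxes are stable under intersection and generate the Borel sets, and
  the sets whose trace on a fixed box has an approximable indicator are closed under complements and
  disjoint countable unions. The fixed box keeps all indicators square integrable and dominates the
  limits.\<close>

lemma l2_approx_indicator: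
  assumes "A \<in> sets borel"
  shows "l2_approx (indicator (A \<inter> box a c) :: real^'n::finite \<Rightarrow> complex)"
proof -
  let ?G = "range (\<lambda>(a, b). box a b) :: (real^'n) set set"
  have st: "Int_stable ?G"
    by (auto simp: Int_stable_def box_Int_box)
  have A: "A \<in> sigma_sets UNIV ?G"
    using assms unfolding borel_eq_box by simp
  show ?thesis
  proof (rule sigma_sets_induct_disjoint[OF st _ A])
    show "?G \<subseteq> Pow UNIV" by simp
  next
    fix A assume "A \<in> ?G"
    then obtain a' c' where "A = box a' c'" by auto
    moreover have "box a' c' \<inter> box a c = box (\<Sum>i\<in>Basis. max (a' \<bullet> i) (a \<bullet> i) *\<^sub>R i) (\<Sum>i\<in>Basis. min (c' \<bullet> i) (c \<bullet> i) *\<^sub>R i)"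
      by (rule box_Int_box)
    ultimately show "l2_approx (indicator (A \<inter> box a c) :: real^'n \<Rightarrow> complex)"
      by (simp only: l2_approx_box)
  next
    have "(indicator ({} \<inter> box a c) :: real^'n \<Rightarrow> complex) = (\<lambda>_. 0)"
      by (auto simp: indicator_def)
    then show "l2_approx (indicator ({} \<inter> box a c) :: real^'n \<Rightarrow> complex)"
      using l2_approx_zero by simp
  next
    fix A assume "l2_approx (indicator (A \<inter> box a c) :: real^'n \<Rightarrow> complex)"
    then have "l2_approx (\<lambda>x. indicator (box a c) x - indicator (A \<inter> box a c) x :: complex)"
      by (intro l2_approx_diff l2_approx_box)
    moreover have "(\<lambda>x. indicator (box a c) x - indicator (A \<inter> box a c) x) = (indicator ((UNIV - A) \<inter> box a c) :: real^'n \<Rightarrow> complex)"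
      by (auto simp: indicator_def)
    ultimately show "l2_approx (indicator ((UNIV - A) \<inter> box a c) :: real^'n \<Rightarrow> complex)" by simp
  next
    fix A :: "nat \<Rightarrow> (real^'n) set"
    assume dis: "disjoint_family A" and r: "range A \<subseteq> sigma_sets UNIV ?G"
      and ap: "\<And>i. l2_approx (indicator (A i \<inter> box a c) :: real^'n \<Rightarrow> complex)"
    have Ai [measurable]: "A i \<in> sets borel" for i
    proof -
      have "A i \<in> sigma_sets UNIV ?G" using r by blast
      then show ?thesis unfolding borel_eq_box by simp
    qed
    define v where "v n x = (\<Sum>i<n. indicator (A i \<inter> box a c) x :: complex)" for n x
    have apv: "l2_approx (v n)" for n
      unfolding v_def by (rule l2_approx_sum) (rule ap)
    have v: "v n x = indicator ((\<Union>i<n. A i) \<inter> box a c) x" for n x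
    proof -
      have "v n x = (\<Sum>i<n. indicator (A i) x) * indicator (box a c) x"
        by (simp add: v_def indicator_inter_arith sum_distrib_right)
      also have "(\<Sum>i<n. indicator (A i) x) = (indicator (\<Union>i<n. A i) x :: complex)"
        by (rule indicator_UN_disjoint[symmetric]) (use dis in \<open>auto simp: disjoint_family_on_def\<close>)
      finally show ?thesis by (simp add: indicator_inter_arith)
    qed
    have lim: "(\<lambda>n. v n x) \<longlonglongrightarrow> indicator ((\<Union>i. A i) \<inter> box a c) x" for x
    proof (rule tendsto_eventually, cases "x \<in> (\<Union>i. A i)")
      case True
      then obtain i where i: "x \<in> A i" by auto
      show "\<forall>\<^sub>F n in sequentially. v n x = indicator ((\<Union>i. A i) \<inter> box a c) x"
        using eventually_gt_at_top[of i] by eventually_elim (use i in \<open>auto simp: v indicator_def\<close>)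
    next
      case False
      then show "\<forall>\<^sub>F n in sequentially. v n x = indicator ((\<Union>i. A i) \<inter> box a c) x"
        by (intro always_eventually) (auto simp: v indicator_def)
    qed
    have dom: "AE x in lborel. cmod (v n x) \<le> indicator (box a c) x" for n
      by (intro AE_I2) (auto simp: v indicator_def)
    have m: "(indicator ((\<Union>i. A i) \<inter> box a c) :: real^'n \<Rightarrow> complex) \<in> borel_measurable lborel"
      by simp
    note * = l2_dominated_convergence[OF l2_measurable[OF l2_approx_l2[OF apv]] m AE_I2[OF lim] integrable_indicator_box_sq dom]
    show "l2_approx (indicator (\<Union> (range A) \<inter> box a c) :: real^'n \<Rightarrow> complex)"
      by (rule l2_approx_lim[OF *(1) apv *(2)])
  qed
qed

lemma l2_approx_all:
  fixes u :: "real^'n::finite \<Rightarrow> complex"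
  assumes u: "l2 u"
  shows "l2_approx u"
proof -
  obtain F where F: "\<And>i. simple_function lborel (F i)" "\<And>x. (\<lambda>i. F i x) \<longlonglongrightarrow> u x"
      "\<And>i x. cmod (F i x) \<le> 2 * cmod (u x)"
    using borel_measurable_implies_sequence_metric[OF l2_measurable[OF u], of 0]
    by (auto simp: dist_norm)
  \<comment> \<open>The level sets of \<open>F n\<close> may have infinite measure, so the simple
    functions are cut off on boxes that exhaust the space.\<close>
  define B :: "nat \<Rightarrow> (real^'n) set" where "B n = box (\<chi> i. - real n) (\<chi> i. real n)" for n
  define v where "v n x = F n x * indicator (B n) x" for n x
  have sB [measurable]: "B n \<in> sets borel" for n by (simp add: B_def)
  have Fm [measurable]: "F n \<in> borel_measurable lborel" for n
    using F(1) by (rule borel_measurable_simple_function)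
  have ap: "l2_approx (v n)" for n
  proof -
    have fin: "finite (range (F n))"
      using simple_functionD(1)[OF F(1)[of n]] by simp
    have "v n x = (\<Sum>y\<in>range (F n). y * indicator ((F n -` {y}) \<inter> B n) x)" for x
    proof -
      have "(\<Sum>y\<in>range (F n). y * indicator ((F n -` {y}) \<inter> B n) x) = (\<Sum>y\<in>range (F n). if y = F n x then y * indicator (B n) x else 0)"
        by (intro sum.cong) (auto simp: indicator_def)
      also have "\<dots> = v n x"
        using fin by (simp add: v_def)
      finally show ?thesis by simp
    qed
    then have "v n = (\<lambda>x. \<Sum>y\<in>range (F n). y * indicator ((F n -` {y}) \<inter> B n) x)" by (rule ext)
    moreover have "F n -` {y} \<in> sets borel" for y
      using simple_functionD(2)[OF F(1)[of n], of "{y}"] by simp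
    ultimately show ?thesis
      unfolding B_def by (auto intro!: l2_approx_sum l2_approx_cmult l2_approx_indicator)
  qed
  have "(\<lambda>n. v n x) \<longlonglongrightarrow> u x * 1" for x
    unfolding v_def
  proof (intro tendsto_mult F(2) tendsto_eventually)
    obtain N :: nat where N: "norm x < real N" using reals_Archimedean2 by blast
    show "\<forall>\<^sub>F n in sequentially. indicator (B n) x = (1::complex)"
      using eventually_ge_at_top[of N]
    proof eventually_elim
      case (elim n)
      have "\<bar>x $ i\<bar> < real n" for i
        using component_le_norm_cart[of x i] N elim by linarith
      then have "x \<in> B n" by (auto simp: B_def mem_box_cart abs_less_iff minus_less_iff)
      then show ?case by simp
    qed
  qed
  then have lim: "AE x in lborel. (\<lambda>n. v n x) \<longlonglongrightarrow> u x" by simp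
  have dom: "AE x in lborel. cmod (v n x) \<le> 2 * cmod (u x)" for n
    using F(3)[of n] by (intro AE_I2) (auto simp: v_def indicator_def norm_mult)
  have int: "integrable lborel (\<lambda>x. (2 * cmod (u x))\<^sup>2)"
    using l2_integrable[OF u] by (simp add: power_mult_distrib)
  note * = l2_dominated_convergence[OF l2_measurable[OF l2_approx_l2[OF ap]] l2_measurable[OF u] lim int dom]
  show ?thesis by (rule l2_approx_lim[OF u ap *(2)])
qed

lemma l2_test_fun_seq:
  assumes "l2 u"
  obtains \<phi> where "\<And>n. test_fun (\<phi> n)" "(\<lambda>n. l2norm (\<lambda>x. \<phi> n x - u x)) \<longlonglongrightarrow> 0"
proof -
  have "\<exists>\<phi>. test_fun \<phi> \<and> l2norm (\<lambda>x. u x - \<phi> x) < 1 / real (Suc n)" for n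
    using l2_approx_all[OF assms] unfolding l2_approx_def by simp
  then obtain \<phi> where \<phi>: "\<And>n. test_fun (\<phi> n)" "\<And>n. l2norm (\<lambda>x. u x - \<phi> n x) < 1 / real (Suc n)"
    by metis
  have "(\<lambda>n. l2norm (\<lambda>x. \<phi> n x - u x)) \<longlonglongrightarrow> 0"
  proof (rule Lim_null_comparison[OF always_eventually LIMSEQ_inverse_real_of_nat], intro allI)
    show "norm (l2norm (\<lambda>x. \<phi> n x - u x)) \<le> inverse (real (Suc n))" for n
      using \<phi>(2)[of n] l2norm_minus_commute[of u "\<phi> n"] by (simp add: inverse_eq_divide)
  qed
  then show thesis using that \<phi>(1) by blast
qed

lemma l2_orth_test_fun:
  assumes u: "l2 u" and 0: "\<And>\<phi>. test_fun \<phi> \<Longrightarrow> l2inner \<phi> u = 0"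
  shows "AE x in lborel. u x = 0"
proof -
  obtain \<phi> where \<phi>: "\<And>n. test_fun (\<phi> n)" "(\<lambda>n. l2norm (\<lambda>x. \<phi> n x - u x)) \<longlonglongrightarrow> 0"
    using l2_test_fun_seq[OF u] by blast
  have "(\<lambda>n. l2inner (\<phi> n) u) \<longlonglongrightarrow> l2inner u u"
    using \<phi> u by (intro l2inner_tendsto_left) (auto intro: test_fun_l2)
  then have "l2inner u u = 0"
    using 0 \<phi>(1) LIMSEQ_unique[OF tendsto_const] by fastforce
  then have "l2norm u = 0" using u by (simp add: l2inner_self)
  then show ?thesis using l2norm_eq_0_AE u by blast
qed

section \<open>Gaussian regularisation and Fourier inversion\<close>

lemma
  fixes f :: "'a::euclidean_space \<Rightarrow> real \<Rightarrow> 'b::{real_normed_field,banach,second_countable_topology}"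
  assumes f: "\<And>b. b \<in> Basis \<Longrightarrow> integrable lborel (f b)"
  shows integrable_lborel_prod: "integrable lborel (\<lambda>x::'a. \<Prod>b\<in>Basis. f b (x \<bullet> b))"
    and integral_lborel_prod: "(\<integral>x. (\<Prod>b\<in>Basis. f b (x \<bullet> b)) \<partial>(lborel :: 'a measure)) = (\<Prod>b\<in>Basis. \<integral>x. f b x \<partial>lborel)"
proof -
  interpret product_sigma_finite "\<lambda>_::'a. lborel :: real measure"
    by standard
  have [measurable]: "f b \<in> borel_measurable borel" if "b \<in> Basis" for b
    using f[OF that] by simp
  have m1: "(\<lambda>g. \<Sum>b\<in>Basis. g b *\<^sub>R b :: 'a) \<in> measurable (\<Pi>\<^sub>M b\<in>Basis. lborel) borel"
    by measurable
  have m2: "(\<lambda>x::'a. \<Prod>b\<in>Basis. f b (x \<bullet> b)) \<in> borel_measurable borel"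
    by measurable
  have eq: "(\<Prod>b\<in>Basis. f b ((\<Sum>b\<in>Basis. g b *\<^sub>R b :: 'a) \<bullet> b)) = (\<Prod>b\<in>Basis. f b (g b))" for g
    by (intro prod.cong) auto
  have "integrable (distr (\<Pi>\<^sub>M b\<in>Basis. lborel) borel (\<lambda>g. \<Sum>b\<in>Basis. g b *\<^sub>R b :: 'a)) (\<lambda>x. \<Prod>b\<in>Basis. f b (x \<bullet> b))"
    unfolding integrable_distr_eq[OF m1 m2] eq
    by (rule product_integrable_prod) (auto intro: f)
  then show "integrable lborel (\<lambda>x::'a. \<Prod>b\<in>Basis. f b (x \<bullet> b))"
    unfolding lborel_eq[where 'a = 'a] .
  have "(\<integral>x. (\<Prod>b\<in>Basis. f b (x \<bullet> b)) \<partial>distr (\<Pi>\<^sub>M b\<in>Basis. lborel) borel (\<lambda>g. \<Sum>b\<in>Basis. g b *\<^sub>R b :: 'a)) = (\<Prod>b\<in>Basis. \<integral>x. f b x \<partial>lborel)"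
    unfolding integral_distr[OF m1 m2] eq
    by (rule product_integral_prod) (auto intro: f)
  then show "(\<integral>x. (\<Prod>b\<in>Basis. f b (x \<bullet> b)) \<partial>(lborel :: 'a measure)) = (\<Prod>b\<in>Basis. \<integral>x. f b x \<partial>lborel)"
    unfolding lborel_eq[where 'a = 'a] .
qed

lemma integrable_lborel_affine:
  fixes f :: "'a::euclidean_space \<Rightarrow> 'b::{banach,second_countable_topology}"
  assumes f: "integrable lborel f" and c: "c \<noteq> 0"
  shows "integrable lborel (\<lambda>x. f (t + c *\<^sub>R x))"
proof -
  have [measurable]: "f \<in> borel_measurable borel" using f by simp
  have "integrable (density (distr lborel borel (\<lambda>x. t + c *\<^sub>R x)) (\<lambda>_. ennreal (\<bar>c\<bar>^DIM('a)))) f"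
    using f lborel_affine[OF c, of t] by simp
  then have "integrable (distr lborel borel (\<lambda>x. t + c *\<^sub>R x)) (\<lambda>x. \<bar>c\<bar>^DIM('a) *\<^sub>R f x)"
    by (subst (asm) integrable_density) auto
  then have "integrable lborel (\<lambda>x. \<bar>c\<bar>^DIM('a) *\<^sub>R f (t + c *\<^sub>R x))"
    by (subst (asm) integrable_distr_eq) auto
  from integrable_scaleR_right[OF this, of "inverse (\<bar>c\<bar>^DIM('a))"] show ?thesis using c by simp
qed

lemma integral_lborel_affine:
  fixes f :: "'a::euclidean_space \<Rightarrow> 'b::{banach,second_countable_topology}"
  assumes [measurable]: "f \<in> borel_measurable lborel" and c: "c \<noteq> 0"
  shows "(\<integral>x. f x \<partial>lborel) = \<bar>c\<bar>^DIM('a) *\<^sub>R (\<integral>x. f (t + c *\<^sub>R x) \<partial>lborel)"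
proof -
  have "(\<integral>x. f x \<partial>lborel) = (\<integral>x. f x \<partial>density (distr lborel borel (\<lambda>x. t + c *\<^sub>R x)) (\<lambda>_. ennreal (\<bar>c\<bar>^DIM('a))))"
    using lborel_affine[OF c, of t] by simp
  also have "\<dots> = \<bar>c\<bar>^DIM('a) *\<^sub>R (\<integral>x. f x \<partial>distr lborel borel (\<lambda>x. t + c *\<^sub>R x))"
    by (subst integral_density) auto
  also have "(\<integral>x. f x \<partial>distr lborel borel (\<lambda>x. t + c *\<^sub>R x)) = (\<integral>x. f (t + c *\<^sub>R x) \<partial>lborel)"
    by (subst integral_distr) auto
  finally show ?thesis .
qed

lemma nn_integral_lborel_shift:
  fixes f :: "'a::euclidean_space \<Rightarrow> ennreal"
  assumes [measurable]: "f \<in> borel_measurable lborel" and c: "\<bar>c\<bar> = 1"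
  shows "(\<integral>\<^sup>+x. f (t + c *\<^sub>R x) \<partial>lborel) = (\<integral>\<^sup>+x. f x \<partial>lborel)"
proof -
  have "c \<noteq> 0" using c by auto
  then have "(\<integral>\<^sup>+x. f x \<partial>lborel) = (\<integral>\<^sup>+x. f x \<partial>density (distr lborel borel (\<lambda>x. t + c *\<^sub>R x)) (\<lambda>_. ennreal (\<bar>c\<bar>^DIM('a))))"
    using lborel_affine[of c t] by simp
  also have "\<dots> = (\<integral>\<^sup>+x. f x \<partial>distr lborel borel (\<lambda>x. t + c *\<^sub>R x))"
    using c by (subst nn_integral_density) auto
  also have "\<dots> = (\<integral>\<^sup>+x. f (t + c *\<^sub>R x) \<partial>lborel)"
    by (subst nn_integral_distr) auto
  finally show ?thesis by simp
qed

definition fourier_const :: "'n::finite itself \<Rightarrow> real" where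
  "fourier_const _ = (2 * pi) powr (- real CARD('n) / 2)"

lemma fourier_const_pos: "0 < fourier_const TYPE('n::finite)"
  by (simp add: fourier_const_def)

lemma FT_eq: "FT f \<xi> = fourier_const TYPE('n) * (\<integral>x. cis (- (x \<bullet> \<xi>)) * f x \<partial>lborel)"
  for f :: "real^'n::finite \<Rightarrow> complex"
  by (simp add: FT_def fourier_const_def)

lemma IFT_eq: "IFT f x = fourier_const TYPE('n) * (\<integral>\<xi>. cis (x \<bullet> \<xi>) * f \<xi> \<partial>lborel)"
  for f :: "real^'n::finite \<Rightarrow> complex"
  by (simp add: IFT_def fourier_const_def)

lemma FT_eq_IFT: "FT f \<xi> = IFT f (- \<xi>)"
  by (simp add: FT_eq IFT_eq inner_commute)

text \<open>The constant of the unitary Fourier transform is also the normalising constant of the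
  standard normal density, so \<open>gauss\<close> is a probability density.\<close>

definition gauss :: "real^'n::finite \<Rightarrow> real" where
  "gauss z = fourier_const TYPE('n) * exp (- (norm z)\<^sup>2 / 2)"

lemma gauss_nonneg: "0 \<le> gauss z"
  by (simp add: gauss_def fourier_const_def)

lemma gauss_prod: "gauss z = (\<Prod>b\<in>Basis. std_normal_density (z \<bullet> b))"
  for z :: "real^'n::finite"
proof -
  have n2: "(norm z)\<^sup>2 = (\<Sum>b\<in>Basis. (z \<bullet> b)\<^sup>2)"
    by (simp add: norm_eq_sqrt_inner euclidean_inner[of z z] power2_eq_square sum_nonneg)
  have "(\<Prod>b\<in>Basis. std_normal_density (z \<bullet> b)) = (1 / sqrt (2 * pi)) ^ CARD('n) * (\<Prod>b\<in>Basis. exp (- (z \<bullet> b)\<^sup>2 / 2))"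
    by (simp add: std_normal_density_def prod.distrib prod_dividef power_one_over)
  also have "(\<Prod>b\<in>Basis. exp (- (z \<bullet> b)\<^sup>2 / 2)) = exp (- (norm z)\<^sup>2 / 2)"
    by (simp add: exp_sum[symmetric] n2 sum_negf sum_divide_distrib)
  also have "(1 / sqrt (2 * pi)) ^ CARD('n) = fourier_const TYPE('n)"
  proof -
    have "(1 / sqrt (2 * pi)) = (2 * pi) powr (- (1 / 2))"
      by (simp add: powr_minus powr_half_sqrt inverse_eq_divide)
    then show ?thesis
      by (simp add: fourier_const_def powr_power)
  qed
  finally show ?thesis by (simp add: gauss_def)
qed

lemma gauss_measurable [measurable]: "gauss \<in> borel_measurable borel"
  unfolding gauss_def by measurable

lemma cis_inner_prod: "cis (z \<bullet> \<xi>) = (\<Prod>b\<in>Basis. cis ((\<xi> \<bullet> b) * (z \<bullet> b)))"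
  for z :: "'a::euclidean_space"
proof -
  have "cis (\<Sum>b\<in>A. (\<xi> \<bullet> b) * (z \<bullet> b)) = (\<Prod>b\<in>A. cis ((\<xi> \<bullet> b) * (z \<bullet> b)))" if "finite A" for A
    using that by (induction A rule: finite_induct) (auto simp: cis_mult[symmetric])
  then show ?thesis by (simp add: euclidean_inner[of z \<xi>] mult.commute)
qed

lemma norm_of_real_mult_cis [simp]: "cmod (cis a * w) = cmod w"
  by (simp add: norm_mult)

lemma cis_measurable [measurable]: "cis \<in> borel_measurable borel"
  by (intro borel_measurable_continuous_onI continuous_intros)

lemma std_normal_cis:
  "integrable lborel (\<lambda>x. cis (t * x) * complex_of_real (std_normal_density x))"
  "(\<integral>x. cis (t * x) * complex_of_real (std_normal_density x) \<partial>lborel) = exp (- t\<^sup>2 / 2)"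
proof -
  have "integrable lborel std_normal_density"
    using integrable_std_normal_moment[of 0] by simp
  then show "integrable lborel (\<lambda>x. cis (t * x) * complex_of_real (std_normal_density x))"
    by (rule Bochner_Integration.integrable_bound) (auto intro!: AE_I2)
  have "(\<integral>x. cis (t * x) * complex_of_real (std_normal_density x) \<partial>lborel)
      = (\<integral>x. std_normal_density x *\<^sub>R iexp (t * x) \<partial>lborel)"
    by (intro Bochner_Integration.integral_cong refl) (simp add: cis_conv_exp scaleR_conv_of_real)
  also have "\<dots> = char std_normal_distribution t"
    unfolding char_def by (subst integral_density) (auto simp: cis_conv_exp[symmetric])
  finally show "(\<integral>x. cis (t * x) * complex_of_real (std_normal_density x) \<partial>lborel) = exp (- t\<^sup>2 / 2)"
    by (simp add: char_std_normal_distribution)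
qed

lemma gauss_cis:
  fixes \<xi> :: "real^'n::finite"
  shows "integrable lborel (\<lambda>z. cis (z \<bullet> \<xi>) * complex_of_real (gauss z))"
    and "(\<integral>z. cis (z \<bullet> \<xi>) * complex_of_real (gauss z) \<partial>lborel) = exp (- (norm \<xi>)\<^sup>2 / 2)"
proof -
  have eq: "cis (z \<bullet> \<xi>) * complex_of_real (gauss z) =
      (\<Prod>b\<in>Basis. cis ((\<xi> \<bullet> b) * (z \<bullet> b)) * complex_of_real (std_normal_density (z \<bullet> b)))" for z
    by (simp add: cis_inner_prod gauss_prod prod.distrib)
  show "integrable lborel (\<lambda>z. cis (z \<bullet> \<xi>) * complex_of_real (gauss z))"
    unfolding eq by (rule integrable_lborel_prod) (rule std_normal_cis)
  have "(\<integral>z. cis (z \<bullet> \<xi>) * complex_of_real (gauss z) \<partial>lborel) = (\<Prod>b\<in>Basis. complex_of_real (exp (- (\<xi> \<bullet> b)\<^sup>2 / 2)))"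
    unfolding eq by (subst integral_lborel_prod) (auto simp: std_normal_cis)
  also have "\<dots> = exp (- (norm \<xi>)\<^sup>2 / 2)"
  proof -
    have n2: "(norm \<xi>)\<^sup>2 = (\<Sum>b\<in>Basis. (\<xi> \<bullet> b)\<^sup>2)"
      by (simp add: norm_eq_sqrt_inner euclidean_inner[of \<xi> \<xi>] power2_eq_square sum_nonneg)
    show ?thesis by (simp add: n2 exp_sum[symmetric] sum_negf sum_divide_distrib flip: of_real_prod)
  qed
  finally show "(\<integral>z. cis (z \<bullet> \<xi>) * complex_of_real (gauss z) \<partial>lborel) = exp (- (norm \<xi>)\<^sup>2 / 2)" .
qed

lemma gauss_integrable: "integrable lborel (gauss :: real^'n::finite \<Rightarrow> real)"
  and gauss_integral: "(\<integral>z. gauss z \<partial>(lborel :: (real^'n) measure)) = 1"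
proof -
  have "integrable lborel (\<lambda>z::real^'n. complex_of_real (gauss z))"
    using gauss_cis(1)[of 0] by simp
  then show "integrable lborel (gauss :: real^'n \<Rightarrow> real)"
    by (subst (asm) complex_of_real_integrable_eq)
  have "complex_of_real (\<integral>z. gauss z \<partial>(lborel :: (real^'n) measure)) = 1"
    using gauss_cis(2)[of "0 :: real^'n"] by simp
  then show "(\<integral>z. gauss z \<partial>(lborel :: (real^'n) measure)) = 1"
    by simp
qed

section \<open>Absolutely convergent Fourier integrals\<close>

lemma fubini_kernel:
  fixes f g :: "'a::euclidean_space \<Rightarrow> complex"
  assumes f: "integrable lborel f" and g: "integrable lborel g"
    and K: "(\<lambda>(x, y). K x y) \<in> borel_measurable (lborel \<Otimes>\<^sub>M lborel)" and bd: "\<And>x y. cmod (K x y) \<le> B"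
  shows "(\<integral>x. f x * (\<integral>y. K x y * g y \<partial>lborel) \<partial>lborel) = (\<integral>y. g y * (\<integral>x. K x y * f x \<partial>lborel) \<partial>lborel)"
proof -
  have [measurable]: "f \<in> borel_measurable borel" "g \<in> borel_measurable borel"
    using f g by auto
  note K [measurable]
  have Kx: "(\<lambda>y. K x y) \<in> borel_measurable lborel" for x
    using measurable_compose[OF measurable_Pair1' K, of x] by simp
  have "integrable (lborel \<Otimes>\<^sub>M lborel) (\<lambda>(x, y). f x * K x y * g y)"
  proof (rule lborel_pair.Fubini_integrable)
    show "(\<lambda>(x, y). f x * K x y * g y) \<in> borel_measurable (lborel \<Otimes>\<^sub>M lborel)" by measurable
    have ib: "integrable lborel (\<lambda>y. f x * K x y * g y)" for x
      by (rule Bochner_Integration.integrable_bound[OF integrable_mult_right[OF integrable_norm[OF g], of "cmod (f x) * B"]])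
         (use Kx[of x] bd in \<open>auto intro!: AE_I2 mult_right_mono mult_left_mono simp: norm_mult abs_mult intro: order_trans[OF _ abs_ge_self]\<close>)
    then show "AE x in lborel. integrable lborel (\<lambda>y. case (x, y) of (x, y) \<Rightarrow> f x * K x y * g y)" by simp
    show "integrable lborel (\<lambda>x. \<integral>y. norm (case (x, y) of (x, y) \<Rightarrow> f x * K x y * g y) \<partial>lborel)"
    proof (rule Bochner_Integration.integrable_bound[OF integrable_mult_left[OF integrable_norm[OF f], of "\<integral>y. B * norm (g y) \<partial>lborel"]])
      show "(\<lambda>x. \<integral>y. norm (case (x, y) of (x, y) \<Rightarrow> f x * K x y * g y) \<partial>lborel) \<in> borel_measurable lborel"
        by measurable
      have "(\<integral>y. norm (f x * K x y * g y) \<partial>lborel) \<le> (\<integral>y. cmod (f x) * (B * cmod (g y)) \<partial>lborel)" for x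
        using g bd by (intro integral_mono[OF integrable_norm[OF ib]])
          (auto simp: norm_mult mult.assoc intro!: mult_left_mono mult_right_mono)
      then show "AE x in lborel. norm (\<integral>y. norm (case (x, y) of (x, y) \<Rightarrow> f x * K x y * g y) \<partial>lborel)
          \<le> norm (cmod (f x) * (\<integral>y. B * norm (g y) \<partial>lborel))"
        by (intro AE_I2) (auto intro: order_trans[OF _ abs_ge_self])
    qed
  qed
  from lborel_pair.Fubini_integral[OF this] show ?thesis
    by (simp add: mult_ac flip: integral_mult_right_zero)
qed

text \<open>The three conditions serve different steps: integrability makes the Fourier integrals
  converge, boundedness adds square integrability, and continuity lets Gaussian averages converge at
  every point.\<close>

definition nice :: "(real^'n::finite \<Rightarrow> complex) \<Rightarrow> bool" where
  "nice a \<longleftrightarrow> continuous_on UNIV a \<and> (\<exists>B. \<forall>x. cmod (a x) \<le> B) \<and> integrable lborel a"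

lemma nice_l2: "nice a \<Longrightarrow> l2 a"
  unfolding nice_def using l2_if_integrable_bounded by blast

lemma nice_cc:
  assumes "continuous_on UNIV F" "bounded {x. F x \<noteq> 0}"
  shows "nice F"
  using integrable_cc[OF assms] cc_bound[OF assms] assms(1) unfolding nice_def by metis

lemma nice_test_fun: "test_fun \<phi> \<Longrightarrow> nice \<phi>"
  using nice_cc test_fun_cc by blast

lemma IFT_measurable [measurable]:
  assumes "f \<in> borel_measurable lborel"
  shows "IFT f \<in> borel_measurable borel"
proof -
  have [measurable]: "f \<in> borel_measurable borel" using assms by simp
  have "(\<lambda>x. \<integral>\<xi>. cis (x \<bullet> \<xi>) * f \<xi> \<partial>lborel) \<in> borel_measurable lborel"
    by measurable
  then show ?thesis unfolding IFT_eq[abs_def] by simp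
qed

lemma FT_measurable [measurable]:
  assumes "f \<in> borel_measurable lborel"
  shows "FT f \<in> borel_measurable borel"
  using measurable_compose[OF _ IFT_measurable[OF assms], of uminus borel] unfolding FT_eq_IFT[abs_def] by simp

lemma integrable_cis_mult:
  assumes "integrable lborel f"
  shows "integrable lborel (\<lambda>\<xi>::'a::euclidean_space. cis (x \<bullet> \<xi>) * f \<xi>)"
proof (rule Bochner_Integration.integrable_bound[OF assms])
  have [measurable]: "f \<in> borel_measurable borel" using assms by simp
  show "(\<lambda>\<xi>. cis (x \<bullet> \<xi>) * f \<xi>) \<in> borel_measurable lborel" by simp
qed simp

lemma IFT_bound: "cmod (IFT f x) \<le> fourier_const TYPE('n) * (\<integral>\<xi>. cmod (f \<xi>) \<partial>lborel)"
  for f :: "real^'n::finite \<Rightarrow> complex"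
proof -
  have "cmod (\<integral>\<xi>. cis (x \<bullet> \<xi>) * f \<xi> \<partial>lborel) \<le> (\<integral>\<xi>. cmod (cis (x \<bullet> \<xi>) * f \<xi>) \<partial>lborel)"
    by (rule integral_norm_bound)
  then show ?thesis
    using fourier_const_pos[where 'n = 'n] by (simp add: IFT_eq norm_mult)
qed

lemma FT_bound: "cmod (FT f x) \<le> fourier_const TYPE('n) * (\<integral>\<xi>. cmod (f \<xi>) \<partial>lborel)"
  for f :: "real^'n::finite \<Rightarrow> complex"
  by (simp add: FT_eq_IFT IFT_bound)

lemma IFT_continuous:
  assumes f: "integrable lborel f"
  shows "continuous_on UNIV (IFT f)"
proof (rule continuous_at_imp_continuous_on, rule ballI, unfold continuous_at_sequentially, intro allI impI)
  fix x and X :: "nat \<Rightarrow> real^'a" assume X: "X \<longlonglongrightarrow> x"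
  have [measurable]: "f \<in> borel_measurable borel" using f by simp
  have "(\<lambda>n. \<integral>\<xi>. cis (X n \<bullet> \<xi>) * f \<xi> \<partial>lborel) \<longlonglongrightarrow> (\<integral>\<xi>. cis (x \<bullet> \<xi>) * f \<xi> \<partial>lborel)"
  proof (rule integral_dominated_convergence[where w = "\<lambda>\<xi>. cmod (f \<xi>)"])
    show "AE \<xi> in lborel. (\<lambda>n. cis (X n \<bullet> \<xi>) * f \<xi>) \<longlonglongrightarrow> cis (x \<bullet> \<xi>) * f \<xi>"
      using X by (intro AE_I2 tendsto_intros)
  qed (use f in auto)
  then show "((IFT f) \<circ> X) \<longlonglongrightarrow> IFT f x"
    unfolding IFT_eq[abs_def] comp_def by (intro tendsto_intros)
qed

lemma FT_continuous:
  assumes f: "integrable lborel f"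
  shows "continuous_on UNIV (FT f)"
  unfolding FT_eq_IFT[abs_def]
  by (intro continuous_on_compose2[OF IFT_continuous[OF f]] continuous_intros) auto

text \<open>Fubini alone makes \<open>FT\<close> the adjoint of \<open>IFT\<close>; no inversion is
  involved, so the identity is available for proving inversion and the isometry.\<close>

lemma cnj_IFT_mult:
  assumes a: "integrable lborel a" and u: "integrable lborel u"
  shows "(\<integral>x. cnj (IFT a x) * u x \<partial>lborel) = (\<integral>\<xi>. cnj (a \<xi>) * FT u \<xi> \<partial>lborel)"
proof -
  have ca: "integrable lborel (\<lambda>\<xi>. cnj (a \<xi>))" using a by simp
  have "cnj (IFT a x) = fourier_const TYPE('a) * (\<integral>\<xi>. cis (- (x \<bullet> \<xi>)) * cnj (a \<xi>) \<partial>lborel)" for x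
    by (subst IFT_eq) (simp only: complex_cnj_mult complex_cnj_complex_of_real Bochner_Integration.integral_cnj[symmetric] cis_cnj)
  then have "(\<integral>x. cnj (IFT a x) * u x \<partial>lborel) =
      (\<integral>x. fourier_const TYPE('a) * (u x * (\<integral>\<xi>. cis (- (x \<bullet> \<xi>)) * cnj (a \<xi>) \<partial>lborel)) \<partial>lborel)"
    by (simp add: mult_ac)
  also have "\<dots> = fourier_const TYPE('a) * (\<integral>x. u x * (\<integral>\<xi>. cis (- (x \<bullet> \<xi>)) * cnj (a \<xi>) \<partial>lborel) \<partial>lborel)"
    by (rule integral_mult_right_zero)
  also have "\<dots> = fourier_const TYPE('a) * (\<integral>\<xi>. cnj (a \<xi>) * (\<integral>x. cis (- (x \<bullet> \<xi>)) * u x \<partial>lborel) \<partial>lborel)"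
    by (subst fubini_kernel[OF u ca, of "\<lambda>x \<xi>. cis (- (x \<bullet> \<xi>))" 1]) auto
  also have "\<dots> = (\<integral>\<xi>. fourier_const TYPE('a) * (cnj (a \<xi>) * (\<integral>x. cis (- (x \<bullet> \<xi>)) * u x \<partial>lborel)) \<partial>lborel)"
    by (rule integral_mult_right_zero[symmetric])
  also have "\<dots> = (\<integral>\<xi>. cnj (a \<xi>) * FT u \<xi> \<partial>lborel)"
    by (simp add: FT_eq mult_ac)
  finally show ?thesis .
qed

section \<open>Gaussian damping, pointwise inversion and the isometry\<close>

definition gauss_reg :: "real \<Rightarrow> real^'n::finite \<Rightarrow> real" where
  "gauss_reg \<delta> x = exp (- (\<delta>\<^sup>2 * (norm x)\<^sup>2) / 2)"

text \<open>Convolution with a Gaussian of width \<delta>, rescaled so that the width sits in the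
  argument of \<open>b\<close>. For bounded \<open>b\<close> one multiple of \<open>gauss\<close>
  then dominates the integrand for all widths.\<close>

definition gauss_smooth :: "real \<Rightarrow> (real^'n::finite \<Rightarrow> complex) \<Rightarrow> real^'n \<Rightarrow> complex" where
  "gauss_smooth \<delta> b \<xi> = (\<integral>z. complex_of_real (gauss z) * b (\<xi> + \<delta> *\<^sub>R z) \<partial>lborel)"

lemma gauss_reg_eq: "fourier_const TYPE('n) * gauss_reg \<delta> x = gauss (\<delta> *\<^sub>R x)" for x :: "real^'n::finite"
  by (simp add: gauss_reg_def gauss_def power_mult_distrib)

lemma gauss_reg_measurable [measurable]: "gauss_reg \<delta> \<in> borel_measurable borel"
  unfolding gauss_reg_def by measurable

lemma gauss_reg_bounds: "0 \<le> gauss_reg \<delta> x" "gauss_reg \<delta> x \<le> 1"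
  by (auto simp: gauss_reg_def)

lemma gauss_reg_integrable:
  assumes "\<delta> \<noteq> 0"
  shows "integrable lborel (gauss_reg \<delta> :: real^'n::finite \<Rightarrow> real)"
proof -
  have "integrable lborel (\<lambda>x::real^'n. gauss (0 + \<delta> *\<^sub>R x))"
    by (rule integrable_lborel_affine[OF gauss_integrable assms])
  then have "integrable lborel (\<lambda>x::real^'n. fourier_const TYPE('n) * gauss_reg \<delta> x)"
    by (simp add: gauss_reg_eq)
  then show ?thesis
    using fourier_const_pos[where 'n = 'n] by simp
qed

lemma gauss_reg_tendsto: "(\<lambda>n. gauss_reg (1 / real (Suc n)) x) \<longlonglongrightarrow> 1"
proof -
  have "(\<lambda>n. exp (- ((inverse (real (Suc n)))\<^sup>2 * (norm x)\<^sup>2) / 2)) \<longlonglongrightarrow> exp (- (0\<^sup>2 * (norm x)\<^sup>2) / 2)"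
    by (intro tendsto_intros LIMSEQ_inverse_real_of_nat) simp
  then show ?thesis by (simp add: gauss_reg_def inverse_eq_divide)
qed

text \<open>The squared constant collects one factor from \<open>FT\<close> and one from
  \<open>IFT\<close>; the right-hand side is the Gaussian probability density of width
  \<delta>.\<close>

lemma gauss_reg_fourier:
  fixes \<zeta> :: "real^'n::finite"
  assumes "\<delta> > 0"
  shows "(complex_of_real (fourier_const TYPE('n)))\<^sup>2 * (\<integral>x. cis (x \<bullet> \<zeta>) * complex_of_real (gauss_reg \<delta> x) \<partial>lborel)
    = complex_of_real (\<delta> powr (- real CARD('n)) * gauss ((1 / \<delta>) *\<^sub>R \<zeta>))"
proof -
  let ?c = "complex_of_real (fourier_const TYPE('n))"
  have "exp (- (norm ((1 / \<delta>) *\<^sub>R \<zeta>))\<^sup>2 / 2) = (\<integral>z. cis (z \<bullet> ((1 / \<delta>) *\<^sub>R \<zeta>)) * complex_of_real (gauss z) \<partial>lborel)"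
    by (rule gauss_cis(2)[symmetric])
  also have "\<dots> = \<bar>\<delta>\<bar>^DIM(real^'n) *\<^sub>R (\<integral>x. cis ((0 + \<delta> *\<^sub>R x) \<bullet> ((1 / \<delta>) *\<^sub>R \<zeta>)) * complex_of_real (gauss (0 + \<delta> *\<^sub>R x)) \<partial>lborel)"
    by (rule integral_lborel_affine) (use assms in auto)
  also have "(\<lambda>x. cis ((0 + \<delta> *\<^sub>R x) \<bullet> ((1 / \<delta>) *\<^sub>R \<zeta>)) * complex_of_real (gauss (0 + \<delta> *\<^sub>R x)))
      = (\<lambda>x. ?c * (cis (x \<bullet> \<zeta>) * complex_of_real (gauss_reg \<delta> x)))"
    using assms by (auto simp: gauss_reg_eq[symmetric])
  also have "\<bar>\<delta>\<bar>^DIM(real^'n) *\<^sub>R (\<integral>x. ?c * (cis (x \<bullet> \<zeta>) * complex_of_real (gauss_reg \<delta> x)) \<partial>lborel)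
      = \<delta>^CARD('n) * ?c * (\<integral>x. cis (x \<bullet> \<zeta>) * complex_of_real (gauss_reg \<delta> x) \<partial>lborel)"
    using assms by (simp add: scaleR_conv_of_real)
  finally have "?c * complex_of_real (exp (- (norm ((1 / \<delta>) *\<^sub>R \<zeta>))\<^sup>2 / 2)) =
      \<delta>^CARD('n) * (?c\<^sup>2 * (\<integral>x. cis (x \<bullet> \<zeta>) * complex_of_real (gauss_reg \<delta> x) \<partial>lborel))"
    by (simp add: power2_eq_square mult_ac)
  moreover have "complex_of_real (\<delta> powr (- real CARD('n))) * complex_of_real \<delta> ^ CARD('n) = 1"
    using assms by (simp add: powr_minus powr_realpow flip: of_real_power of_real_mult)
  ultimately have "complex_of_real (\<delta> powr (- real CARD('n))) * (?c * complex_of_real (exp (- (norm ((1 / \<delta>) *\<^sub>R \<zeta>))\<^sup>2 / 2)))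
     = ?c\<^sup>2 * (\<integral>x. cis (x \<bullet> \<zeta>) * complex_of_real (gauss_reg \<delta> x) \<partial>lborel)"
    by (simp add: mult.assoc[symmetric])
  then show ?thesis by (simp add: gauss_def)
qed

lemma abs_gauss_reg [simp]: "\<bar>gauss_reg \<delta> x\<bar> = gauss_reg \<delta> x"
  by (simp add: gauss_reg_bounds)

lemma gauss_mult_le: "cmod w \<le> B \<Longrightarrow> cmod (complex_of_real (gauss z) * w) \<le> B * gauss z"
  using gauss_nonneg[of z] by (simp add: norm_mult mult.commute[of "gauss z"] mult_right_mono)

lemma gauss_mult_integrable:
  assumes [measurable]: "b \<in> borel_measurable lborel" and bd: "\<And>x. cmod (b x) \<le> B"
  shows "integrable lborel (\<lambda>z. complex_of_real (gauss z) * b (\<xi> + \<delta> *\<^sub>R z))"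
proof (rule Bochner_Integration.integrable_bound[OF integrable_mult_right[OF gauss_integrable, of B]])
  have "0 \<le> B" using bd order_trans norm_ge_zero by blast
  then show "AE z in lborel. norm (complex_of_real (gauss z) * b (\<xi> + \<delta> *\<^sub>R z)) \<le> norm (B * gauss z)"
    using order_trans[OF gauss_mult_le[OF bd] abs_ge_self] by (intro AE_I2) simp
qed simp

lemma gauss_smooth_bound:
  assumes m: "b \<in> borel_measurable lborel" and bd: "\<And>x. cmod (b x) \<le> B"
  shows "cmod (gauss_smooth \<delta> b \<xi>) \<le> B"
proof -
  have "cmod (gauss_smooth \<delta> b \<xi>) \<le> (\<integral>z. cmod (complex_of_real (gauss z) * b (\<xi> + \<delta> *\<^sub>R z)) \<partial>lborel)"
    unfolding gauss_smooth_def by (rule integral_norm_bound)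
  also have "\<dots> \<le> (\<integral>z. B * gauss z \<partial>(lborel :: (real^'a) measure))"
    by (intro integral_mono integrable_norm gauss_mult_integrable[OF m bd] integrable_mult_right gauss_integrable
        gauss_mult_le bd)
  also have "\<dots> = B" by (simp add: gauss_integral)
  finally show ?thesis .
qed

text \<open>Regularised Fourier inversion: damping \<open>IFT b\<close> by a Gaussian averages \<open>b\<close> against a narrow Gaussian.\<close>

lemma FT_IFT_gauss_reg:
  fixes b :: "real^'n::finite \<Rightarrow> complex"
  assumes b: "integrable lborel b" and \<delta>: "\<delta> > 0"
  shows "FT (\<lambda>x. IFT b x * complex_of_real (gauss_reg \<delta> x)) \<xi> = gauss_smooth \<delta> b \<xi>"
proof -
  let ?c = "complex_of_real (fourier_const TYPE('n))"
  have [measurable]: "b \<in> borel_measurable borel" using b by simp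
  have f: "integrable lborel (\<lambda>x. cis (- (x \<bullet> \<xi>)) * complex_of_real (gauss_reg \<delta> x))"
    using integrable_cis_mult[OF integrable_of_real[OF gauss_reg_integrable], of \<delta> "- \<xi>"] \<delta>
    by (simp add: inner_commute)
  have "FT (\<lambda>x. IFT b x * complex_of_real (gauss_reg \<delta> x)) \<xi> =
      ?c * (\<integral>x. ?c * ((cis (- (x \<bullet> \<xi>)) * complex_of_real (gauss_reg \<delta> x)) * (\<integral>\<eta>. cis (x \<bullet> \<eta>) * b \<eta> \<partial>lborel)) \<partial>lborel)"
    by (simp add: FT_eq IFT_eq mult_ac)
  also have "\<dots> = ?c\<^sup>2 * (\<integral>x. (cis (- (x \<bullet> \<xi>)) * complex_of_real (gauss_reg \<delta> x)) * (\<integral>\<eta>. cis (x \<bullet> \<eta>) * b \<eta> \<partial>lborel) \<partial>lborel)"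
    by (simp add: power2_eq_square)
  also have "\<dots> = ?c\<^sup>2 * (\<integral>\<eta>. b \<eta> * (\<integral>x. cis (x \<bullet> \<eta>) * (cis (- (x \<bullet> \<xi>)) * complex_of_real (gauss_reg \<delta> x)) \<partial>lborel) \<partial>lborel)"
    by (subst fubini_kernel[OF f b, of "\<lambda>x \<eta>. cis (x \<bullet> \<eta>)" 1]) auto
  also have "\<dots> = (\<integral>\<eta>. b \<eta> * (?c\<^sup>2 * (\<integral>x. cis (x \<bullet> (\<eta> - \<xi>)) * complex_of_real (gauss_reg \<delta> x) \<partial>lborel)) \<partial>lborel)"
  proof -
    have *: "cis (x \<bullet> \<eta>) * (cis (- (x \<bullet> \<xi>)) * complex_of_real (gauss_reg \<delta> x)) = cis (x \<bullet> (\<eta> - \<xi>)) * complex_of_real (gauss_reg \<delta> x)" for x \<eta>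
      by (simp add: cis_mult inner_diff_right mult.assoc[symmetric])
    have "(\<lambda>\<eta>. b \<eta> * (?c\<^sup>2 * (\<integral>x. cis (x \<bullet> (\<eta> - \<xi>)) * complex_of_real (gauss_reg \<delta> x) \<partial>lborel)))
      = (\<lambda>\<eta>. ?c\<^sup>2 * (b \<eta> * (\<integral>x. cis (x \<bullet> \<eta>) * (cis (- (x \<bullet> \<xi>)) * complex_of_real (gauss_reg \<delta> x)) \<partial>lborel)))"
      by (simp only: *) (simp add: mult.left_commute)
    then show ?thesis by (simp only: integral_mult_right_zero)
  qed
  also have "\<dots> = (\<integral>\<eta>. b \<eta> * complex_of_real (\<delta> powr (- real CARD('n)) * gauss ((1 / \<delta>) *\<^sub>R (\<eta> - \<xi>))) \<partial>lborel)"
    by (simp add: gauss_reg_fourier[OF \<delta>])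
  also have "\<dots> = \<bar>\<delta>\<bar>^DIM(real^'n) *\<^sub>R (\<integral>z. b (\<xi> + \<delta> *\<^sub>R z) * complex_of_real (\<delta> powr (- real CARD('n)) * gauss ((1 / \<delta>) *\<^sub>R ((\<xi> + \<delta> *\<^sub>R z) - \<xi>))) \<partial>lborel)"
    by (rule integral_lborel_affine) (use \<delta> in auto)
  also have "(\<lambda>z. b (\<xi> + \<delta> *\<^sub>R z) * complex_of_real (\<delta> powr (- real CARD('n)) * gauss ((1 / \<delta>) *\<^sub>R ((\<xi> + \<delta> *\<^sub>R z) - \<xi>))))
      = (\<lambda>z. complex_of_real (\<delta> powr (- real CARD('n))) * (complex_of_real (gauss z) * b (\<xi> + \<delta> *\<^sub>R z)))"
    using \<delta> by (auto simp: mult_ac)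
  also have "\<bar>\<delta>\<bar>^DIM(real^'n) *\<^sub>R (\<integral>z. complex_of_real (\<delta> powr (- real CARD('n))) * (complex_of_real (gauss z) * b (\<xi> + \<delta> *\<^sub>R z)) \<partial>lborel)
      = complex_of_real (\<delta>^CARD('n) * \<delta> powr (- real CARD('n))) * gauss_smooth \<delta> b \<xi>"
    using \<delta> by (simp add: gauss_smooth_def scaleR_conv_of_real)
  also have "\<delta>^CARD('n) * \<delta> powr (- real CARD('n)) = 1"
    using \<delta> by (simp add: powr_minus powr_realpow)
  also have "complex_of_real 1 * gauss_smooth \<delta> b \<xi> = gauss_smooth \<delta> b \<xi>" by simp
  finally show ?thesis .
qed

lemma gauss_smooth_tendsto:
  assumes cont: "continuous_on UNIV b" and bd: "\<And>x. cmod (b x) \<le> B"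
  shows "(\<lambda>n. gauss_smooth (1 / real (Suc n)) b \<xi>) \<longlonglongrightarrow> b \<xi>"
proof -
  have m [measurable]: "b \<in> borel_measurable borel"
    using borel_measurable_cont[OF cont] by simp
  have "0 \<le> B" using bd order_trans norm_ge_zero by blast
  have l: "(\<lambda>n. complex_of_real (gauss z) * b (\<xi> + (1 / real (Suc n)) *\<^sub>R z)) \<longlonglongrightarrow> complex_of_real (gauss z) * b (\<xi> + 0 *\<^sub>R z)" for z
  proof (intro tendsto_mult tendsto_const)
    have "(\<lambda>n. \<xi> + (1 / real (Suc n)) *\<^sub>R z) \<longlonglongrightarrow> \<xi> + 0 *\<^sub>R z"
      using LIMSEQ_inverse_real_of_nat by (intro tendsto_intros) (simp add: inverse_eq_divide)
    then show "(\<lambda>n. b (\<xi> + (1 / real (Suc n)) *\<^sub>R z)) \<longlonglongrightarrow> b (\<xi> + 0 *\<^sub>R z)"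
      by (rule continuous_on_tendsto_compose[OF cont]) auto
  qed
  have "(\<lambda>n. gauss_smooth (1 / real (Suc n)) b \<xi>) \<longlonglongrightarrow> (\<integral>z. complex_of_real (gauss z) * b (\<xi> + 0 *\<^sub>R z) \<partial>lborel)"
    unfolding gauss_smooth_def
  proof (rule integral_dominated_convergence[where w = "\<lambda>z. B * gauss z"])
    show "integrable lborel (\<lambda>z::real^'a. B * gauss z)"
      by (intro integrable_mult_right gauss_integrable)
    show "AE z in lborel. (\<lambda>n. complex_of_real (gauss z) * b (\<xi> + (1 / real (Suc n)) *\<^sub>R z)) \<longlonglongrightarrow> complex_of_real (gauss z) * b (\<xi> + 0 *\<^sub>R z)"
      using l by (intro AE_I2)
    show "AE z in lborel. norm (complex_of_real (gauss z) * b (\<xi> + (1 / real (Suc n)) *\<^sub>R z)) \<le> B * gauss z" for n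
      by (intro AE_I2 gauss_mult_le bd)
  qed simp_all
  also have "(\<integral>z. complex_of_real (gauss z) * b (\<xi> + 0 *\<^sub>R z) \<partial>lborel) = b \<xi> * of_real (\<integral>z. gauss z \<partial>(lborel :: (real^'a) measure))"
    by (simp add: mult.commute[of _ "b \<xi>"])
  finally show ?thesis by (simp add: gauss_integral)
qed

text \<open>Both sides are limits of the same damped transform: integrability of
  \<open>IFT b\<close> allows the damping to be removed under the integral, while the equivalent
  Gaussian averages converge to \<open>b\<close> by continuity.\<close>

lemma FT_IFT:
  assumes b: "nice b" and i: "integrable lborel (IFT b)"
  shows "FT (IFT b) \<xi> = b \<xi>"
proof -
  have bi: "integrable lborel b" and bc: "continuous_on UNIV b" and "\<exists>B. \<forall>x. cmod (b x) \<le> B"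
    using b by (auto simp: nice_def)
  then obtain B where B: "\<And>x. cmod (b x) \<le> B" by auto
  have [measurable]: "IFT b \<in> borel_measurable borel" using i by simp
  have "(\<lambda>n. FT (\<lambda>x. IFT b x * complex_of_real (gauss_reg (1 / real (Suc n)) x)) \<xi>) \<longlonglongrightarrow> FT (IFT b) \<xi>"
    unfolding FT_eq
  proof (intro tendsto_mult tendsto_const integral_dominated_convergence[where w = "\<lambda>x. cmod (IFT b x)"])
    have "(\<lambda>n. cis (- (x \<bullet> \<xi>)) * (IFT b x * complex_of_real (gauss_reg (1 / real (Suc n)) x))) \<longlonglongrightarrow> cis (- (x \<bullet> \<xi>)) * (IFT b x * complex_of_real 1)" for x
      by (intro tendsto_intros gauss_reg_tendsto)
    then show "AE x in lborel. (\<lambda>n. cis (- (x \<bullet> \<xi>)) * (IFT b x * complex_of_real (gauss_reg (1 / real (Suc n)) x))) \<longlonglongrightarrow> cis (- (x \<bullet> \<xi>)) * IFT b x"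
      by simp
    show "AE x in lborel. norm (cis (- (x \<bullet> \<xi>)) * (IFT b x * complex_of_real (gauss_reg (1 / real (Suc n)) x))) \<le> cmod (IFT b x)" for n
      using gauss_reg_bounds[of "1 / real (Suc n)"] by (intro AE_I2) (auto simp: norm_mult intro!: mult_left_le simp del: of_nat_Suc)
  qed (use i in auto)
  moreover have "FT (\<lambda>x. IFT b x * complex_of_real (gauss_reg (1 / real (Suc n)) x)) \<xi> = gauss_smooth (1 / real (Suc n)) b \<xi>" for n
    by (rule FT_IFT_gauss_reg[OF bi]) simp
  ultimately have "(\<lambda>n. gauss_smooth (1 / real (Suc n)) b \<xi>) \<longlonglongrightarrow> FT (IFT b) \<xi>"
    by (simp only:)
  then show ?thesis
    by (rule LIMSEQ_unique) (rule gauss_smooth_tendsto[OF bc B])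
qed

lemma IFT_reflect:
  fixes f :: "real^'n::finite \<Rightarrow> complex"
  assumes [measurable]: "f \<in> borel_measurable borel"
  shows "IFT (\<lambda>x. f (- x)) \<xi> = IFT f (- \<xi>)"
proof -
  have "(\<integral>x. cis (\<xi> \<bullet> x) * f (- x) \<partial>lborel) = \<bar>- 1\<bar>^DIM(real^'n) *\<^sub>R (\<integral>x. cis (\<xi> \<bullet> (0 + (- 1) *\<^sub>R x)) * f (- (0 + (- 1) *\<^sub>R x)) \<partial>lborel)"
    by (rule integral_lborel_affine) auto
  then show ?thesis by (simp add: IFT_eq)
qed

text \<open>\<open>FT b\<close> is the inverse transform of the reflected function, so this is
  \<open>FT_IFT\<close> for the reflection, read at the reflected point.\<close>

lemma IFT_FT:
  assumes b: "nice b" and i: "integrable lborel (FT b)"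
  shows "IFT (FT b) x = b x"
proof -
  have e: "FT b = IFT (\<lambda>x. b (- x))"
  proof
    have "b \<in> borel_measurable borel" using b by (auto simp: nice_def)
    then show "FT b x = IFT (\<lambda>x. b (- x)) x" for x by (simp add: FT_eq_IFT IFT_reflect)
  qed
  have nb: "nice (\<lambda>x. b (- x))"
    unfolding nice_def
  proof (intro conjI)
    have "continuous_on UNIV b" using b by (simp add: nice_def)
    then show "continuous_on UNIV (\<lambda>x. b (- x))"
      by (rule continuous_on_compose2) (auto intro: continuous_on_minus continuous_on_id)
    show "\<exists>B. \<forall>x. cmod (b (- x)) \<le> B" using b unfolding nice_def by blast
    show "integrable lborel (\<lambda>x. b (- x))"
      using b integrable_lborel_affine[of b "-1" 0] by (simp add: nice_def)
  qed
  have "IFT (FT b) x = FT (IFT (\<lambda>x. b (- x))) (- x)"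
    by (simp add: FT_eq_IFT e)
  also have "\<dots> = b x"
    using FT_IFT[OF nb] i by (simp add: e)
  finally show ?thesis .
qed

text \<open>The function \<open>IFT a\<close> is bounded but not known to decay, so pairings are
  taken with Gaussian damping; \<open>main\<close> identifies their limit on the frequency side. For
  equal arguments this bounds the damped norms and Fatou yields square integrability, after which
  dominated convergence removes the damping from the inner product.\<close>

lemma IFT_isometry:
  assumes a: "nice a" and b: "nice b"
  shows "l2 (IFT a)" and "l2inner (IFT a) (IFT b) = l2inner a b"
proof -
  have main: "(\<lambda>n. \<integral>x. cnj (IFT a x) * (IFT b x * complex_of_real (gauss_reg (1 / real (Suc n)) x)) \<partial>lborel) \<longlonglongrightarrow> l2inner a b"
    if a: "nice a" and b: "nice b" for a b :: "real^'a \<Rightarrow> complex"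
  proof -
    have ai: "integrable lborel a" and bi: "integrable lborel b" and bc: "continuous_on UNIV b"
      and "\<exists>B. \<forall>x. cmod (b x) \<le> B"
      using a b by (auto simp: nice_def)
    then obtain B where B: "\<And>x. cmod (b x) \<le> B" by auto
    have [measurable]: "a \<in> borel_measurable borel" "b \<in> borel_measurable borel" using ai bi by auto
    have sm [measurable]: "(\<lambda>\<xi>. gauss_smooth (1 / real (Suc n)) b \<xi>) \<in> borel_measurable borel" for n
      unfolding gauss_smooth_def by measurable
    have eq: "(\<integral>x. cnj (IFT a x) * (IFT b x * complex_of_real (gauss_reg (1 / real (Suc n)) x)) \<partial>lborel)
        = (\<integral>\<xi>. cnj (a \<xi>) * gauss_smooth (1 / real (Suc n)) b \<xi> \<partial>lborel)" for n
    proof -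
      have "integrable lborel (\<lambda>x. IFT b x * complex_of_real (gauss_reg (1 / real (Suc n)) x))"
      proof (rule Bochner_Integration.integrable_bound)
        show "integrable lborel (\<lambda>x::real^'a. fourier_const TYPE('a) * (\<integral>\<xi>. cmod (b \<xi>) \<partial>lborel) * gauss_reg (1 / real (Suc n)) x)"
          by (intro integrable_mult_right gauss_reg_integrable) simp
        show "AE x in lborel. norm (IFT b x * complex_of_real (gauss_reg (1 / real (Suc n)) x))
            \<le> norm (fourier_const TYPE('a) * (\<integral>\<xi>. cmod (b \<xi>) \<partial>lborel) * gauss_reg (1 / real (Suc n)) x)"
          using gauss_reg_bounds[of "1 / real (Suc n)"] order_trans[OF IFT_bound[of b] abs_ge_self]
          by (intro AE_I2) (auto simp: norm_mult abs_mult intro!: mult_right_mono)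
      qed (use bi in measurable)
      from cnj_IFT_mult[OF ai this] show ?thesis
        by (simp add: FT_IFT_gauss_reg[OF bi])
    qed
    show ?thesis
      unfolding eq l2inner_def
    proof (rule integral_dominated_convergence[where w = "\<lambda>x. cmod (a x) * B"])
      show "AE x in lborel. (\<lambda>n. cnj (a x) * gauss_smooth (1 / real (Suc n)) b x) \<longlonglongrightarrow> cnj (a x) * b x"
        by (intro AE_I2 tendsto_intros gauss_smooth_tendsto[OF bc B])
      show "AE x in lborel. norm (cnj (a x) * gauss_smooth (1 / real (Suc n)) b x) \<le> cmod (a x) * B" for n
        using gauss_smooth_bound[of b B] B by (intro AE_I2) (simp add: norm_mult mult_left_mono)
    qed (use ai in \<open>auto simp del: of_nat_Suc\<close>)
  qed
  have l2: "l2 (IFT a)" if a: "nice a" for a :: "real^'a \<Rightarrow> complex"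
  proof (rule l2_fatou(1))
    have ai: "integrable lborel a" using a by (auto simp: nice_def)
    have am [measurable]: "IFT a \<in> borel_measurable borel" using ai by measurable
    \<comment> \<open>The square root puts exactly one factor \<open>gauss_reg\<close> into the
      squared modulus, matching the damped pairing in \<open>main\<close>.\<close>
    define w where "w n x = IFT a x * sqrt (gauss_reg (1 / real (Suc n)) x)" for n x
    have wsq: "(cmod (w n x))\<^sup>2 = (cmod (IFT a x))\<^sup>2 * gauss_reg (1 / real (Suc n)) x" for n x
      by (simp add: w_def norm_mult power_mult_distrib gauss_reg_bounds del: of_nat_Suc)
    show "l2 (w n)" for n
      unfolding l2_def
    proof
      show "integrable lborel (\<lambda>x. (cmod (w n x))\<^sup>2)"
        unfolding wsq
      proof (rule Bochner_Integration.integrable_bound)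
        show "integrable lborel (\<lambda>x::real^'a. (fourier_const TYPE('a) * (\<integral>\<xi>. cmod (a \<xi>) \<partial>lborel))\<^sup>2 * gauss_reg (1 / real (Suc n)) x)"
          by (intro integrable_mult_right gauss_reg_integrable) simp
        show "AE x in lborel. norm ((cmod (IFT a x))\<^sup>2 * gauss_reg (1 / real (Suc n)) x)
          \<le> norm ((fourier_const TYPE('a) * (\<integral>\<xi>. cmod (a \<xi>) \<partial>lborel))\<^sup>2 * gauss_reg (1 / real (Suc n)) x)"
          using gauss_reg_bounds[of "1 / real (Suc n)"]
          by (intro AE_I2) (auto simp: abs_mult intro!: mult_right_mono power_mono IFT_bound)
      qed measurable
    qed (unfold w_def, measurable)
    have "complex_of_real ((l2norm (w n))\<^sup>2) = (\<integral>x. cnj (IFT a x) * (IFT a x * complex_of_real (gauss_reg (1 / real (Suc n)) x)) \<partial>lborel)" for n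
    proof -
      have "complex_of_real ((l2norm (w n))\<^sup>2) = (\<integral>x. complex_of_real ((cmod (w n x))\<^sup>2) \<partial>lborel)"
        by (simp only: l2norm_sq integral_complex_of_real)
      also have "\<dots> = (\<integral>x. cnj (IFT a x) * (IFT a x * complex_of_real (gauss_reg (1 / real (Suc n)) x)) \<partial>lborel)"
        unfolding wsq by (simp add: complex_norm_square mult_ac flip: of_real_power)
      finally show ?thesis .
    qed
    then have "(\<lambda>n. complex_of_real ((l2norm (w n))\<^sup>2)) \<longlonglongrightarrow> complex_of_real ((l2norm a)\<^sup>2)"
      using main[OF a a] by (simp add: l2inner_self[OF nice_l2[OF a]])
    then have "(\<lambda>n. (l2norm (w n))\<^sup>2) \<longlonglongrightarrow> (l2norm a)\<^sup>2"
      by (simp only: tendsto_of_real_iff)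
    then have "(\<lambda>n. sqrt ((l2norm (w n))\<^sup>2)) \<longlonglongrightarrow> sqrt ((l2norm a)\<^sup>2)"
      by (intro tendsto_real_sqrt)
    then have lim: "(\<lambda>n. l2norm (w n)) \<longlonglongrightarrow> l2norm a" by simp
    show "\<forall>\<^sub>F n in sequentially. l2norm (w n) \<le> l2norm a + 1"
      by (rule eventually_mono[OF order_tendstoD(2)[OF lim, of "l2norm a + 1"]]) auto
    show "AE x in lborel. (\<lambda>n. w n x) \<longlonglongrightarrow> IFT a x"
    proof (rule AE_I2)
      fix x :: "real^'a"
      have "(\<lambda>n. w n x) \<longlonglongrightarrow> IFT a x * complex_of_real (sqrt 1)"
        unfolding w_def by (intro tendsto_intros gauss_reg_tendsto)
      then show "(\<lambda>n. w n x) \<longlonglongrightarrow> IFT a x" by simp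
    qed
    show "IFT a \<in> borel_measurable lborel" using am by simp
  qed simp
  show la: "l2 (IFT a)" by (rule l2[OF a])
  have lb: "l2 (IFT b)" by (rule l2[OF b])
  note [measurable] = la[THEN l2_measurable] lb[THEN l2_measurable]
  have "(\<lambda>n. \<integral>x. cnj (IFT a x) * (IFT b x * complex_of_real (gauss_reg (1 / real (Suc n)) x)) \<partial>lborel) \<longlonglongrightarrow> l2inner (IFT a) (IFT b)"
    unfolding l2inner_def
  proof (rule integral_dominated_convergence[where w = "\<lambda>x. cmod (IFT a x) * cmod (IFT b x)"])
    have "(\<lambda>n. cnj (IFT a x) * (IFT b x * complex_of_real (gauss_reg (1 / real (Suc n)) x))) \<longlonglongrightarrow> cnj (IFT a x) * (IFT b x * complex_of_real 1)" for x
      by (intro tendsto_intros gauss_reg_tendsto)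
    then show "AE x in lborel. (\<lambda>n. cnj (IFT a x) * (IFT b x * complex_of_real (gauss_reg (1 / real (Suc n)) x))) \<longlonglongrightarrow> cnj (IFT a x) * IFT b x"
      by simp
    show "AE x in lborel. norm (cnj (IFT a x) * (IFT b x * complex_of_real (gauss_reg (1 / real (Suc n)) x))) \<le> cmod (IFT a x) * cmod (IFT b x)" for n
      using gauss_reg_bounds[of "1 / real (Suc n)"] by (intro AE_I2) (auto simp: norm_mult intro!: mult_left_mono mult_left_le simp del: of_nat_Suc)
  qed (use l2_norm_mult_integrable[OF la lb] in auto)
  then show "l2inner (IFT a) (IFT b) = l2inner a b"
    using main[OF a b] LIMSEQ_unique by blast
qed

section \<open>Decay of Fourier transforms of test functions\<close>

lemma vector_derivative_bound:
  fixes f :: "real \<Rightarrow> 'a::real_normed_vector"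
  assumes "\<And>t. (f has_vector_derivative f' t) (at t)" "\<And>t. norm (f' t) \<le> B"
  shows "norm (f x - f y) \<le> B * \<bar>x - y\<bar>"
proof -
  have "norm (f x - f y) \<le> B * norm (x - y)"
  proof (rule differentiable_bound[of UNIV f "\<lambda>t h. h *\<^sub>R f' t"])
    show "(f has_derivative (\<lambda>h. h *\<^sub>R f' t)) (at t within UNIV)" for t
      using assms(1)[of t] by (simp add: has_vector_derivative_def)
    show "onorm (\<lambda>h. h *\<^sub>R f' t) \<le> B" for t
      using assms(2)[of t] by (intro onorm_le) (simp add: mult.commute[of B] mult_left_mono)
  qed auto
  then show ?thesis by simp
qed

lemma has_vector_derivative_quotient:
  fixes f :: "real \<Rightarrow> 'a::real_normed_vector"
  assumes "(f has_vector_derivative D) (at x)"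
  shows "((\<lambda>h. (f (x + h) - f x) /\<^sub>R h) \<longlongrightarrow> D) (at 0)"
proof (rule LIM_zero_cancel, rule tendsto_norm_zero_cancel, rule Lim_transform_eventually)
  show "((\<lambda>h. norm (f (x + h) - f x - h *\<^sub>R D) / norm h) \<longlongrightarrow> 0) (at 0)"
    using assms by (simp add: has_vector_derivative_def has_derivative_at)
  have "norm (f (x + h) - f x - h *\<^sub>R D) / norm h = norm ((f (x + h) - f x) /\<^sub>R h - D)" if "h \<noteq> 0" for h
  proof -
    have "(f (x + h) - f x) /\<^sub>R h - D = (f (x + h) - f x - h *\<^sub>R D) /\<^sub>R h"
      using that by (simp add: scaleR_diff_right)
    then show ?thesis by (simp add: divide_inverse mult.commute)
  qed
  then show "\<forall>\<^sub>F h in at 0. norm (f (x + h) - f x - h *\<^sub>R D) / norm h = norm ((f (x + h) - f x) /\<^sub>R h - D)"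
    by (simp add: eventually_at_filter)
qed

lemma cis_difference_quotient: "(\<lambda>n. (cis (t / real (Suc n)) - 1) * real (Suc n)) \<longlonglongrightarrow> \<i> * t"
proof -
  have "((\<lambda>z. exp (\<i> * t * z)) has_field_derivative \<i> * t) (at 0)"
    by (auto intro!: derivative_eq_intros)
  then have "((\<lambda>h. (exp (\<i> * t * h) - 1) / h) \<longlongrightarrow> \<i> * t) (at 0)"
    by (simp add: DERIV_def)
  moreover have "filterlim (\<lambda>n. complex_of_real (inverse (real (Suc n)))) (at 0) sequentially"
  proof (rule filterlim_atI)
    have "(\<lambda>n. complex_of_real (inverse (real (Suc n)))) \<longlonglongrightarrow> complex_of_real 0"
      by (intro tendsto_of_real LIMSEQ_inverse_real_of_nat)
    then show "(\<lambda>n. complex_of_real (inverse (real (Suc n)))) \<longlonglongrightarrow> 0" by simp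
  qed (simp del: of_nat_Suc)
  ultimately have "(\<lambda>n. (exp (\<i> * t * complex_of_real (inverse (real (Suc n)))) - 1) / complex_of_real (inverse (real (Suc n)))) \<longlonglongrightarrow> \<i> * t"
    by (rule filterlim_compose)
  then show ?thesis by (simp add: cis_conv_exp divide_inverse mult.assoc del: of_nat_Suc)
qed

lemma integral_cis_shift:
  assumes [measurable]: "\<phi> \<in> borel_measurable borel"
  shows "(\<integral>x. cis (- (x \<bullet> \<xi>)) * \<phi> (x + y) \<partial>lborel) = cis (y \<bullet> \<xi>) * (\<integral>x. cis (- (x \<bullet> \<xi>)) * \<phi> x \<partial>lborel)"
proof -
  have "(\<integral>x. cis (- (x \<bullet> \<xi>)) * \<phi> x \<partial>lborel) = \<bar>1\<bar>^DIM('a) *\<^sub>R (\<integral>x. cis (- ((y + 1 *\<^sub>R x) \<bullet> \<xi>)) * \<phi> (y + 1 *\<^sub>R x) \<partial>lborel)"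
    by (rule integral_lborel_affine) auto
  also have "\<dots> = (\<integral>x. cis (- (y \<bullet> \<xi>)) * (cis (- (x \<bullet> \<xi>)) * \<phi> (x + y)) \<partial>lborel)"
  proof -
    have "cis (- ((y + 1 *\<^sub>R x) \<bullet> \<xi>)) * \<phi> (y + 1 *\<^sub>R x) = cis (- (y \<bullet> \<xi>)) * (cis (- (x \<bullet> \<xi>)) * \<phi> (x + y))" for x
      by (simp add: inner_add_left mult.assoc[symmetric] cis_mult add.commute)
    then show ?thesis by (simp only: scaleR_one abs_one power_one)
  qed
  also have "\<dots> = cis (- (y \<bullet> \<xi>)) * (\<integral>x. cis (- (x \<bullet> \<xi>)) * \<phi> (x + y) \<partial>lborel)"
    by (rule integral_mult_right_zero)
  finally show ?thesis by (simp add: mult.assoc[symmetric] cis_mult)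
qed

lemma FT_shift:
  assumes "\<phi> \<in> borel_measurable borel"
  shows "FT (\<lambda>x. \<phi> (x + y)) \<xi> = cis (y \<bullet> \<xi>) * FT \<phi> \<xi>"
  by (simp add: FT_eq integral_cis_shift[OF assms])

text \<open>Integration by parts is replaced by translation: shifting \<open>\<phi>\<close>
  multiplies its transform by a phase, and the difference quotients converge on both sides.\<close>

lemma FT_pdiff:
  fixes \<phi> :: "real^'n::finite \<Rightarrow> complex"
  assumes \<phi>: "test_fun \<phi>"
  shows "FT (pdiff i \<phi>) \<xi> = \<i> * of_real (\<xi> $ i) * FT \<phi> \<xi>"
proof -
  let ?e = "axis i 1 :: real^'n"
  have sm: "smooth_Rd \<phi>" using \<phi> by (simp add: test_fun_def)
  have [measurable]: "\<phi> \<in> borel_measurable borel"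
    using borel_measurable_cont[OF test_fun_cont[OF \<phi>]] by simp
  have [measurable]: "pdiff i \<phi> \<in> borel_measurable borel"
    using borel_measurable_cont[OF test_fun_cont[OF test_fun_pdiff[OF \<phi>]]] by simp
  obtain R where R: "\<And>x. \<phi> x \<noteq> 0 \<Longrightarrow> norm x \<le> R"
    using cc_bound[OF test_fun_cc[OF \<phi>]] by metis
  obtain B where B: "\<And>x. cmod (pdiff i \<phi> x) \<le> B" "0 \<le> B"
    using cc_bound[OF test_fun_cc[OF test_fun_pdiff[OF \<phi>, of i]]] by metis
  have d0: "((\<lambda>h. \<phi> (x + h *\<^sub>R ?e)) has_vector_derivative pdiff i \<phi> x) (at 0)" for x
    using smooth_Rd_pdiff[OF sm, of "[]" x i] by simp
  have d: "((\<lambda>h. \<phi> (x + h *\<^sub>R ?e)) has_vector_derivative pdiff i \<phi> (x + t *\<^sub>R ?e)) (at t)" for x t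
  proof -
    have "(((\<lambda>h. \<phi> ((x + t *\<^sub>R ?e) + h *\<^sub>R ?e)) \<circ> (\<lambda>h. h - t)) has_vector_derivative 1 *\<^sub>R pdiff i \<phi> (x + t *\<^sub>R ?e)) (at t)"
      by (rule vector_diff_chain_at) (auto intro!: derivative_eq_intros simp: d0)
    then show ?thesis by (simp add: comp_def algebra_simps)
  qed
  define D where "D n x = (\<phi> (x + (1 / real (Suc n)) *\<^sub>R ?e) - \<phi> x) * real (Suc n)" for n x
  \<comment> \<open>The shifts have length at most 1, so beyond radius \<open>R + 1\<close> both
    terms vanish; inside, the mean value inequality gives the bound.\<close>
  have Db: "cmod (D n x) \<le> B * indicator (cball 0 (R + 1)) x" for n x
  proof (cases "x \<in> cball 0 (R + 1)")
    case True
    have "cmod (\<phi> (x + (1 / real (Suc n)) *\<^sub>R ?e) - \<phi> (x + 0 *\<^sub>R ?e)) \<le> B * \<bar>1 / real (Suc n) - 0\<bar>"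
      by (rule vector_derivative_bound[OF d B(1)])
    from mult_right_mono[OF this, of "real (Suc n)"] show ?thesis
      using True by (simp add: D_def norm_mult del: of_nat_Suc)
  next
    case False
    have n1: "norm ((1 / real (Suc n)) *\<^sub>R ?e) \<le> 1" by (simp add: norm_axis_1)
    have "\<phi> x = 0" using R[of x] False by auto
    moreover have "\<phi> (x + (1 / real (Suc n)) *\<^sub>R ?e) = 0"
    proof (rule ccontr)
      assume "\<phi> (x + (1 / real (Suc n)) *\<^sub>R ?e) \<noteq> 0"
      then have "norm (x + (1 / real (Suc n)) *\<^sub>R ?e) \<le> R" by (rule R)
      then have "norm x \<le> R + 1"
        using n1 norm_triangle_ineq4[of "x + (1 / real (Suc n)) *\<^sub>R ?e" "(1 / real (Suc n)) *\<^sub>R ?e"]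
        unfolding add_diff_cancel_right' by linarith
      then show False using False by simp
    qed
    ultimately show ?thesis using False by (simp add: D_def)
  qed
  have Dl: "(\<lambda>n. D n x) \<longlonglongrightarrow> pdiff i \<phi> x" for x
  proof -
    have "((\<lambda>h. (\<phi> (x + h *\<^sub>R ?e) - \<phi> x) /\<^sub>R h) \<longlongrightarrow> pdiff i \<phi> x) (at 0)"
      using has_vector_derivative_quotient[OF d0[of x]] by simp
    moreover have "filterlim (\<lambda>n. inverse (real (Suc n))) (at 0) sequentially"
      by (rule filterlim_atI[OF LIMSEQ_inverse_real_of_nat]) (simp del: of_nat_Suc)
    ultimately have "(\<lambda>n. (\<phi> (x + inverse (real (Suc n)) *\<^sub>R ?e) - \<phi> x) /\<^sub>R inverse (real (Suc n))) \<longlonglongrightarrow> pdiff i \<phi> x"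
      by (rule filterlim_compose)
    then show ?thesis
      by (simp add: D_def scaleR_conv_of_real inverse_eq_divide mult.commute del: of_nat_Suc)
  qed
  have lim1: "(\<lambda>n. \<integral>x. cis (- (x \<bullet> \<xi>)) * D n x \<partial>lborel) \<longlonglongrightarrow> (\<integral>x. cis (- (x \<bullet> \<xi>)) * pdiff i \<phi> x \<partial>lborel)"
  proof (rule integral_dominated_convergence[OF _ _ integrable_indicator_cball[of B 0 "R + 1"]])
    show "(\<lambda>x. cis (- (x \<bullet> \<xi>)) * D n x) \<in> borel_measurable lborel" for n
      unfolding D_def by measurable
    show "AE x in lborel. (\<lambda>n. cis (- (x \<bullet> \<xi>)) * D n x) \<longlonglongrightarrow> cis (- (x \<bullet> \<xi>)) * pdiff i \<phi> x"
      by (intro AE_I2 tendsto_intros Dl)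
    show "AE x in lborel. norm (cis (- (x \<bullet> \<xi>)) * D n x) \<le> B * indicator (cball 0 (R + 1)) x" for n
      using Db by (intro AE_I2) simp
  qed measurable
  have \<phi>i: "integrable lborel \<phi>" by (rule test_fun_integrable[OF \<phi>])
  have eq: "(\<integral>x. cis (- (x \<bullet> \<xi>)) * D n x \<partial>lborel) = (cis (\<xi> $ i / real (Suc n)) - 1) * real (Suc n) * (\<integral>x. cis (- (x \<bullet> \<xi>)) * \<phi> x \<partial>lborel)" for n
  proof -
    let ?h = "(1 / real (Suc n)) *\<^sub>R ?e"
    have c1: "integrable lborel (\<lambda>x. cis (- (x \<bullet> \<xi>)) * \<phi> x)"
      using integrable_cis_mult[OF \<phi>i, of "- \<xi>"] by (simp add: inner_commute)
    have c2: "integrable lborel (\<lambda>x. cis (- (x \<bullet> \<xi>)) * \<phi> (x + ?h))"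
      using integrable_cis_mult[OF integrable_lborel_affine[OF \<phi>i, of 1 ?h], of "- \<xi>"] by (simp add: inner_commute add.commute)
    have "(\<integral>x. cis (- (x \<bullet> \<xi>)) * D n x \<partial>lborel) = (\<integral>x. real (Suc n) * (cis (- (x \<bullet> \<xi>)) * \<phi> (x + ?h) - cis (- (x \<bullet> \<xi>)) * \<phi> x) \<partial>lborel)"
      by (simp add: D_def algebra_simps del: of_nat_Suc)
    also have "\<dots> = real (Suc n) * ((\<integral>x. cis (- (x \<bullet> \<xi>)) * \<phi> (x + ?h) \<partial>lborel) - (\<integral>x. cis (- (x \<bullet> \<xi>)) * \<phi> x \<partial>lborel))"
      unfolding integral_mult_right_zero using c1 c2 by simp
    also have "(\<integral>x. cis (- (x \<bullet> \<xi>)) * \<phi> (x + ?h) \<partial>lborel) = cis (\<xi> $ i / real (Suc n)) * (\<integral>x. cis (- (x \<bullet> \<xi>)) * \<phi> x \<partial>lborel)"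
      by (subst integral_cis_shift) (auto simp: inner_axis' del: of_nat_Suc)
    finally show ?thesis by (simp add: algebra_simps del: of_nat_Suc)
  qed
  have "(\<lambda>n. (cis (\<xi> $ i / real (Suc n)) - 1) * real (Suc n) * (\<integral>x. cis (- (x \<bullet> \<xi>)) * \<phi> x \<partial>lborel)) \<longlonglongrightarrow> \<i> * of_real (\<xi> $ i) * (\<integral>x. cis (- (x \<bullet> \<xi>)) * \<phi> x \<partial>lborel)"
    by (intro tendsto_mult tendsto_const cis_difference_quotient)
  then have "(\<integral>x. cis (- (x \<bullet> \<xi>)) * pdiff i \<phi> x \<partial>lborel) = \<i> * of_real (\<xi> $ i) * (\<integral>x. cis (- (x \<bullet> \<xi>)) * \<phi> x \<partial>lborel)"
    using lim1 unfolding eq by (rule LIMSEQ_unique[rotated])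
  then show ?thesis by (simp add: FT_eq mult_ac)
qed

lemma FT_pd_iter_replicate:
  assumes "test_fun \<phi>"
  shows "FT (pd_iter (replicate N i) \<phi>) \<xi> = (\<i> * of_real (\<xi> $ i)) ^ N * FT \<phi> \<xi>"
  by (induction N) (auto simp: FT_pdiff[OF test_fun_pd_iter[OF assms]] mult.assoc)

text \<open>N derivatives in one coordinate give the decay of that coordinate's N-th power. The norm
  is then compared with the largest coordinate, so pure derivatives suffice.\<close>

lemma FT_test_fun_decay:
  fixes \<phi> :: "real^'n::finite \<Rightarrow> complex"
  assumes \<phi>: "test_fun \<phi>"
  obtains C where "\<And>\<xi>. (1 + norm \<xi>) ^ N * cmod (FT \<phi> \<xi>) \<le> C"
proof -
  define c where "c M i = fourier_const TYPE('n) * (\<integral>x. cmod (pd_iter (replicate M i) \<phi> x) \<partial>lborel)" for M and i :: 'n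
  have ci: "\<bar>\<xi> $ i\<bar> ^ M * cmod (FT \<phi> \<xi>) \<le> c M i" for \<xi> M i
  proof -
    have "\<bar>\<xi> $ i\<bar> ^ M * cmod (FT \<phi> \<xi>) = cmod (FT (pd_iter (replicate M i) \<phi>) \<xi>)"
      by (simp add: FT_pd_iter_replicate[OF \<phi>] norm_mult norm_power)
    then show ?thesis using FT_bound[of "pd_iter (replicate M i) \<phi>" \<xi>] by (simp add: c_def)
  qed
  \<comment> \<open>With no derivative taken, every coordinate gives the same bound, hence the
    arbitrary index \<open>undefined\<close>.\<close>
  have c0: "cmod (FT \<phi> \<xi>) \<le> c 0 undefined" for \<xi>
    using ci[of \<xi> undefined 0] by simp
  let ?n = "real CARD('n) + 1"
  have "(1 + norm \<xi>) ^ N * cmod (FT \<phi> \<xi>) \<le> ?n ^ N * (c 0 undefined + (\<Sum>i\<in>UNIV. c N i))" for \<xi>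
  proof -
    \<comment> \<open>Including 1 in the maximum absorbs the summand 1 of
      \<open>1 + norm \<xi>\<close>; if the maximum is 1 the undifferentiated bound applies,
      otherwise that of the maximal coordinate.\<close>
    define m where "m = Max (insert 1 (range (\<lambda>i. \<bar>\<xi> $ i\<bar>)))"
    have m1: "1 \<le> m" unfolding m_def by simp
    have mi: "\<bar>\<xi> $ i\<bar> \<le> m" for i unfolding m_def by (rule Max_ge) auto
    have "norm \<xi> \<le> (\<Sum>i\<in>UNIV. \<bar>\<xi> $ i\<bar>)" by (rule norm_le_l1_cart)
    also have "\<dots> \<le> real CARD('n) * m" using sum_bounded_above[of UNIV "\<lambda>i. \<bar>\<xi> $ i\<bar>" m] mi by simp
    finally have "1 + norm \<xi> \<le> ?n * m" using m1 by (simp add: algebra_simps)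
    then have "(1 + norm \<xi>) ^ N \<le> (?n * m) ^ N" by (intro power_mono) auto
    also have "\<dots> = ?n ^ N * m ^ N" by (simp add: power_mult_distrib)
    finally have 1: "(1 + norm \<xi>) ^ N * cmod (FT \<phi> \<xi>) \<le> ?n ^ N * (m ^ N * cmod (FT \<phi> \<xi>))"
      by (simp add: mult.assoc[symmetric] mult_right_mono)
    have "m \<in> insert 1 (range (\<lambda>i. \<bar>\<xi> $ i\<bar>))" unfolding m_def by (rule Max_in) auto
    then have "m ^ N * cmod (FT \<phi> \<xi>) \<le> c 0 undefined + (\<Sum>i\<in>UNIV. c N i)"
    proof
      have cn: "0 \<le> c N i" for i
        using fourier_const_pos[where 'n = 'n] by (auto simp: c_def)
      assume "m = 1"
      then show ?thesis using c0[of \<xi>] sum_nonneg[of UNIV "c N"] cn by simp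
    next
      have cn: "0 \<le> c M i" for M i
        using fourier_const_pos[where 'n = 'n] by (auto simp: c_def)
      assume "m \<in> range (\<lambda>i. \<bar>\<xi> $ i\<bar>)"
      then obtain i where i: "m = \<bar>\<xi> $ i\<bar>" by auto
      have "m ^ N * cmod (FT \<phi> \<xi>) \<le> c N i" unfolding i by (rule ci)
      also have "\<dots> \<le> (\<Sum>i\<in>UNIV. c N i)" using cn by (intro member_le_sum) auto
      finally show ?thesis using cn[of 0 undefined] by linarith
    qed
    then show ?thesis
      by (intro order_trans[OF 1] mult_left_mono) auto
  qed
  then show thesis by (rule that)
qed

lemma integrable_inverse_1_plus_sq: "integrable lborel (\<lambda>x::real. inverse (1 + x\<^sup>2))"
  using integrable_inverse_1_plus_square by (simp add: set_integrable_def einterval_def)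

text \<open>The exponent is twice the dimension so that each coordinate receives a square: the
  product of the factors 1 + \<xi>_b^2 is then a lower bound for the power, and its inverse is a
  product of integrable functions of one variable.\<close>

lemma integrable_inverse_power:
  "integrable lborel (\<lambda>\<xi>::real^'n::finite. inverse ((1 + norm \<xi>) ^ (2 * CARD('n))))"
proof (rule Bochner_Integration.integrable_bound)
  show "integrable lborel (\<lambda>\<xi>::real^'n. \<Prod>b\<in>Basis. inverse (1 + (\<xi> \<bullet> b)\<^sup>2))"
    by (rule integrable_lborel_prod) (rule integrable_inverse_1_plus_sq)
  show "AE \<xi> in lborel. norm (inverse ((1 + norm (\<xi>::real^'n)) ^ (2 * CARD('n)))) \<le> norm (\<Prod>b\<in>Basis. inverse (1 + (\<xi> \<bullet> b)\<^sup>2))"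
  proof (rule AE_I2)
    fix \<xi> :: "real^'n"
    have pos: "0 < (\<Prod>b\<in>Basis. 1 + (\<xi> \<bullet> b)\<^sup>2)" by (intro prod_pos) (auto simp: add_pos_nonneg)
    have "(\<Prod>b\<in>Basis. 1 + (\<xi> \<bullet> b)\<^sup>2) \<le> (\<Prod>b\<in>(Basis :: (real^'n) set). (1 + norm \<xi>)\<^sup>2)"
    proof (intro prod_mono conjI)
      fix b :: "real^'n" assume b: "b \<in> Basis"
      have "(\<xi> \<bullet> b)\<^sup>2 \<le> (norm \<xi>)\<^sup>2"
        using Basis_le_norm[OF b, of \<xi>] by (metis abs_ge_zero power2_abs power_mono)
      then show "1 + (\<xi> \<bullet> b)\<^sup>2 \<le> (1 + norm \<xi>)\<^sup>2"
        unfolding power2_sum one_power2 using norm_ge_zero[of \<xi>] by linarith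
    qed simp
    also have "\<dots> = (1 + norm \<xi>) ^ (2 * CARD('n))"
      by (simp add: power_mult)
    finally show "norm (inverse ((1 + norm \<xi>) ^ (2 * CARD('n)))) \<le> norm (\<Prod>b\<in>Basis. inverse (1 + (\<xi> \<bullet> b)\<^sup>2))"
      using pos le_imp_inverse_le[OF _ pos] prod_inversef[of "\<lambda>b. 1 + (\<xi> \<bullet> b)\<^sup>2" Basis]
      by (simp add: comp_def less_imp_le)
  qed
qed measurable

text \<open>Polynomial growth is what the rapid decay of the transform of a test function can
  absorb. The class contains the unbounded Bessel symbols as well as the phases of the free
  evolution.\<close>

definition tempered :: "(real^'n::finite \<Rightarrow> complex) \<Rightarrow> bool" where
  "tempered m \<longleftrightarrow> continuous_on UNIV m \<and> (\<exists>C N. \<forall>\<xi>. cmod (m \<xi>) \<le> C * (1 + norm \<xi>) ^ N)"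

lemma temperedI:
  "continuous_on UNIV m \<Longrightarrow> (\<And>\<xi>. cmod (m \<xi>) \<le> C * (1 + norm \<xi>) ^ N) \<Longrightarrow> tempered m"
  unfolding tempered_def by blast

lemma tempered_bounded:
  assumes "continuous_on UNIV m" "\<And>\<xi>. cmod (m \<xi>) \<le> C"
  shows "tempered m"
  by (rule temperedI[where C = C and N = 0]) (use assms in auto)

lemma tempered_cnj: "tempered m \<Longrightarrow> tempered (\<lambda>\<xi>. cnj (m \<xi>))"
  unfolding tempered_def by (auto intro: continuous_on_cnj)

lemma nice_tempered_FT:
  fixes \<phi> :: "real^'n::finite \<Rightarrow> complex"
  assumes m: "tempered m" and \<phi>: "test_fun \<phi>"
  shows "nice (\<lambda>\<xi>. m \<xi> * FT \<phi> \<xi>)"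
proof -
  have mc: "continuous_on UNIV m" using m by (simp add: tempered_def)
  obtain C N where m_le: "\<And>\<xi>. cmod (m \<xi>) \<le> C * (1 + norm \<xi>) ^ N"
    using m by (auto simp: tempered_def)
  have C0: "0 \<le> C" using order_trans[OF norm_ge_zero m_le[of 0]] by simp
  have cont: "continuous_on UNIV (\<lambda>\<xi>. m \<xi> * FT \<phi> \<xi>)"
    by (intro continuous_intros mc FT_continuous test_fun_integrable[OF \<phi>])
  obtain C1 where C1: "\<And>\<xi>. (1 + norm \<xi>) ^ N * cmod (FT \<phi> \<xi>) \<le> C1"
    using FT_test_fun_decay[OF \<phi>] by blast
  \<comment> \<open>The additional powers, twice the dimension, pay for integrability after the
    growth of \<open>m\<close> has been absorbed.\<close>
  obtain C2 where C2: "\<And>\<xi>. (1 + norm \<xi>) ^ (N + 2 * CARD('n)) * cmod (FT \<phi> \<xi>) \<le> C2"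
    using FT_test_fun_decay[OF \<phi>] by blast
  have le: "cmod (m \<xi> * FT \<phi> \<xi>) \<le> C * ((1 + norm \<xi>) ^ N * cmod (FT \<phi> \<xi>))" for \<xi>
    using mult_right_mono[OF m_le[of \<xi>], of "cmod (FT \<phi> \<xi>)"] by (simp add: norm_mult mult.assoc)
  have bd: "cmod (m \<xi> * FT \<phi> \<xi>) \<le> C * C1" for \<xi>
    using order_trans[OF le mult_left_mono[OF C1 C0]] .
  have "integrable lborel (\<lambda>\<xi>. m \<xi> * FT \<phi> \<xi>)"
  proof (rule Bochner_Integration.integrable_bound[OF integrable_mult_right[OF integrable_inverse_power[where 'n = 'n], of "C * C2"]])
    show "(\<lambda>\<xi>. m \<xi> * FT \<phi> \<xi>) \<in> borel_measurable lborel" by (rule borel_measurable_cont[OF cont])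
    have "cmod (m \<xi> * FT \<phi> \<xi>) \<le> C * C2 * inverse ((1 + norm \<xi>) ^ (2 * CARD('n)))" for \<xi>
    proof -
      have "0 < (1 + norm \<xi>) ^ (2 * CARD('n))" by (simp add: add_pos_nonneg)
      moreover have "(1 + norm \<xi>) ^ N * cmod (FT \<phi> \<xi>) * (1 + norm \<xi>) ^ (2 * CARD('n)) \<le> C2"
        using C2[of \<xi>] by (simp add: power_add mult_ac)
      ultimately have "(1 + norm \<xi>) ^ N * cmod (FT \<phi> \<xi>) \<le> C2 * inverse ((1 + norm \<xi>) ^ (2 * CARD('n)))"
        by (simp add: pos_le_divide_eq flip: divide_inverse)
      from order_trans[OF le mult_left_mono[OF this C0]] show ?thesis by (simp add: mult.assoc)
    qed
    then show "AE \<xi> in lborel. norm (m \<xi> * FT \<phi> \<xi>) \<le> norm (C * C2 * inverse ((1 + norm \<xi>) ^ (2 * CARD('n))))"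
      by (intro AE_I2) (auto intro: order_trans[OF _ abs_ge_self])
  qed
  then show ?thesis using cont bd unfolding nice_def by blast
qed

lemma nice_FT: "test_fun \<phi> \<Longrightarrow> nice (FT \<phi>)"
  using nice_tempered_FT[OF tempered_bounded[of "\<lambda>_. 1" 1]] by auto

lemma test_fun_IFT_FT: "test_fun \<phi> \<Longrightarrow> IFT (FT \<phi>) x = \<phi> x"
  using IFT_FT[OF nice_test_fun] nice_FT by (auto simp: nice_def)

section \<open>The Fourier transform on \<open>L\<^sup>2\<close> and Fourier multipliers\<close>

text \<open>\<open>U\<close> is the \<open>L\<^sup>2\<close> Fourier transform of \<open>u\<close>, expressed by Parseval's identity against nice functions,
  for which the integral \<open>IFT\<close> converges.\<close>

definition ftpair :: "(real^'n::finite \<Rightarrow> complex) \<Rightarrow> (real^'n \<Rightarrow> complex) \<Rightarrow> bool" where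
  "ftpair u U \<longleftrightarrow> l2 u \<and> l2 U \<and> (\<forall>a. nice a \<longrightarrow> l2inner (IFT a) u = l2inner a U)"

lemma ftpair_l2: "ftpair u U \<Longrightarrow> l2 u" "ftpair u U \<Longrightarrow> l2 U"
  by (auto simp: ftpair_def)

lemma ftpair_inner: "ftpair u U \<Longrightarrow> nice a \<Longrightarrow> l2inner (IFT a) u = l2inner a U"
  by (auto simp: ftpair_def)

lemma l2norm_IFT: "nice a \<Longrightarrow> l2norm (IFT a) = l2norm a"
proof -
  assume a: "nice a"
  have "complex_of_real ((l2norm (IFT a))\<^sup>2) = complex_of_real ((l2norm a)\<^sup>2)"
    using IFT_isometry[OF a a] by (simp add: l2inner_self nice_l2[OF a] flip: of_real_power)
  then have "(l2norm (IFT a))\<^sup>2 = (l2norm a)\<^sup>2" by (simp only: of_real_eq_iff)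
  then show ?thesis by simp
qed

lemma ftpair_IFT: "nice a \<Longrightarrow> ftpair (IFT a) a"
  by (auto simp: ftpair_def IFT_isometry nice_l2)

lemma ftpair_diff: "ftpair u U \<Longrightarrow> ftpair v V \<Longrightarrow> ftpair (\<lambda>x. u x - v x) (\<lambda>x. U x - V x)"
  unfolding ftpair_def by (auto simp: l2_diff l2inner_diff_right IFT_isometry nice_l2)

lemma nice_diff:
  assumes "nice a" "nice b"
  shows "nice (\<lambda>x. a x - b x)"
proof -
  obtain A B where "\<And>x. cmod (a x) \<le> A" "\<And>x. cmod (b x) \<le> B"
    using assms by (auto simp: nice_def)
  then have "cmod (a x - b x) \<le> A + B" for x
    using norm_triangle_ineq4[of "a x" "b x"] add_mono order_trans by blast
  then show ?thesis
    using assms by (auto simp: nice_def intro!: continuous_on_diff)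
qed

lemma IFT_diff: "integrable lborel a \<Longrightarrow> integrable lborel b \<Longrightarrow> IFT (\<lambda>x. a x - b x) x = IFT a x - IFT b x"
  by (simp add: IFT_eq right_diff_distrib integrable_cis_mult)

lemma nice_reflect:
  assumes b: "nice b"
  shows "nice (\<lambda>x. b (- x))"
  unfolding nice_def
proof (intro conjI)
  have "continuous_on UNIV b" using b by (simp add: nice_def)
  then show "continuous_on UNIV (\<lambda>x. b (- x))"
    by (rule continuous_on_compose2) (auto intro: continuous_on_minus continuous_on_id)
  show "\<exists>B. \<forall>x. cmod (b (- x)) \<le> B" using b unfolding nice_def by blast
  show "integrable lborel (\<lambda>x. b (- x))"
    using b integrable_lborel_affine[of b "-1" 0] by (simp add: nice_def)
qed

lemma l2norm_reflect:
  fixes b :: "real^'n::finite \<Rightarrow> complex"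
  assumes [measurable]: "b \<in> borel_measurable borel"
  shows "l2norm (\<lambda>x. b (- x)) = l2norm b"
proof -
  have "(\<integral>x. (cmod (b (- x)))\<^sup>2 \<partial>lborel) = \<bar>- 1\<bar>^DIM(real^'n) *\<^sub>R (\<integral>x. (cmod (b (- (0 + (- 1) *\<^sub>R x))))\<^sup>2 \<partial>lborel)"
    by (rule integral_lborel_affine) auto
  then show ?thesis by (simp add: l2norm_def)
qed

lemma nice_measurable: "nice b \<Longrightarrow> b \<in> borel_measurable borel"
  using nice_l2 l2_measurable by fastforce

lemma FT_eq_IFT_reflect: "nice b \<Longrightarrow> FT b = IFT (\<lambda>x. b (- x))"
  by (rule ext) (simp add: FT_eq_IFT IFT_reflect nice_measurable)

lemma nice_integrable: "nice a \<Longrightarrow> integrable lborel a"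
  by (simp add: nice_def)

lemma ftpair_FT:
  assumes u: "nice u"
  shows "ftpair u (FT u)" "l2norm (FT u) = l2norm u"
proof -
  have l: "l2 (FT u)"
    unfolding FT_eq_IFT_reflect[OF u] by (rule IFT_isometry(1)[OF nice_reflect[OF u] nice_reflect[OF u]])
  show "ftpair u (FT u)"
    unfolding ftpair_def l2inner_def using l nice_l2[OF u] cnj_IFT_mult nice_integrable u by blast
  show "l2norm (FT u) = l2norm u"
    unfolding FT_eq_IFT_reflect[OF u]
    by (simp add: l2norm_IFT nice_reflect u l2norm_reflect nice_measurable)
qed

lemma ftpair_limit:
  assumes p: "\<And>n. ftpair (u n) (U n)" and u: "l2 u0" "(\<lambda>n. l2norm (\<lambda>x. u n x - u0 x)) \<longlonglongrightarrow> 0"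
    and U: "l2 U0" "(\<lambda>n. l2norm (\<lambda>x. U n x - U0 x)) \<longlonglongrightarrow> 0"
  shows "ftpair u0 U0"
  unfolding ftpair_def
proof (intro conjI allI impI u U)
  fix a :: "real^'a \<Rightarrow> complex" assume a: "nice a"
  have "(\<lambda>n. l2inner (IFT a) (u n)) \<longlonglongrightarrow> l2inner (IFT a) u0"
    using p u IFT_isometry(1)[OF a a] by (intro l2inner_tendsto_right) (auto dest: ftpair_l2)
  moreover have "(\<lambda>n. l2inner a (U n)) \<longlonglongrightarrow> l2inner a U0"
    using p U nice_l2[OF a] by (intro l2inner_tendsto_right) (auto dest: ftpair_l2)
  ultimately show "l2inner (IFT a) u0 = l2inner a U0"
    unfolding ftpair_inner[OF p a] by (rule LIMSEQ_unique)
qed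

lemma l2_Cauchy_if_tendsto:
  assumes "\<And>n. l2 (u n)" "l2 v" "(\<lambda>n. l2norm (\<lambda>x. u n x - v x)) \<longlonglongrightarrow> 0" "e > 0"
  shows "\<exists>N. \<forall>m\<ge>N. \<forall>n\<ge>N. l2norm (\<lambda>x. u m x - u n x) < e"
proof -
  obtain N where N: "\<And>n. n \<ge> N \<Longrightarrow> l2norm (\<lambda>x. u n x - v x) < e / 2"
    using LIMSEQ_D[OF assms(3), of "e / 2"] assms(4) by auto
  have "l2norm (\<lambda>x. u m x - u n x) < e" if "m \<ge> N" "n \<ge> N" for m n
    using l2norm_diff_triangle[OF assms(1)[of m] assms(2) assms(1)[of n]] N[OF that(1)] N[OF that(2)]
    by (simp add: l2norm_minus_commute[of v])
  then show ?thesis by blast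
qed

text \<open>The isometry turns an approximation of \<open>U\<close> by test functions into a Cauchy
  sequence of inverse transforms; completeness supplies the partner.\<close>

lemma ftpair_inverse_exists:
  assumes U: "l2 U"
  obtains u where "ftpair u U" "l2norm u = l2norm U"
proof -
  obtain a where a: "\<And>n. test_fun (a n)" "(\<lambda>n. l2norm (\<lambda>x. a n x - U x)) \<longlonglongrightarrow> 0"
    using l2_test_fun_seq[OF U] by blast
  have na: "nice (a n)" for n using a(1) by (rule nice_test_fun)
  have l: "l2 (IFT (a n))" for n by (rule IFT_isometry(1)[OF na na])
  have "\<exists>N. \<forall>m\<ge>N. \<forall>n\<ge>N. l2norm (\<lambda>x. IFT (a m) x - IFT (a n) x) < e" if "e > 0" for e
  proof -
    have "l2norm (\<lambda>x. IFT (a m) x - IFT (a n) x) = l2norm (\<lambda>x. a m x - a n x)" for m n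
    proof -
      have "IFT (\<lambda>x. a m x - a n x) = (\<lambda>x. IFT (a m) x - IFT (a n) x)"
        by (rule ext) (rule IFT_diff[OF nice_integrable[OF na] nice_integrable[OF na]])
      then show ?thesis using l2norm_IFT[OF nice_diff[OF na na], of m n] by simp
    qed
    then show ?thesis
      using l2_Cauchy_if_tendsto[OF nice_l2[OF na] U a(2) that] by simp
  qed
  then obtain u where u: "l2 u" "(\<lambda>n. l2norm (\<lambda>x. IFT (a n) x - u x)) \<longlonglongrightarrow> 0"
    using l2_complete[of "\<lambda>n. IFT (a n)"] l by blast
  have "ftpair u U"
    by (rule ftpair_limit[OF ftpair_IFT[OF na] u U a(2)])
  moreover have "l2norm u = l2norm U"
    using LIMSEQ_unique[OF l2norm_tendsto[OF l u]] l2norm_tendsto[OF nice_l2[OF na] U a(2)]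
    by (simp add: l2norm_IFT na)
  ultimately show thesis by (rule that)
qed

lemma FT_diff: "integrable lborel a \<Longrightarrow> integrable lborel b \<Longrightarrow> FT (\<lambda>x. a x - b x) x = FT a x - FT b x"
  by (simp add: FT_eq_IFT IFT_diff)

lemma ftpair_exists:
  assumes u: "l2 u"
  obtains U where "ftpair u U" "l2norm U = l2norm u"
proof -
  obtain a where a: "\<And>n. test_fun (a n)" "(\<lambda>n. l2norm (\<lambda>x. a n x - u x)) \<longlonglongrightarrow> 0"
    using l2_test_fun_seq[OF u] by blast
  have na: "nice (a n)" for n using a(1) by (rule nice_test_fun)
  have l: "l2 (FT (a n))" for n using ftpair_l2(2)[OF ftpair_FT(1)[OF na]] .
  have "\<exists>N. \<forall>m\<ge>N. \<forall>n\<ge>N. l2norm (\<lambda>x. FT (a m) x - FT (a n) x) < e" if "e > 0" for e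
  proof -
    have "l2norm (\<lambda>x. FT (a m) x - FT (a n) x) = l2norm (\<lambda>x. a m x - a n x)" for m n
    proof -
      have "FT (\<lambda>x. a m x - a n x) = (\<lambda>x. FT (a m) x - FT (a n) x)"
        by (rule ext) (rule FT_diff[OF nice_integrable[OF na] nice_integrable[OF na]])
      then show ?thesis using ftpair_FT(2)[OF nice_diff[OF na na], of m n] by simp
    qed
    then show ?thesis
      using l2_Cauchy_if_tendsto[OF nice_l2[OF na] u a(2) that] by simp
  qed
  then obtain U where U: "l2 U" "(\<lambda>n. l2norm (\<lambda>x. FT (a n) x - U x)) \<longlonglongrightarrow> 0"
    using l2_complete[of "\<lambda>n. FT (a n)"] l by blast
  have "ftpair u U"
    by (rule ftpair_limit[OF ftpair_FT(1)[OF na] u a(2) U])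
  moreover have "l2norm U = l2norm u"
    using LIMSEQ_unique[OF l2norm_tendsto[OF l U]] l2norm_tendsto[OF nice_l2[OF na] u a(2)]
    by (simp add: ftpair_FT(2) na)
  ultimately show thesis by (rule that)
qed

text \<open>Test functions are nice, so the defining pairings determine \<open>U\<close> against a
  dense set.\<close>

lemma ftpair_unique:
  assumes "ftpair u U" "ftpair u U'"
  shows "AE x in lborel. U x = U' x"
proof -
  have "AE x in lborel. U x - U' x = 0"
  proof (rule l2_orth_test_fun)
    show "l2 (\<lambda>x. U x - U' x)" using assms by (intro l2_diff) (auto dest: ftpair_l2)
    show "l2inner \<phi> (\<lambda>x. U x - U' x) = 0" if "test_fun \<phi>" for \<phi>
      using assms ftpair_inner[OF assms(1) nice_test_fun[OF that]] ftpair_inner[OF assms(2) nice_test_fun[OF that]]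
      by (simp add: l2inner_diff_right test_fun_l2 that ftpair_l2)
  qed
  then show ?thesis by simp
qed

text \<open>Plancherel for arbitrary pairs: existence provides a partner with the right norm, and
  uniqueness leaves no other up to null sets.\<close>

lemma ftpair_norm:
  assumes "ftpair u U"
  shows "l2norm u = l2norm U"
proof -
  obtain U' where U': "ftpair u U'" "l2norm U' = l2norm u"
    using ftpair_exists[OF ftpair_l2(1)[OF assms]] by blast
  have "l2norm U = l2norm U'"
    by (rule l2norm_cong_AE[OF _ _ ftpair_unique[OF assms U'(1)]])
       (use assms U' in \<open>auto dest: ftpair_l2 l2_measurable\<close>)
  then show ?thesis using U'(2) by simp
qed

lemma ftpair_cong_AE:
  assumes p: "ftpair u U" and V: "V \<in> borel_measurable lborel" "AE x in lborel. U x = V x"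
  shows "ftpair u V"
proof -
  have lU: "l2 U" by (rule ftpair_l2[OF p])
  have lV: "l2 V"
    by (rule l2_dominated[OF lU V(1), of 1]) (use V(2) in \<open>auto elim!: eventually_mono\<close>)
  have "l2inner a U = l2inner a V" if "nice a" for a
    unfolding l2inner_def
  proof (rule integral_cong_AE)
    note [measurable] = l2_borel_measurable[OF nice_l2[OF that]] l2_borel_measurable[OF lU] l2_borel_measurable[OF lV]
    show "(\<lambda>x. cnj (a x) * U x) \<in> borel_measurable lborel" "(\<lambda>x. cnj (a x) * V x) \<in> borel_measurable lborel"
      by measurable
    show "AE x in lborel. cnj (a x) * U x = cnj (a x) * V x"
      using V(2) by (auto elim!: eventually_mono)
  qed
  then show ?thesis using p lV by (auto simp: ftpair_def)
qed

section \<open>Weak multipliers as multiplication operators\<close>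

lemma l2inner_test_fun_ftpair:
  assumes "ftpair u U" "test_fun \<phi>"
  shows "l2inner \<phi> u = l2inner (FT \<phi>) U"
  using ftpair_inner[OF assms(1) nice_FT[OF assms(2)]] test_fun_IFT_FT[OF assms(2)]
  by (simp add: l2inner_def)

text \<open>Parseval moves both pairings to the frequency side. The conjugate of \<open>m\<close>
  stems from the adjoint multiplier that acts on the test function.\<close>

lemma weak_mult_iff_inner:
  fixes m :: "real^'n::finite \<Rightarrow> complex"
  assumes m: "tempered m" and u: "ftpair u U" and v: "ftpair v V"
  shows "weak_mult m u v \<longleftrightarrow> (\<forall>\<phi>. test_fun \<phi> \<longrightarrow> l2inner (FT \<phi>) V = l2inner (\<lambda>\<xi>. cnj (m \<xi>) * FT \<phi> \<xi>) U)"
proof -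
  have "(\<integral>x. cnj (\<phi> x) * v x \<partial>lborel) = l2inner (FT \<phi>) V"
    "(\<integral>x. cnj (mult_test (\<lambda>\<xi>. cnj (m \<xi>)) \<phi> x) * u x \<partial>lborel) = l2inner (\<lambda>\<xi>. cnj (m \<xi>) * FT \<phi> \<xi>) U"
    if "test_fun \<phi>" for \<phi>
    using l2inner_test_fun_ftpair[OF v that] ftpair_inner[OF u nice_tempered_FT[OF tempered_cnj[OF m] that]]
    by (auto simp: l2inner_def mult_test_def)
  then show ?thesis by (auto simp: weak_mult_def)
qed

text \<open>On a box small compared with 1 / |\<xi>| the phase stays below 1, so its cosine is
  positive and the real part of the transform integrates a positive function over a set of positive
  measure. The boxes are indexed by naturals to keep later exceptional sets countable in
  number.\<close>

lemma FT_box_bump_nonzero: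
  fixes \<xi> :: "real^'n::finite"
  shows "\<exists>j. FT (box_bump 1 (\<chi> i. - (1 / real (Suc j))) (\<chi> i. 1 / real (Suc j))) \<xi> \<noteq> 0"
proof -
  define S where "S = (\<Sum>i\<in>UNIV. \<bar>\<xi> $ i\<bar>)"
  \<comment> \<open>This choice bounds the phase on the box by S / (j + 1), hence strictly by
    1.\<close>
  obtain j :: nat where j: "S < real j" using reals_Archimedean2 by blast
  define a c :: "real^'n" where "a = (\<chi> i. - (1 / real (Suc j)))" and "c = (\<chi> i. 1 / real (Suc j))"
  define f where "f x = Re (box_bump 1 a c x)" for x
  have fe: "box_bump 1 a c x = of_real (f x)" and f0: "0 \<le> f x" for x
    unfolding f_def by (rule box_bump_real)+
  have tf: "test_fun (box_bump 1 a c)" by (rule test_fun_box_bump) simp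
  have ii: "integrable lborel (\<lambda>x. cis (- (x \<bullet> \<xi>)) * box_bump 1 a c x)"
    using integrable_cis_mult[OF test_fun_integrable[OF tf], of "- \<xi>"] by (simp add: inner_commute)
  have Re: "Re (\<integral>x. cis (- (x \<bullet> \<xi>)) * box_bump 1 a c x \<partial>lborel) = (\<integral>x. cos (x \<bullet> \<xi>) * f x \<partial>lborel)"
    using ii by (subst integral_Re[symmetric]) (auto simp: fe)
  have ic: "integrable lborel (\<lambda>x. cos (x \<bullet> \<xi>) * f x)"
    using integrable_Re[OF ii] by (simp add: fe)
  have supp: "f x \<noteq> 0 \<longleftrightarrow> x \<in> box a c" for x
    using box_bump_nonzero_iff[of 1 a c x] fe[of x] by simp
  have cospos: "0 < cos (x \<bullet> \<xi>)" if "x \<in> box a c" for x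
  proof -
    have xi: "\<bar>x $ i\<bar> \<le> 1 / real (Suc j)" for i
    proof -
      have "- (1 / real (Suc j)) < x $ i" "x $ i < 1 / real (Suc j)"
        using that by (simp_all add: mem_box_cart a_def c_def)
      then show ?thesis by linarith
    qed
    have "\<bar>x \<bullet> \<xi>\<bar> \<le> (\<Sum>i\<in>UNIV. \<bar>x $ i * \<xi> $ i\<bar>)"
      unfolding inner_vec_def by (simp add: sum_abs)
    also have "\<dots> \<le> (\<Sum>i\<in>UNIV. (1 / real (Suc j)) * \<bar>\<xi> $ i\<bar>)"
      unfolding abs_mult by (intro sum_mono mult_right_mono xi) auto
    also have "\<dots> = S / real (Suc j)" by (simp add: S_def sum_divide_distrib)
    also have "\<dots> < 1" using j by simp
    finally have "\<bar>x \<bullet> \<xi>\<bar> < 1" .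
    then show ?thesis
      using pi_gt3 by (intro cos_gt_zero_pi) auto
  qed
  have nn: "0 \<le> cos (x \<bullet> \<xi>) * f x" for x
    using cospos[of x] supp[of x] f0[of x] by (cases "x \<in> box a c") auto
  have "(\<integral>x. cos (x \<bullet> \<xi>) * f x \<partial>lborel) \<noteq> 0"
  proof
    assume "(\<integral>x. cos (x \<bullet> \<xi>) * f x \<partial>lborel) = 0"
    then have "AE x in lborel. cos (x \<bullet> \<xi>) * f x = 0"
      using ic nn by (subst (asm) integral_nonneg_eq_0_iff_AE) auto
    then have "AE x in lborel. x \<notin> box a c"
      by (rule eventually_mono) (use cospos supp in fastforce)
    then have "emeasure lborel (box a c) = 0"
      by (subst (asm) AE_iff_measurable[OF _ refl]) auto
    moreover have "emeasure lborel (box a c) \<noteq> 0"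
    proof -
      have pos: "0 < (c - a) \<bullet> b" if b: "b \<in> Basis" for b
      proof -
        obtain i where "b = axis i 1" using b by (auto simp: Basis_vec_def)
        then show ?thesis by (simp add: inner_axis a_def c_def add_pos_pos)
      qed
      have "emeasure lborel (box a c) = ennreal (\<Prod>b\<in>Basis. (c - a) \<bullet> b)"
        by (rule emeasure_lborel_box) (use pos in \<open>force simp: inner_diff_left\<close>)
      moreover have "0 < (\<Prod>b\<in>Basis. (c - a) \<bullet> b)" by (rule prod_pos[OF pos])
      ultimately show ?thesis by (simp only: ennreal_eq_0_iff not_le simp_thms)
    qed
    ultimately show False by simp
  qed
  then have "FT (box_bump 1 a c) \<xi> \<noteq> 0"
    using Re fourier_const_pos[where 'n = 'n] by (auto simp: FT_eq)
  then show ?thesis unfolding a_def c_def by blast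
qed

lemma l2_bounded_mult:
  assumes "l2 U" "b \<in> borel_measurable lborel" "\<And>x. cmod (b x) \<le> B"
  shows "l2 (\<lambda>x. b x * U x)"
proof (rule l2_dominated[OF assms(1), where c = B])
  show "(\<lambda>x. b x * U x) \<in> borel_measurable lborel"
    using assms(2) l2_borel_measurable[OF assms(1)] by simp
  show "AE x in lborel. cmod (b x * U x) \<le> B * cmod (U x)"
    using assms(3) by (intro AE_I2) (simp add: norm_mult mult_right_mono)
qed

text \<open>Modulating the test function by a translation shows that \<open>cnj (FT \<phi>) * (V - m U)\<close> has vanishing
  Fourier transform; varying \<open>\<phi>\<close> among bumps of small support then gives \<open>V = m U\<close>.\<close>

lemma weak_mult_AE:
  fixes m :: "real^'n::finite \<Rightarrow> complex"
  assumes m: "tempered m" and u: "ftpair u U" and v: "ftpair v V" and w: "weak_mult m u v"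
  shows "AE \<xi> in lborel. V \<xi> = m \<xi> * U \<xi>"
proof -
  have lU: "l2 U" and lV: "l2 V" using u v ftpair_l2 by auto
  have mm: "m \<in> borel_measurable lborel" using m borel_measurable_cont by (auto simp: tempered_def)
  note [measurable] = l2_borel_measurable[OF lU] l2_borel_measurable[OF lV] mm[simplified]
  have eq: "l2inner (FT \<phi>) V = l2inner (\<lambda>\<xi>. cnj (m \<xi>) * FT \<phi> \<xi>) U" if "test_fun \<phi>" for \<phi>
    using w that weak_mult_iff_inner[OF m u v] by blast
  have zero: "AE \<xi> in lborel. FT (box_bump 1 a c) \<xi> = 0 \<or> V \<xi> = m \<xi> * U \<xi>" for a c :: "real^'n"
  proof -
    define \<phi> where "\<phi> = box_bump 1 a c"
    have tf: "test_fun \<phi>" unfolding \<phi>_def by (rule test_fun_box_bump) simp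
    have \<phi>m: "\<phi> \<in> borel_measurable borel" using nice_measurable[OF nice_test_fun[OF tf]] .
    define k where "k \<xi> = cnj (FT \<phi> \<xi>) * V \<xi> - cnj (cnj (m \<xi>) * FT \<phi> \<xi>) * U \<xi>" for \<xi>
    have n1: "nice (FT \<phi>)" by (rule nice_FT[OF tf])
    have n2: "nice (\<lambda>\<xi>. cnj (m \<xi>) * FT \<phi> \<xi>)" by (rule nice_tempered_FT[OF tempered_cnj[OF m] tf])
    note [measurable] = nice_measurable[OF n1] nice_measurable[OF n2]
    have i1: "integrable lborel (\<lambda>\<xi>. cnj (FT \<phi> \<xi>) * V \<xi>)"
      by (rule l2_inner_integrable[OF nice_l2[OF n1] lV])
    have i2: "integrable lborel (\<lambda>\<xi>. cnj (cnj (m \<xi>) * FT \<phi> \<xi>) * U \<xi>)"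
      by (rule l2_inner_integrable[OF nice_l2[OF n2] lU])
    have ki: "integrable lborel k" unfolding k_def by (intro Bochner_Integration.integrable_diff i1 i2)
    obtain B1 B2 where B: "\<And>\<xi>. cmod (cnj (FT \<phi> \<xi>)) \<le> B1" "\<And>\<xi>. cmod (cnj (cnj (m \<xi>) * FT \<phi> \<xi>)) \<le> B2"
      using n1 n2 unfolding nice_def by (auto simp: norm_mult)
    have kl2: "l2 k"
      unfolding k_def
      by (intro l2_diff l2_bounded_mult[OF lV _ B(1)] l2_bounded_mult[OF lU _ B(2)]) measurable
    have FTk: "FT k y = 0" for y
    proof -
      define \<phi>y where "\<phi>y x = \<phi> (x + y)" for x
      have ty: "test_fun \<phi>y"
        unfolding \<phi>y_def \<phi>_def box_bump_shift by (rule test_fun_box_bump) simp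
      have Fy: "FT \<phi>y \<xi> = cis (y \<bullet> \<xi>) * FT \<phi> \<xi>" for \<xi>
        unfolding \<phi>y_def by (rule FT_shift[OF \<phi>m])
      have c: "cnj (cis (y \<bullet> \<xi>)) = cis (- (\<xi> \<bullet> y))" for \<xi> by (simp add: cis_cnj inner_commute)
      have "(\<integral>\<xi>. cis (- (\<xi> \<bullet> y)) * k \<xi> \<partial>lborel) = (\<integral>\<xi>. cnj (FT \<phi>y \<xi>) * V \<xi> - cnj (cnj (m \<xi>) * FT \<phi>y \<xi>) * U \<xi> \<partial>lborel)"
        by (simp add: k_def Fy c right_diff_distrib mult_ac)
      also have "\<dots> = l2inner (FT \<phi>y) V - l2inner (\<lambda>\<xi>. cnj (m \<xi>) * FT \<phi>y \<xi>) U"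
        unfolding l2inner_def
        by (intro Bochner_Integration.integral_diff l2_inner_integrable lU lV nice_l2 nice_FT nice_tempered_FT tempered_cnj m ty)
      also have "\<dots> = 0" using eq[OF ty] by simp
      finally show ?thesis by (simp add: FT_eq)
    qed
    have "AE \<xi> in lborel. k \<xi> = 0"
    proof (rule l2_orth_test_fun[OF kl2])
      fix \<eta> :: "real^'n \<Rightarrow> complex" assume \<eta>: "test_fun \<eta>"
      have "l2inner \<eta> k = (\<integral>x. cnj (IFT (FT \<eta>) x) * k x \<partial>lborel)"
        by (simp add: l2inner_def test_fun_IFT_FT[OF \<eta>])
      also have "\<dots> = (\<integral>\<xi>. cnj (FT \<eta> \<xi>) * FT k \<xi> \<partial>lborel)"
        by (rule cnj_IFT_mult[OF nice_integrable[OF nice_FT[OF \<eta>]] ki])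
      finally show "l2inner \<eta> k = 0" by (simp add: FTk)
    qed
    then show ?thesis
    proof eventually_elim
      case (elim \<xi>)
      then have "cnj (FT \<phi> \<xi>) * (V \<xi> - m \<xi> * U \<xi>) = 0"
        by (simp add: k_def algebra_simps)
      then show ?case by (auto simp: \<phi>_def)
    qed
  qed
  \<comment> \<open>Countably many bumps cover all frequencies, so their exceptional sets still form
    a null set.\<close>
  have "AE \<xi> in lborel. \<forall>j. FT (box_bump 1 (\<chi> i. - (1 / real (Suc j))) (\<chi> i. 1 / real (Suc j))) \<xi> = 0 \<or> V \<xi> = m \<xi> * U \<xi>"
    unfolding AE_all_countable using zero by blast
  then show ?thesis
    by (rule eventually_mono) (use FT_box_bump_nonzero in blast)
qed

lemma weak_mult_if_AE:
  fixes m :: "real^'n::finite \<Rightarrow> complex"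
  assumes m: "tempered m" and u: "ftpair u U" and v: "ftpair v (\<lambda>\<xi>. m \<xi> * U \<xi>)"
  shows "weak_mult m u v"
  unfolding weak_mult_iff_inner[OF m u v] l2inner_def by (simp add: mult_ac)

lemma in_Lp_2_iff: "in_Lp 2 u \<longleftrightarrow> l2 u" "in_Lp (ereal 2) u \<longleftrightarrow> l2 u"
  by (auto simp: in_Lp_def l2_def)

lemma lp_norm_2: "lp_norm 2 u = l2norm u" "lp_norm (ereal 2) u = l2norm u"
  by (simp_all add: lp_norm_def l2norm_def powr_half_sqrt)

text \<open>The inverse transform of m U shows that the choice in \<open>L2_mult\<close> is
  inhabited, and \<open>weak_mult_AE\<close> shows that whatever is chosen has this transform almost
  everywhere.\<close>

lemma L2_mult_ftpair:
  fixes m :: "real^'n::finite \<Rightarrow> complex"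
  assumes m: "continuous_on UNIV m" "\<And>\<xi>. cmod (m \<xi>) \<le> B" and u: "ftpair u U"
  shows "ftpair (L2_mult m u) (\<lambda>\<xi>. m \<xi> * U \<xi>)"
proof -
  have t: "tempered m" by (rule tempered_bounded[OF m])
  have mU: "l2 (\<lambda>\<xi>. m \<xi> * U \<xi>)"
    by (rule l2_bounded_mult[OF ftpair_l2(2)[OF u] borel_measurable_cont[OF m(1)] m(2)])
  obtain v where v: "ftpair v (\<lambda>\<xi>. m \<xi> * U \<xi>)"
    using ftpair_inverse_exists[OF mU] by blast
  have "in_Lp 2 v \<and> weak_mult m u v"
    using ftpair_l2(1)[OF v] weak_mult_if_AE[OF t u v] by (simp add: in_Lp_2_iff)
  then have *: "in_Lp 2 (L2_mult m u) \<and> weak_mult m u (L2_mult m u)"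
    unfolding L2_mult_def by (rule someI[where P = "\<lambda>v. in_Lp 2 v \<and> weak_mult m u v"])
  then obtain V where V: "ftpair (L2_mult m u) V"
    using ftpair_exists by (auto simp: in_Lp_2_iff)
  have "AE \<xi> in lborel. V \<xi> = m \<xi> * U \<xi>"
    using weak_mult_AE[OF t u V] * by blast
  then show ?thesis
    by (rule ftpair_cong_AE[OF V l2_measurable[OF mU]])
qed

lemma jbr_ge_1: "1 \<le> jbr x"
  by (simp add: jbr_def)

lemma jbr_le: "jbr x \<le> 1 + norm x"
  unfolding jbr_def by (rule real_le_lsqrt) (auto simp: power2_sum)

lemma jbr_continuous: "continuous_on UNIV jbr"
  unfolding jbr_def by (intro continuous_intros)

lemma tempered_bessel_sym: "tempered (bessel_sym s :: real^'n::finite \<Rightarrow> complex)"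
proof (rule temperedI)
  show "continuous_on UNIV (bessel_sym s :: real^'n \<Rightarrow> complex)"
  proof -
    have "jbr x \<noteq> 0" for x :: "real^'n" using jbr_ge_1[of x] by linarith
    then show ?thesis
      unfolding bessel_sym_def by (intro continuous_intros jbr_continuous) simp
  qed
  show "cmod (bessel_sym s \<xi>) \<le> 1 * (1 + norm \<xi>) ^ (nat \<lceil>\<bar>s\<bar>\<rceil>)" for \<xi> :: "real^'n"
  proof -
    have "jbr \<xi> powr s \<le> jbr \<xi> powr real (nat \<lceil>\<bar>s\<bar>\<rceil>)"
    proof (rule powr_mono)
      show "s \<le> real (nat \<lceil>\<bar>s\<bar>\<rceil>)" by linarith
    qed (rule jbr_ge_1)
    also have "\<dots> = jbr \<xi> ^ nat \<lceil>\<bar>s\<bar>\<rceil>"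
      using jbr_ge_1[of \<xi>] by (intro powr_realpow) linarith
    also have "\<dots> \<le> (1 + norm \<xi>) ^ nat \<lceil>\<bar>s\<bar>\<rceil>"
      using jbr_ge_1[of \<xi>] by (intro power_mono jbr_le) linarith
    finally show ?thesis by (simp add: bessel_sym_def)
  qed
qed

text \<open>\<open>weak_mult_AE\<close> identifies the transform of the chosen witness as the Bessel
  symbol times that of \<open>u\<close>, and for nonnegative \<open>s\<close> this symbol is at
  least 1.\<close>

lemma l2norm_le_Hsp_norm:
  assumes "in_Hsp s 2 u" "0 \<le> s"
  shows "l2 u" "l2norm u \<le> Hsp_norm s 2 u"
proof -
  show lu: "l2 u" using assms(1) unfolding in_Hsp_def in_Lp_2_iff(1) by (rule conjunct1)
  define g where "g = (SOME g. in_Lp 2 g \<and> weak_mult (bessel_sym s) u g)"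
  have "in_Lp 2 g \<and> weak_mult (bessel_sym s) u g"
    unfolding g_def by (rule someI_ex[where P = "\<lambda>g. in_Lp 2 g \<and> weak_mult (bessel_sym s) u g"]) (rule conjunct2[OF assms(1)[unfolded in_Hsp_def]])
  then have g: "l2 g" "weak_mult (bessel_sym s) u g" unfolding in_Lp_2_iff(1) by (rule conjunct1, rule conjunct2)
  obtain U where U: "ftpair u U" "l2norm U = l2norm u" using ftpair_exists[OF lu] by blast
  obtain G where G: "ftpair g G" "l2norm G = l2norm g" using ftpair_exists[OF g(1)] by blast
  have "AE \<xi> in lborel. G \<xi> = bessel_sym s \<xi> * U \<xi>"
    by (rule weak_mult_AE[OF tempered_bessel_sym U(1) G(1) g(2)])
  then have "AE \<xi> in lborel. cmod (U \<xi>) \<le> 1 * cmod (G \<xi>)"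
  proof eventually_elim
    case (elim \<xi>)
    have "1 \<le> jbr \<xi> powr s" by (rule ge_one_powr_ge_zero[OF jbr_ge_1 assms(2)])
    then have "1 * cmod (U \<xi>) \<le> jbr \<xi> powr s * cmod (U \<xi>)" by (intro mult_right_mono) auto
    then show ?case unfolding elim by (simp add: norm_mult bessel_sym_def)
  qed
  then have "l2norm U \<le> 1 * l2norm G"
    by (intro l2norm_mono_AE[OF ftpair_l2(2)[OF G(1)] l2_measurable[OF ftpair_l2(2)[OF U(1)]]]) auto
  then show "l2norm u \<le> Hsp_norm s 2 u"
    unfolding Hsp_norm_def g_def[symmetric] lp_norm_2(1) using U(2) G(2) by linarith
qed

section \<open>Decay of the nonlinearity\<close>

lemma young_decay_exponent:
  fixes a v M q r :: real
  assumes q: "1 \<le> q" and r: "1 \<le> r" and M: "0 < M" and a: "0 \<le> a" and v: "0 \<le> v" "v \<le> M"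
  defines "P \<equiv> 2 * r / (r - 1)"
  shows "a * v\<^sup>2 \<le> M powr (2 * min 1 (r / q)) * (a powr q + v\<^sup>2 + (if r = 1 then 0 else M powr (- P) * v powr P))"
proof (cases "v = 0")
  case True
  then show ?thesis by simp
next
  case False
  then have v0: "0 < v" using v by simp
  define T where "T = (if r = 1 then 0 else M powr (- P) * v powr P)"
  have T0: "0 \<le> T" by (simp add: T_def)
  have div_le: "x / c \<le> x" if "0 \<le> x" "1 < c" for x c :: real
    using mult_left_mono[of 1 c x] that by (simp add: divide_le_eq)
  have PI: "(v / M) powr P = M powr (- P) * v powr P"
    using v0 M by (simp add: powr_divide powr_minus_divide)
  consider "q = 1" | "1 < q" "q \<le> r" | "r < q" using q by linarith
  then show ?thesis
  proof cases
    case 1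
    have "a * v\<^sup>2 \<le> a * M\<^sup>2" using v a by (intro mult_left_mono power_mono) auto
    also have "\<dots> = M\<^sup>2 * a" by (rule mult.commute)
    also have "\<dots> \<le> M\<^sup>2 * (a powr q + v\<^sup>2 + T)" using T0 1 a by (intro mult_left_mono) auto
    also have "M\<^sup>2 = M powr (2 * min 1 (r / q))" using 1 r M by (simp add: min_def powr_numeral)
    finally show ?thesis by (simp only: T_def)
  next
    case 2
    define q' where "q' = q / (q - 1)"
    have q': "1 < q'" "1 / q + 1 / q' = 1" using 2 by (auto simp: q'_def field_simps)
    have r1: "1 < r" using 2 by simp
    have "a * (v / M)\<^sup>2 \<le> a powr q / q + ((v / M)\<^sup>2) powr q' / q'"
      using Youngs_inequality[OF 2(1) q'(1,2) a, of "(v / M)\<^sup>2"] by simp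
    also have "\<dots> \<le> a powr q + ((v / M)\<^sup>2) powr q'"
      using 2(1) q'(1) by (intro add_mono div_le) auto
    also have "((v / M)\<^sup>2) powr q' = (v / M) powr (2 * q')"
    proof -
      have "(v / M)\<^sup>2 = (v / M) powr 2" using v0 M by (simp add: powr_numeral)
      then show ?thesis by (simp only: powr_powr)
    qed
    also have "\<dots> \<le> (v / M) powr P"
    proof (rule powr_mono')
      have "r * (q - 1) \<le> q * (r - 1)" using 2 by (simp add: algebra_simps)
      then have "r / (r - 1) \<le> q / (q - 1)" using 2 r1 by (simp add: field_simps)
      then show "P \<le> 2 * q'" by (simp add: P_def q'_def)
    qed (use v v0 M in auto)
    also have "\<dots> = T" using r1 by (simp add: T_def PI)
    finally have "M\<^sup>2 * (a * (v / M)\<^sup>2) \<le> M\<^sup>2 * (a powr q + v\<^sup>2 + T)"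
      by (intro mult_left_mono) (auto intro: order_trans)
    moreover have "M\<^sup>2 * (a * (v / M)\<^sup>2) = a * v\<^sup>2" using M by (simp add: power_divide)
    moreover have "M\<^sup>2 = M powr (2 * min 1 (r / q))" using 2 M by (simp add: min_def powr_numeral)
    ultimately show ?thesis by (simp only: T_def)
  next
    case 3
    define q' where "q' = q / (q - 1)"
    have q1: "1 < q" using 3 r by simp
    have q': "1 < q'" "1 / q + 1 / q' = 1" using q1 by (auto simp: q'_def field_simps)
    \<comment> \<open>With this exponent the conjugate power of \<open>w\<close> equals v^2 times a
      power of v / M^r, which singles out M^r as a threshold.\<close>
    define e where "e = 2 * r / q"
    define w where "w = v\<^sup>2 * M powr (- e)"
    have w0: "0 \<le> w" by (simp add: w_def)
    have "a * w \<le> a powr q / q + w powr q' / q'"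
      using Youngs_inequality[OF q1 q'(1,2) a w0] by simp
    also have "\<dots> \<le> a powr q + w powr q'"
      using q1 q'(1) by (intro add_mono div_le) auto
    also have "w powr q' \<le> v\<^sup>2 + T"
    proof -
      have v2: "v\<^sup>2 = v powr 2" using v0 by (simp add: powr_numeral)
      have eq': "e * q' = r * (2 * (q' - 1))"
        using q1 by (simp add: e_def q'_def field_simps)
      have "w powr q' = v powr (2 * q') * M powr (- (e * q'))"
        unfolding w_def v2 by (simp only: powr_mult powr_ge_zero powr_powr mult_minus_left)
      also have "v powr (2 * q') = v\<^sup>2 * v powr (2 * (q' - 1))"
        unfolding v2 powr_add[symmetric] by (simp add: algebra_simps)
      also have "M powr (- (e * q')) = (M powr (- r)) powr (2 * (q' - 1))"
        by (simp add: powr_powr eq')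
      finally have w_eq: "w powr q' = v\<^sup>2 * (v * M powr (- r)) powr (2 * (q' - 1))"
        using v0 M by (simp add: powr_mult)
      show ?thesis
      \<comment> \<open>Below the threshold the mass term v^2 suffices. Above it the exponent may be
        raised to P - 2, and r (P - 2) = P turns the result into \<open>T\<close>; for r = 1 this
        case cannot occur.\<close>
      proof (cases "v * M powr (- r) \<le> 1")
        case True
        then have "(v * M powr (- r)) powr (2 * (q' - 1)) \<le> 1"
          using v0 q'(1) by (intro powr_le1) auto
        then have "w powr q' \<le> v\<^sup>2 * 1" unfolding w_eq by (intro mult_left_mono) auto
        then show ?thesis using T0 by simp
      next
        case False
        have r1: "r \<noteq> 1"
        proof
          assume "r = 1"
          then have "v * M powr (- r) = v / M" using M by (simp add: powr_minus divide_inverse)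
          then show False using False v M by simp
        qed
        then have r1: "1 < r" using r by simp
        have "2 * (q' - 1) \<le> P - 2"
        proof -
          have "q' - 1 = 1 / (q - 1)" using q1 by (simp add: q'_def field_simps)
          also have "\<dots> \<le> 1 / (r - 1)" using r1 3 by (intro divide_left_mono) auto
          also have "P - 2 = 2 * (1 / (r - 1))" using r1 by (simp add: P_def field_simps)
          ultimately show ?thesis by simp
        qed
        then have "(v * M powr (- r)) powr (2 * (q' - 1)) \<le> (v * M powr (- r)) powr (P - 2)"
          using False by (intro powr_mono) auto
        then have "w powr q' \<le> v\<^sup>2 * (v * M powr (- r)) powr (P - 2)"
          unfolding w_eq by (intro mult_left_mono) auto
        also have "\<dots> = (v\<^sup>2 * v powr (P - 2)) * M powr (- (r * (P - 2)))"
          using v0 M by (simp add: powr_mult powr_powr)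
        also have "v\<^sup>2 * v powr (P - 2) = v powr P"
          unfolding v2 powr_add[symmetric] by simp
        also have "r * (P - 2) = P" using r1 by (simp add: P_def field_simps)
        also have "v powr P * M powr (- P) = T" using r1 by (simp add: T_def)
        finally show ?thesis using zero_le_power2[of v] by linarith
      qed
    qed
    finally have "M powr e * (a * w) \<le> M powr e * (a powr q + v\<^sup>2 + T)"
      by (intro mult_left_mono) (auto simp: add.assoc)
    moreover have "M powr e * (a * w) = a * v\<^sup>2"
      using M by (simp add: w_def powr_minus)
    moreover have "e = 2 * min 1 (r / q)" using 3 q1 r by (simp add: e_def min_def)
    ultimately show ?thesis by (simp only: T_def)
  qed
qed

section \<open>Bounds for the convolution potential\<close>

lemma AE_lborel_minus:
  fixes x :: "'a::euclidean_space"
  assumes "AE z in lborel. Q z"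
  shows "AE y in lborel. Q (x - y)"
proof -
  obtain N where N: "\<And>z. z \<in> space lborel - N \<Longrightarrow> Q z" "N \<in> null_sets lborel"
    using AE_E3[OF assms] that by metis
  have [measurable]: "N \<in> sets borel" using N(2) by auto
  have V: "(\<lambda>y. x - y) -` N \<in> sets borel"
    by (rule measurable_sets_borel[of _ borel]) auto
  have "emeasure lborel ((\<lambda>y. x - y) -` N) = (\<integral>\<^sup>+y. indicator N (x + (- 1) *\<^sub>R y) \<partial>lborel)"
  proof -
    have "indicator N (x + (- 1) *\<^sub>R y) = (indicator ((\<lambda>y. x - y) -` N) y :: ennreal)" for y
      by (simp add: indicator_def)
    then show ?thesis using nn_integral_indicator[OF V[folded sets_lborel]] by (simp only:)
  qed
  also have "\<dots> = (\<integral>\<^sup>+y. indicator N y \<partial>lborel)"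
    by (rule nn_integral_lborel_shift) auto
  also have "\<dots> = 0" using N(2) by (simp add: null_setsD1)
  finally have "(\<lambda>y. x - y) -` N \<in> null_sets lborel"
    using V by (intro null_setsI) auto
  then show ?thesis by (rule AE_I') (use N(1) in auto)
qed

text \<open>The measure may be singular, so for a single x the exceptional set need not be null for
  it. Exchanging the quantifiers helps: for each fixed y the bad x form a translate of a Lebesgue
  null set.\<close>

lemma AE_minus_finite_measure:
  fixes \<mu> :: "(real^'n::finite) measure"
  assumes \<mu>: "finite_measure \<mu>" "sets \<mu> = sets borel" and u [measurable]: "u \<in> borel_measurable borel"
    and bd: "AE z in lborel. u z \<le> (M::real)"
  shows "AE x in lborel. AE y in \<mu>. u (x - y) \<le> M"
proof -
  interpret finite_measure \<mu> by fact
  interpret pair_sigma_finite "lborel :: (real^'n) measure" \<mu> ..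
  have [measurable_cong]: "sets \<mu> = sets borel" by fact
  have "(AE x in lborel. AE y in \<mu>. u (x - y) \<le> M) \<longleftrightarrow> (AE y in \<mu>. AE x in lborel. u (x - y) \<le> M)"
    by (rule AE_commute) measurable
  moreover have "AE x in lborel. u (x - y) \<le> M" for y
  proof -
    have "AE x in lborel. u (- (y - x)) \<le> M"
      using AE_lborel_minus[of "\<lambda>z. u (- z) \<le> M" y] AE_lborel_minus[OF bd, of 0] by simp
    then show ?thesis by simp
  qed
  ultimately show ?thesis by simp
qed

text \<open>A function that is not integrable has integral 0 by convention, so the bound covers that
  case too.\<close>

lemma finite_measure_integral_abs_le:
  fixes f :: "'a \<Rightarrow> real"
  assumes "finite_measure \<mu>" "AE y in \<mu>. \<bar>f y\<bar> \<le> c" "0 \<le> c"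
  shows "\<bar>\<integral>y. f y \<partial>\<mu>\<bar> \<le> c * measure \<mu> (space \<mu>)"
proof (cases "integrable \<mu> f")
  case True
  interpret finite_measure \<mu> by fact
  have "\<bar>\<integral>y. f y \<partial>\<mu>\<bar> \<le> (\<integral>y. \<bar>f y\<bar> \<partial>\<mu>)" using integral_norm_bound[of \<mu> f] by simp
  also have "\<dots> \<le> (\<integral>y. c \<partial>\<mu>)" by (intro integral_mono_AE) (use True assms in auto)
  finally show ?thesis by (simp add: mult.commute)
qed (use assms in \<open>simp add: not_integrable_integral_eq\<close>)

text \<open>The measures cost the squared sup bound times their masses. For \<open>h\<close> the
  pointwise Young estimate is integrated in y, where translation invariance makes its three terms
  independent of x.\<close>

lemma conv_w_AE_bound:
  fixes \<mu>1 \<mu>2 :: "(real^'n::finite) measure" and u :: "real^'n \<Rightarrow> complex"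
  assumes \<mu>1: "finite_measure \<mu>1" "sets \<mu>1 = sets borel" and \<mu>2: "finite_measure \<mu>2" "sets \<mu>2 = sets borel"
    and h: "h \<in> borel_measurable borel" "integrable lborel (\<lambda>x. \<bar>h x\<bar> powr q)"
    and q: "1 \<le> q" and r: "1 \<le> r"
    and u: "l2 u" "l2norm u \<le> B" and M: "0 < M" "AE z in lborel. cmod (u z) \<le> M"
    and P: "P = 2 * r / (r - 1)"
    and up: "r \<noteq> 1 \<Longrightarrow> integrable lborel (\<lambda>x. cmod (u x) powr P)" "r \<noteq> 1 \<Longrightarrow> (\<integral>x. cmod (u x) powr P \<partial>lborel) \<le> M powr P"
  shows "AE x in lborel. \<bar>conv_w \<mu>1 \<mu>2 h (\<lambda>y. (cmod (u y))\<^sup>2) x\<bar> \<le>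
    M\<^sup>2 * (measure \<mu>1 UNIV + measure \<mu>2 UNIV) + M powr (2 * min 1 (r / q)) * ((\<integral>x. \<bar>h x\<bar> powr q \<partial>lborel) + B\<^sup>2 + 1)"
proof -
  note [measurable] = h(1) l2_borel_measurable[OF u(1)]
  let ?E = "M powr (2 * min 1 (r / q))"
  have AEM: "AE x in lborel. AE y in \<mu>. (cmod (u (x - y)))\<^sup>2 \<le> M\<^sup>2"
    if "finite_measure \<mu>" "sets \<mu> = sets borel" for \<mu> :: "(real^'n) measure"
  proof (rule AE_minus_finite_measure[OF that])
    show "AE z in lborel. (cmod (u z))\<^sup>2 \<le> M\<^sup>2"
      using M(2) by (rule eventually_mono) (simp add: power_mono)
  qed measurable
  have hpart: "\<bar>\<integral>y. h y * (cmod (u (x - y)))\<^sup>2 \<partial>lborel\<bar> \<le> ?E * ((\<integral>x. \<bar>h x\<bar> powr q \<partial>lborel) + B\<^sup>2 + 1)" for x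
  proof -
    \<comment> \<open>Normalised by the L^p bound, so that its integral is at most 1.\<close>
    define T where "T y = (if r = 1 then 0 else M powr (- P) * cmod (u (x - y)) powr P)" for y
    have i2: "integrable lborel (\<lambda>y. (cmod (u (x - y)))\<^sup>2)"
      using integrable_lborel_affine[OF l2_integrable[OF u(1)], of "-1" x] by simp
    have I2: "(\<integral>y. (cmod (u (x - y)))\<^sup>2 \<partial>lborel) = (l2norm u)\<^sup>2"
      unfolding l2norm_sq using integral_lborel_affine[of "\<lambda>z. (cmod (u z))\<^sup>2" "-1" x] by simp
    have iT: "integrable lborel T"
      using integrable_lborel_affine[OF up(1), of "-1" x] unfolding T_def by (cases "r = 1") auto
    have IT: "(\<integral>y. T y \<partial>lborel) \<le> 1"
    proof (cases "r = 1")
      case False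
      have "(\<integral>y. T y \<partial>lborel) = M powr (- P) * (\<integral>z. cmod (u z) powr P \<partial>lborel)"
        using False integral_lborel_affine[of "\<lambda>z. cmod (u z) powr P" "-1" x] by (simp add: T_def)
      also have "\<dots> \<le> M powr (- P) * M powr P" using up(2)[OF False] by (intro mult_left_mono) auto
      also have "\<dots> = 1" using M(1) by (simp flip: powr_add)
      finally show ?thesis .
    qed (simp add: T_def)
    have bd: "AE y in lborel. \<bar>h y\<bar> * (cmod (u (x - y)))\<^sup>2 \<le> ?E * (\<bar>h y\<bar> powr q + (cmod (u (x - y)))\<^sup>2 + T y)"
      using AE_lborel_minus[OF M(2), of x]
    proof eventually_elim
      case (elim y)
      show ?case
        unfolding T_def P by (rule young_decay_exponent[OF q r M(1) abs_ge_zero norm_ge_zero elim])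
    qed
    have iR: "integrable lborel (\<lambda>y. ?E * (\<bar>h y\<bar> powr q + (cmod (u (x - y)))\<^sup>2 + T y))"
      by (intro integrable_mult_right Bochner_Integration.integrable_add h i2 iT)
    have "\<bar>\<integral>y. h y * (cmod (u (x - y)))\<^sup>2 \<partial>lborel\<bar> \<le> (\<integral>y. ?E * (\<bar>h y\<bar> powr q + (cmod (u (x - y)))\<^sup>2 + T y) \<partial>lborel)"
    proof -
      have ia: "integrable lborel (\<lambda>y. \<bar>h y\<bar> * (cmod (u (x - y)))\<^sup>2)"
        by (rule Bochner_Integration.integrable_bound[OF iR])
           (use bd in \<open>auto elim!: eventually_mono intro: order_trans[OF _ abs_ge_self]\<close>)
      have "\<bar>\<integral>y. h y * (cmod (u (x - y)))\<^sup>2 \<partial>lborel\<bar> \<le> (\<integral>y. \<bar>h y\<bar> * (cmod (u (x - y)))\<^sup>2 \<partial>lborel)"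
        using integral_norm_bound[of lborel "\<lambda>y. h y * (cmod (u (x - y)))\<^sup>2"] by (simp add: abs_mult)
      also have "\<dots> \<le> (\<integral>y. ?E * (\<bar>h y\<bar> powr q + (cmod (u (x - y)))\<^sup>2 + T y) \<partial>lborel)"
        by (rule integral_mono_AE[OF ia iR bd])
      finally show ?thesis .
    qed
    also have "\<dots> = ?E * ((\<integral>x. \<bar>h x\<bar> powr q \<partial>lborel) + (l2norm u)\<^sup>2 + (\<integral>y. T y \<partial>lborel))"
      using h(2) i2 iT by (simp add: I2)
    also have "\<dots> \<le> ?E * ((\<integral>x. \<bar>h x\<bar> powr q \<partial>lborel) + B\<^sup>2 + 1)"
      using IT power_mono[OF u(2) l2norm_nonneg, of 2] by (intro mult_left_mono add_mono) auto
    finally show ?thesis .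
  qed
  have sp: "space \<mu>1 = UNIV" "space \<mu>2 = UNIV"
    using sets_eq_imp_space_eq[OF \<mu>1(2)] sets_eq_imp_space_eq[OF \<mu>2(2)] by auto
  show ?thesis
    using AEM[OF \<mu>1] AEM[OF \<mu>2]
  proof eventually_elim
    case (elim x)
    have "\<bar>\<integral>y. (cmod (u (x - y)))\<^sup>2 \<partial>\<mu>1\<bar> \<le> M\<^sup>2 * measure \<mu>1 UNIV"
      using finite_measure_integral_abs_le[OF \<mu>1(1), of "\<lambda>y. (cmod (u (x - y)))\<^sup>2" "M\<^sup>2"] elim(1) by (simp add: sp)
    moreover have "\<bar>\<integral>y. (cmod (u (x - y)))\<^sup>2 \<partial>\<mu>2\<bar> \<le> M\<^sup>2 * measure \<mu>2 UNIV"
      using finite_measure_integral_abs_le[OF \<mu>2(1), of "\<lambda>y. (cmod (u (x - y)))\<^sup>2" "M\<^sup>2"] elim(2) by (simp add: sp)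
    ultimately show ?case
      using hpart[of x] unfolding conv_w_def distrib_left by linarith
  qed
qed

lemma conv_w_measurable:
  fixes \<mu>1 \<mu>2 :: "(real^'n::finite) measure"
  assumes \<mu>1: "finite_measure \<mu>1" "sets \<mu>1 = sets borel" and \<mu>2: "finite_measure \<mu>2" "sets \<mu>2 = sets borel"
    and [measurable]: "h \<in> borel_measurable borel" "\<rho> \<in> borel_measurable borel"
  shows "conv_w \<mu>1 \<mu>2 h \<rho> \<in> borel_measurable borel"
proof -
  interpret m1: finite_measure \<mu>1 by fact
  interpret m2: finite_measure \<mu>2 by fact
  have [measurable_cong]: "sets \<mu>1 = sets borel" "sets \<mu>2 = sets borel" by fact+
  have "(\<lambda>x. \<integral>y. \<rho> (x - y) \<partial>\<mu>1) \<in> borel_measurable borel" "(\<lambda>x. \<integral>y. \<rho> (x - y) \<partial>\<mu>2) \<in> borel_measurable borel"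
    "(\<lambda>x. \<integral>y. h y * \<rho> (x - y) \<partial>lborel) \<in> borel_measurable borel"
    by measurable
  then show ?thesis unfolding conv_w_def[abs_def] by measurable
qed

lemma nonlin_l2:
  fixes \<mu>1 \<mu>2 :: "(real^'n::finite) measure" and u :: "real^'n \<Rightarrow> complex"
  assumes "finite_measure \<mu>1" "sets \<mu>1 = sets borel" "finite_measure \<mu>2" "sets \<mu>2 = sets borel"
    and h: "h \<in> borel_measurable borel" and u: "l2 u"
    and bd: "AE x in lborel. \<bar>conv_w \<mu>1 \<mu>2 h (\<lambda>y. (cmod (u y))\<^sup>2) x\<bar> \<le> k"
  shows "l2 (nonlin \<mu>1 \<mu>2 h u)" "0 \<le> k \<Longrightarrow> l2norm (nonlin \<mu>1 \<mu>2 h u) \<le> k * l2norm u"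
proof -
  note [measurable] = l2_borel_measurable[OF u]
  have [measurable]: "conv_w \<mu>1 \<mu>2 h (\<lambda>y. (cmod (u y))\<^sup>2) \<in> borel_measurable borel"
    by (rule conv_w_measurable[OF assms(1-4) h]) simp
  have m: "nonlin \<mu>1 \<mu>2 h u \<in> borel_measurable lborel"
    unfolding nonlin_def[abs_def] by simp
  have b: "AE x in lborel. cmod (nonlin \<mu>1 \<mu>2 h u x) \<le> k * cmod (u x)"
    using bd by eventually_elim (simp add: nonlin_def norm_mult mult_right_mono)
  show "l2 (nonlin \<mu>1 \<mu>2 h u)" by (rule l2_dominated[OF u m b])
  show "0 \<le> k \<Longrightarrow> l2norm (nonlin \<mu>1 \<mu>2 h u) \<le> k * l2norm u" by (rule l2norm_mono_AE[OF u m b])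
qed

lemma in_Lp_infinity_AE:
  assumes "in_Lp \<infinity> u"
  shows "AE x in lborel. cmod (u x) \<le> lp_norm \<infinity> u" and "0 \<le> lp_norm \<infinity> u"
proof -
  define E where "E = esssup lborel (\<lambda>x. ereal (cmod (u x)))"
  have E: "E < \<infinity>" "lp_norm \<infinity> u = real_of_ereal E"
    using assms by (auto simp: in_Lp_def lp_norm_def E_def)
  have "AE x in lborel. ereal (cmod (u x)) \<le> E"
    unfolding E_def by (rule esssup_AE)
  then show ae: "AE x in lborel. cmod (u x) \<le> lp_norm \<infinity> u"
    by (rule eventually_mono) (use E in \<open>cases E; auto\<close>)
  have "ae_filter (lborel :: (real^'a) measure) \<noteq> bot"
    by (simp add: ae_filter_eq_bot_iff)
  from eventually_happens'[OF this ae] show "0 \<le> lp_norm \<infinity> u"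
    using norm_ge_zero order_trans by blast
qed

lemma dual_exponent_eq:
  assumes "1 = ereal (1 / r) + 2 * inverse p" "1 < r"
  shows "p = ereal (2 * r / (r - 1))"
proof (cases p)
  case (real x)
  have x0: "x \<noteq> 0" using assms(1) real by auto
  then have "ereal 1 = ereal (1 / r + 2 * inverse x)"
    using assms(1) real by (simp add: one_ereal_def)
  then have "1 = 1 / r + 2 * inverse x" by simp
  then have "x = 2 * r / (r - 1)" using x0 assms(2) by (simp add: field_simps)
  then show ?thesis using real by simp
qed (use assms in \<open>auto simp: one_ereal_def\<close>)

lemma nonlin_decay:
  fixes \<psi> :: "real \<Rightarrow> real^'n::finite \<Rightarrow> complex" and q r s :: real
  assumes S: "in_S s r p \<psi>" and s: "0 \<le> s" and r: "1 \<le> r" "r < real CARD('n)" and q: "1 \<le> q" "q < real CARD('n)"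
    and p: "1 = ereal (1 / r) + 2 * inverse p" and dec: "decomp (ereal q) w \<mu>1 \<mu>2 h"
  obtains K \<alpha> where "0 \<le> K" "1 < \<alpha>" "\<And>t. 0 \<le> t \<Longrightarrow> l2 (\<psi> t)"
    "\<And>t. 0 \<le> t \<Longrightarrow> l2 (nonlin \<mu>1 \<mu>2 h (\<psi> t))"
    "\<And>t. 0 \<le> t \<Longrightarrow> l2norm (nonlin \<mu>1 \<mu>2 h (\<psi> t)) \<le> K * jbr t powr (- \<alpha>)"
proof -
  let ?d = "real CARD('n)"
  define P where "P = 2 * r / (r - 1)"
  obtain B where B: "\<And>t. 0 \<le> t \<Longrightarrow> Hsp_norm s 2 (\<psi> t) \<le> B"
    using S unfolding in_S_def by blast
  obtain C0 where C0: "\<And>t. 0 \<le> t \<Longrightarrow> jbr t powr (?d / (2 * r)) * (lp_norm \<infinity> (\<psi> t) + lp_norm p (\<psi> t)) \<le> C0"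
    using S unfolding in_S_def by blast
  have H: "in_Hsp s 2 (\<psi> t)" "in_Lp \<infinity> (\<psi> t)" "in_Lp p (\<psi> t)" if "0 \<le> t" for t
    using S that unfolding in_S_def by blast+
  \<comment> \<open>Being at least 1, the constant satisfies C^e <= C^2 for all exponents e up to 2
    and makes \<open>M\<close> positive.\<close>
  define C where "C = max 1 C0"
  have C1: "1 \<le> C" by (simp add: C_def)
  define \<alpha> where "\<alpha> = min (?d / r) (?d / q)"
  have \<alpha>: "1 < \<alpha>" using r q by (simp add: \<alpha>_def)
  have dm: "finite_measure \<mu>1" "sets \<mu>1 = sets borel" "finite_measure \<mu>2" "sets \<mu>2 = sets borel"
    using dec by (auto simp: decomp_def)
  have hL: "in_Lp (ereal q) (\<lambda>x. complex_of_real (h x))" using dec by (auto simp: decomp_def)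
  have hm: "h \<in> borel_measurable borel"
  proof -
    have [measurable]: "(\<lambda>x. complex_of_real (h x)) \<in> borel_measurable borel" using hL by (simp add: in_Lp_def)
    have "(\<lambda>x. Re (complex_of_real (h x))) \<in> borel_measurable borel" by measurable
    then show ?thesis by simp
  qed
  have hi: "integrable lborel (\<lambda>x. \<bar>h x\<bar> powr q)"
    using hL by (simp add: in_Lp_def)
  define A where "A = (\<integral>x. \<bar>h x\<bar> powr q \<partial>lborel)"
  have A0: "0 \<le> A" by (simp add: A_def)
  define m where "m = measure \<mu>1 UNIV + measure \<mu>2 UNIV"
  have m0: "0 \<le> m" by (simp add: m_def)
  have l2t: "l2 (\<psi> t)" "l2norm (\<psi> t) \<le> B" if "0 \<le> t" for t
    using l2norm_le_Hsp_norm[OF H(1)[OF that] s] B[OF that] by auto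
  have B0: "0 \<le> B" using l2norm_nonneg l2t(2)[of 0] order_trans by blast
  define k where "k = C\<^sup>2 * (m + (A + B\<^sup>2 + 1))"
  have k0: "0 \<le> k" using A0 m0 by (simp add: k_def)
  have main: "l2 (nonlin \<mu>1 \<mu>2 h (\<psi> t)) \<and> l2norm (nonlin \<mu>1 \<mu>2 h (\<psi> t)) \<le> (k * B) * jbr t powr (- \<alpha>)" if t: "0 \<le> t" for t
  proof -
    have j1: "1 \<le> jbr t" by (rule jbr_ge_1)
    have j0: "0 < jbr t" using j1 by linarith
    \<comment> \<open>The sup and L^p norms are nonnegative with sum at most \<open>M\<close>, so
      this one number bounds both. Its square decays at the rate d / r, its power 2 r / q at the
      rate d / q.\<close>
    define M where "M = C * jbr t powr (- ?d / (2 * r))"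
    have M0: "0 < M" using C1 j0 by (simp add: M_def)
    have "lp_norm \<infinity> (\<psi> t) + lp_norm p (\<psi> t) = jbr t powr (- ?d / (2 * r)) * (jbr t powr (?d / (2 * r)) * (lp_norm \<infinity> (\<psi> t) + lp_norm p (\<psi> t)))"
      using j0 by (simp add: mult.assoc[symmetric] powr_add[symmetric])
    also have "\<dots> \<le> jbr t powr (- ?d / (2 * r)) * C"
      using C0[OF t] by (intro mult_left_mono) (auto simp: C_def)
    finally have sum: "lp_norm \<infinity> (\<psi> t) + lp_norm p (\<psi> t) \<le> M" by (simp add: M_def mult.commute)
    have pos: "0 \<le> lp_norm \<infinity> (\<psi> t)" "0 \<le> lp_norm p (\<psi> t)"
    proof -
      show "0 \<le> lp_norm \<infinity> (\<psi> t)" by (rule in_Lp_infinity_AE(2)[OF H(2)[OF t]])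
      then show "0 \<le> lp_norm p (\<psi> t)" by (cases "p = \<infinity>") (simp, simp add: lp_norm_def)
    qed
    have AEM: "AE z in lborel. cmod (\<psi> t z) \<le> M"
      using in_Lp_infinity_AE(1)[OF H(2)[OF t]] by (rule eventually_mono) (use sum pos in linarith)
    have up: "integrable lborel (\<lambda>x. cmod (\<psi> t x) powr P)" "(\<integral>x. cmod (\<psi> t x) powr P \<partial>lborel) \<le> M powr P" if "r \<noteq> 1"
    proof -
      have r1: "1 < r" using that r by simp
      have P0: "0 < P" using r1 by (simp add: P_def)
      have pP: "p = ereal P" using dual_exponent_eq[OF p r1] by (simp add: P_def)
      show "integrable lborel (\<lambda>x. cmod (\<psi> t x) powr P)"
        using H(3)[OF t] by (simp add: pP in_Lp_def)
      have I0: "0 \<le> (\<integral>x. cmod (\<psi> t x) powr P \<partial>lborel)" by simp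
      have "(\<integral>x. cmod (\<psi> t x) powr P \<partial>lborel) powr (1 / P) \<le> M"
        using sum pos by (simp add: pP lp_norm_def)
      then have "((\<integral>x. cmod (\<psi> t x) powr P \<partial>lborel) powr (1 / P)) powr P \<le> M powr P"
        using P0 by (intro powr_mono2) auto
      then show "(\<integral>x. cmod (\<psi> t x) powr P \<partial>lborel) \<le> M powr P"
        using P0 I0 by (simp add: powr_powr)
    qed
    have bound: "AE x in lborel. \<bar>conv_w \<mu>1 \<mu>2 h (\<lambda>y. (cmod (\<psi> t y))\<^sup>2) x\<bar> \<le>
        M\<^sup>2 * m + M powr (2 * min 1 (r / q)) * (A + B\<^sup>2 + 1)"
      unfolding m_def A_def
      by (rule conv_w_AE_bound[OF dm hm hi q(1) r(1) l2t[OF t] M0 AEM P_def up])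
    have Me: "M powr e \<le> C\<^sup>2 * jbr t powr (- \<alpha>)" if "0 \<le> e" "e \<le> 2" "\<alpha> \<le> ?d / (2 * r) * e" for e
    proof -
      have "M powr e = C powr e * jbr t powr (- (?d / (2 * r) * e))"
        using C1 by (simp add: M_def powr_mult powr_powr)
      also have "\<dots> \<le> C powr 2 * jbr t powr (- \<alpha>)"
        using that C1 j1 by (intro mult_mono powr_mono) auto
      finally show ?thesis using C1 by (simp add: powr_numeral)
    qed
    have e1: "M\<^sup>2 \<le> C\<^sup>2 * jbr t powr (- \<alpha>)"
      using Me[of 2] M0 by (simp add: powr_numeral \<alpha>_def)
    have e2: "M powr (2 * min 1 (r / q)) \<le> C\<^sup>2 * jbr t powr (- \<alpha>)"
    proof (rule Me)
      have "?d / (2 * r) * (2 * min 1 (r / q)) = min (?d / r) (?d / q)"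
        using r q by (auto simp: min_def field_simps)
      then show "\<alpha> \<le> ?d / (2 * r) * (2 * min 1 (r / q))" by (simp add: \<alpha>_def)
    qed (use r q in auto)
    have "M\<^sup>2 * m + M powr (2 * min 1 (r / q)) * (A + B\<^sup>2 + 1) \<le> C\<^sup>2 * jbr t powr (- \<alpha>) * m + C\<^sup>2 * jbr t powr (- \<alpha>) * (A + B\<^sup>2 + 1)"
      using e1 e2 m0 A0 by (intro add_mono mult_right_mono) auto
    also have "\<dots> = k * jbr t powr (- \<alpha>)" by (simp add: k_def algebra_simps)
    finally have le: "M\<^sup>2 * m + M powr (2 * min 1 (r / q)) * (A + B\<^sup>2 + 1) \<le> k * jbr t powr (- \<alpha>)" .
    have b2: "AE x in lborel. \<bar>conv_w \<mu>1 \<mu>2 h (\<lambda>y. (cmod (\<psi> t y))\<^sup>2) x\<bar> \<le> k * jbr t powr (- \<alpha>)"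
      using bound by (rule eventually_mono) (use le in linarith)
    have kj: "0 \<le> k * jbr t powr (- \<alpha>)" using k0 by simp
    have "l2norm (nonlin \<mu>1 \<mu>2 h (\<psi> t)) \<le> k * jbr t powr (- \<alpha>) * l2norm (\<psi> t)"
      by (rule nonlin_l2(2)[OF dm hm l2t(1)[OF t] b2 kj])
    also have "\<dots> \<le> k * jbr t powr (- \<alpha>) * B" by (rule mult_left_mono[OF l2t(2)[OF t] kj])
    finally show ?thesis using nonlin_l2(1)[OF dm hm l2t(1)[OF t] b2] by (simp add: mult_ac)
  qed
  show thesis
    by (rule that[of "k * B" \<alpha>]) (use k0 B0 \<alpha> l2t main in auto)
qed

section \<open>Velocity distribution of the free evolution\<close>

lemma jbr_pos: "0 < jbr x"
  using jbr_ge_1[of x] by linarith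

lemma jbr_sq: "(jbr x)\<^sup>2 = 1 + (norm x)\<^sup>2"
  by (simp add: jbr_def)

text \<open>The difference of square roots is rationalised: \<open>jbr\<close> squared is quadratic,
  so the numerator is explicit and the denominator tends to twice \<open>jbr \<xi>\<close>.\<close>

lemma jbr_diff_limit:
  fixes \<xi> y :: "'a::real_inner"
  assumes X: "filterlim X at_top sequentially"
  shows "(\<lambda>n. X n * (jbr \<xi> - jbr (\<xi> - (1 / X n) *\<^sub>R y))) \<longlonglongrightarrow> (y \<bullet> \<xi>) / jbr \<xi>"
proof (rule Lim_transform_eventually)
  have inv: "(\<lambda>n. 1 / X n) \<longlonglongrightarrow> 0"
    using tendsto_inverse_0_at_top[OF X] by (simp add: inverse_eq_divide)
  have sh: "(\<lambda>n. jbr (\<xi> - (1 / X n) *\<^sub>R y)) \<longlonglongrightarrow> jbr (\<xi> - 0 *\<^sub>R y)"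
    unfolding jbr_def by (intro tendsto_intros inv)
  have "(\<lambda>n. (2 * (y \<bullet> \<xi>) - (1 / X n) * (norm y)\<^sup>2) / (jbr \<xi> + jbr (\<xi> - (1 / X n) *\<^sub>R y))) \<longlonglongrightarrow>
      (2 * (y \<bullet> \<xi>) - 0 * (norm y)\<^sup>2) / (jbr \<xi> + jbr (\<xi> - 0 *\<^sub>R y))"
    using jbr_pos[of \<xi>] by (intro tendsto_intros inv sh) auto
  then show "(\<lambda>n. (2 * (y \<bullet> \<xi>) - (1 / X n) * (norm y)\<^sup>2) / (jbr \<xi> + jbr (\<xi> - (1 / X n) *\<^sub>R y))) \<longlonglongrightarrow> (y \<bullet> \<xi>) / jbr \<xi>"
    by simp
  show "\<forall>\<^sub>F n in sequentially. (2 * (y \<bullet> \<xi>) - (1 / X n) * (norm y)\<^sup>2) / (jbr \<xi> + jbr (\<xi> - (1 / X n) *\<^sub>R y))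
      = X n * (jbr \<xi> - jbr (\<xi> - (1 / X n) *\<^sub>R y))"
    using filterlim_at_top_dense[THEN iffD1, OF X, rule_format, of 0]
  proof eventually_elim
    case (elim n)
    define \<eta> where "\<eta> = \<xi> - (1 / X n) *\<^sub>R y"
    have s: "0 < jbr \<xi> + jbr \<eta>" using jbr_pos[of \<xi>] jbr_pos[of \<eta>] by linarith
    have "(norm \<eta>)\<^sup>2 = (norm \<xi>)\<^sup>2 - 2 * (1 / X n) * (y \<bullet> \<xi>) + (1 / X n)\<^sup>2 * (norm y)\<^sup>2"
      unfolding \<eta>_def power2_norm_eq_inner
      by (simp add: inner_diff_left inner_diff_right inner_commute power2_eq_square algebra_simps)
    then have "(jbr \<xi>)\<^sup>2 - (jbr \<eta>)\<^sup>2 = (1 / X n) * (2 * (y \<bullet> \<xi>) - (1 / X n) * (norm y)\<^sup>2)"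
      unfolding jbr_sq by (simp add: power2_eq_square algebra_simps)
    moreover have "(jbr \<xi>)\<^sup>2 - (jbr \<eta>)\<^sup>2 = (jbr \<xi> - jbr \<eta>) * (jbr \<xi> + jbr \<eta>)"
      by (simp add: power2_eq_square algebra_simps)
    ultimately have *: "X n * ((jbr \<xi> - jbr \<eta>) * (jbr \<xi> + jbr \<eta>)) = 2 * (y \<bullet> \<xi>) - (1 / X n) * (norm y)\<^sup>2"
      using elim by simp
    have ne: "jbr \<xi> + jbr \<eta> \<noteq> 0" using s by linarith
    show ?case
      unfolding \<eta>_def[symmetric] nonzero_divide_eq_eq[OF ne] using *[symmetric] by (simp only: mult.assoc)
  qed
qed

text \<open>The propagator acts on Fourier profiles: \<open>IFT (free_evol t b)\<close> is the free
  solution with profile \<open>b\<close>.\<close>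

definition free_evol :: "real \<Rightarrow> (real^'n::finite \<Rightarrow> complex) \<Rightarrow> real^'n \<Rightarrow> complex" where
  "free_evol t b \<xi> = cis (- (t * jbr \<xi>)) * b \<xi>"

lemma cis_cont: "continuous_on UNIV f \<Longrightarrow> continuous_on UNIV (\<lambda>x. cis (f x))" for f :: "real^'n::finite \<Rightarrow> real"
  by (intro continuous_intros)

lemma free_evol_norm [simp]: "cmod (free_evol t b \<xi>) = cmod (b \<xi>)"
  by (simp add: free_evol_def)

lemma free_evol_cc:
  assumes "continuous_on UNIV b" "bounded {x. b x \<noteq> 0}"
  shows "continuous_on UNIV (free_evol t b)" "bounded {x. free_evol t b x \<noteq> 0}"
proof -
  show "continuous_on UNIV (free_evol t b)"
    unfolding free_evol_def by (intro continuous_on_mult assms(1) cis_cont continuous_on_minus continuous_on_const jbr_continuous)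
  show "bounded {x. free_evol t b x \<noteq> 0}"
    using assms(2) by (simp add: free_evol_def)
qed

lemma free_evol_l2:
  assumes "l2 b"
  shows "l2 (free_evol t b)" "l2norm (free_evol t b) = l2norm b"
proof -
  have [measurable]: "(jbr :: real^'a \<Rightarrow> real) \<in> borel_measurable borel"
    by (rule borel_measurable_continuous_onI[OF jbr_continuous])
  have "free_evol t b \<in> borel_measurable lborel"
    unfolding free_evol_def[abs_def] using l2_borel_measurable[OF assms] by measurable
  then show "l2 (free_evol t b)" by (rule l2_dominated[OF assms, of _ 1]) simp
  show "l2norm (free_evol t b) = l2norm b" by (simp add: l2norm_def)
qed

lemma free_evol_add: "free_evol s (free_evol t b) = free_evol (s + t) b"
  by (rule ext) (simp add: free_evol_def mult.assoc[symmetric] cis_mult distrib_right)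

lemma free_evol_diff: "free_evol t (\<lambda>\<xi>. a \<xi> - b \<xi>) \<xi> = free_evol t a \<xi> - free_evol t b \<xi>"
  by (simp add: free_evol_def algebra_simps)

lemma IFT_modulate:
  fixes b :: "real^'n::finite \<Rightarrow> complex"
  assumes [measurable]: "b \<in> borel_measurable borel"
  shows "cis (x \<bullet> \<eta>) * IFT b x = IFT (\<lambda>\<xi>. b (\<xi> - \<eta>)) x"
proof -
  have "(\<integral>\<xi>. cis (x \<bullet> \<xi>) * b (\<xi> - \<eta>) \<partial>lborel) = \<bar>1\<bar>^DIM(real^'n) *\<^sub>R (\<integral>\<xi>. cis (x \<bullet> (\<eta> + 1 *\<^sub>R \<xi>)) * b ((\<eta> + 1 *\<^sub>R \<xi>) - \<eta>) \<partial>lborel)"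
    by (rule integral_lborel_affine) auto
  also have "\<dots> = (\<integral>\<xi>. cis (x \<bullet> \<eta>) * (cis (x \<bullet> \<xi>) * b \<xi>) \<partial>lborel)"
    by (simp add: inner_add_right cis_mult[symmetric] mult.assoc del: cis_mult)
  also have "\<dots> = cis (x \<bullet> \<eta>) * (\<integral>\<xi>. cis (x \<bullet> \<xi>) * b \<xi> \<partial>lborel)"
    by (rule integral_mult_right_zero)
  finally show ?thesis by (simp add: IFT_eq)
qed

lemma cc_shift:
  fixes b :: "real^'n::finite \<Rightarrow> complex"
  assumes "continuous_on UNIV b" "bounded {x. b x \<noteq> 0}"
  shows "continuous_on UNIV (\<lambda>x. b (x - \<eta>))" "bounded {x. b (x - \<eta>) \<noteq> 0}"
proof -
  show "continuous_on UNIV (\<lambda>x. b (x - \<eta>))"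
    by (rule continuous_on_compose2[OF assms(1)]) (auto intro: continuous_on_diff continuous_on_id continuous_on_const)
  have "{x. b (x - \<eta>) \<noteq> 0} = (\<lambda>x. \<eta> + x) ` {x. b x \<noteq> 0}"
    by (auto intro: image_eqI[where x = "_ - \<eta>"])
  then show "bounded {x. b (x - \<eta>) \<noteq> 0}"
    using bounded_translation[OF assms(2)] by simp
qed

text \<open>The position distribution of the free evolution, rescaled by time, converges to the velocity distribution:
  its characteristic function is computed on the Fourier side, where modulation by \<open>y / t\<close> is a translation.\<close>

lemma velocity_char_limit:
  fixes b :: "real^'n::finite \<Rightarrow> complex"
  assumes b: "continuous_on UNIV b" "bounded {x. b x \<noteq> 0}" and X: "filterlim X at_top sequentially"
  shows "(\<lambda>n. \<integral>x. cis (x \<bullet> ((1 / X n) *\<^sub>R y)) * of_real ((cmod (IFT (free_evol (X n) b) x))\<^sup>2) \<partial>lborel) \<longlonglongrightarrow>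
    (\<integral>\<xi>. cis (((1 / jbr \<xi>) *\<^sub>R \<xi>) \<bullet> y) * of_real ((cmod (b \<xi>))\<^sup>2) \<partial>lborel)"
proof -
  obtain B where B: "\<And>x. cmod (b x) \<le> B" using cc_bound[OF b] by metis
  note ec = free_evol_cc[OF b]
  have bi: "integrable lborel b" by (rule integrable_cc[OF b])
  have [measurable]: "b \<in> borel_measurable borel" using bi by simp
  have [measurable]: "(jbr :: real^'n \<Rightarrow> real) \<in> borel_measurable borel"
    by (rule borel_measurable_continuous_onI[OF jbr_continuous])
  have eq: "(\<integral>x. cis (x \<bullet> \<eta>) * of_real ((cmod (IFT (free_evol t b) x))\<^sup>2) \<partial>lborel)
     = (\<integral>\<xi>. cnj (free_evol t b \<xi>) * free_evol t b (\<xi> - \<eta>) \<partial>lborel)" for t \<eta>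
  proof -
    have m: "free_evol t b \<in> borel_measurable borel" using integrable_cc[OF ec] by simp
    have "(\<integral>x. cis (x \<bullet> \<eta>) * of_real ((cmod (IFT (free_evol t b) x))\<^sup>2) \<partial>lborel)
        = l2inner (IFT (free_evol t b)) (IFT (\<lambda>\<xi>. free_evol t b (\<xi> - \<eta>)))"
      unfolding l2inner_def IFT_modulate[OF m, symmetric]
      by (simp add: complex_norm_square mult_ac flip: of_real_power)
    also have "\<dots> = l2inner (free_evol t b) (\<lambda>\<xi>. free_evol t b (\<xi> - \<eta>))"
      by (rule IFT_isometry(2)[OF nice_cc[OF ec] nice_cc[OF cc_shift[OF ec]]])
    finally show ?thesis by (simp add: l2inner_def)
  qed
  show ?thesis
    unfolding eq
  proof (rule integral_dominated_convergence[where w = "\<lambda>\<xi>. cmod (b \<xi>) * B"])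
    show "(\<lambda>\<xi>. cis (((1 / jbr \<xi>) *\<^sub>R \<xi>) \<bullet> y) * complex_of_real ((cmod (b \<xi>))\<^sup>2)) \<in> borel_measurable lborel" by measurable
    show "(\<lambda>\<xi>. cnj (free_evol (X n) b \<xi>) * free_evol (X n) b (\<xi> - (1 / X n) *\<^sub>R y)) \<in> borel_measurable lborel" for n
      unfolding free_evol_def by measurable
    show "integrable lborel (\<lambda>\<xi>. cmod (b \<xi>) * B)" using bi by simp
    show "AE \<xi> in lborel. norm (cnj (free_evol (X n) b \<xi>) * free_evol (X n) b (\<xi> - (1 / X n) *\<^sub>R y)) \<le> cmod (b \<xi>) * B" for n
      by (intro AE_I2) (simp add: norm_mult mult_left_mono B)
    show "AE \<xi> in lborel. (\<lambda>n. cnj (free_evol (X n) b \<xi>) * free_evol (X n) b (\<xi> - (1 / X n) *\<^sub>R y)) \<longlonglongrightarrow>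
        cis (((1 / jbr \<xi>) *\<^sub>R \<xi>) \<bullet> y) * complex_of_real ((cmod (b \<xi>))\<^sup>2)"
    proof (rule AE_I2)
      fix \<xi> :: "real^'n"
      have inv: "(\<lambda>n. 1 / X n) \<longlonglongrightarrow> 0"
        using tendsto_inverse_0_at_top[OF X] by (simp add: inverse_eq_divide)
      have "(\<lambda>n. \<xi> - (1 / X n) *\<^sub>R y) \<longlonglongrightarrow> \<xi> - 0 *\<^sub>R y" by (intro tendsto_intros inv)
      then have "(\<lambda>n. b (\<xi> - (1 / X n) *\<^sub>R y)) \<longlonglongrightarrow> b (\<xi> - 0 *\<^sub>R y)"
        by (rule continuous_on_tendsto_compose[OF b(1)]) auto
      then have bl: "(\<lambda>n. b (\<xi> - (1 / X n) *\<^sub>R y)) \<longlonglongrightarrow> b \<xi>" by simp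
      have "(\<lambda>n. cnj (b \<xi>) * (cis (X n * (jbr \<xi> - jbr (\<xi> - (1 / X n) *\<^sub>R y))) * b (\<xi> - (1 / X n) *\<^sub>R y))) \<longlonglongrightarrow>
          cnj (b \<xi>) * (cis ((y \<bullet> \<xi>) / jbr \<xi>) * b \<xi>)"
        by (intro tendsto_intros bl jbr_diff_limit[OF X])
      moreover have "cnj (free_evol (X n) b \<xi>) * free_evol (X n) b (\<xi> - (1 / X n) *\<^sub>R y) =
          cnj (b \<xi>) * (cis (X n * (jbr \<xi> - jbr (\<xi> - (1 / X n) *\<^sub>R y))) * b (\<xi> - (1 / X n) *\<^sub>R y))" for n
      proof -
        have "cis (X n * jbr \<xi>) * cis (- (X n * jbr (\<xi> - (1 / X n) *\<^sub>R y))) = cis (X n * (jbr \<xi> - jbr (\<xi> - (1 / X n) *\<^sub>R y)))"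
          by (simp add: cis_mult right_diff_distrib)
        then show ?thesis by (simp add: free_evol_def cis_cnj mult_ac)
      qed
      moreover have "cnj (b \<xi>) * (cis ((y \<bullet> \<xi>) / jbr \<xi>) * b \<xi>) = cis (((1 / jbr \<xi>) *\<^sub>R \<xi>) \<bullet> y) * complex_of_real ((cmod (b \<xi>))\<^sup>2)"
        by (simp add: complex_norm_square inner_commute mult_ac flip: of_real_power)
      ultimately show "(\<lambda>n. cnj (free_evol (X n) b \<xi>) * free_evol (X n) b (\<xi> - (1 / X n) *\<^sub>R y)) \<longlonglongrightarrow>
          cis (((1 / jbr \<xi>) *\<^sub>R \<xi>) \<bullet> y) * complex_of_real ((cmod (b \<xi>))\<^sup>2)"
        by (simp only:)
    qed
  qed
qed

text \<open>By Fubini, averaging \<open>FT k\<close> over the law of \<open>v\<close> under the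
  density \<open>\<rho>\<close> amounts to integrating the characteristic function of that law
  against \<open>k\<close>. The same identity serves for positions and for velocities.\<close>

lemma FT_superposition:
  fixes \<rho> :: "real^'n::finite \<Rightarrow> real" and v :: "real^'n \<Rightarrow> real^'n"
  assumes k: "integrable lborel k" and \<rho>: "integrable lborel \<rho>" and v: "v \<in> borel_measurable borel"
  shows "(\<integral>x. FT k (v x) * of_real (\<rho> x) \<partial>lborel) =
    fourier_const TYPE('n) * (\<integral>y. k y * (\<integral>x. cis (- (y \<bullet> v x)) * of_real (\<rho> x) \<partial>lborel) \<partial>lborel)"
proof -
  note [measurable] = v
  have "(\<integral>x. FT k (v x) * of_real (\<rho> x) \<partial>lborel) =
     fourier_const TYPE('n) * (\<integral>x. complex_of_real (\<rho> x) * (\<integral>y. cis (- (y \<bullet> v x)) * k y \<partial>lborel) \<partial>lborel)"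
    by (simp add: FT_eq mult_ac flip: integral_mult_right_zero)
  also have "(\<integral>x. complex_of_real (\<rho> x) * (\<integral>y. cis (- (y \<bullet> v x)) * k y \<partial>lborel) \<partial>lborel)
      = (\<integral>y. k y * (\<integral>x. cis (- (y \<bullet> v x)) * complex_of_real (\<rho> x) \<partial>lborel) \<partial>lborel)"
    by (rule fubini_kernel[OF integrable_of_real[OF \<rho>] k, of "\<lambda>x y. cis (- (y \<bullet> v x))" 1]) auto
  finally show ?thesis .
qed

text \<open>Characteristic functions converge pointwise and are bounded by the conserved mass
  \<open>(l2norm b)\<^sup>2\<close>, so integrability of \<open>k\<close> provides the dominating
  function.\<close>

lemma velocity_FT_limit:
  fixes b :: "real^'n::finite \<Rightarrow> complex"
  assumes b: "continuous_on UNIV b" "bounded {x. b x \<noteq> 0}" and X: "filterlim X at_top sequentially"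
    and k: "integrable lborel k"
  shows "(\<lambda>n. \<integral>x. FT k ((1 / X n) *\<^sub>R x) * of_real ((cmod (IFT (free_evol (X n) b) x))\<^sup>2) \<partial>lborel) \<longlonglongrightarrow>
    (\<integral>\<xi>. FT k ((1 / jbr \<xi>) *\<^sub>R \<xi>) * of_real ((cmod (b \<xi>))\<^sup>2) \<partial>lborel)"
proof -
  note ec = free_evol_cc[OF b]
  have [measurable]: "k \<in> borel_measurable borel" "b \<in> borel_measurable borel"
    using k borel_measurable_cont[OF b(1)] by auto
  have jm [measurable]: "(jbr :: real^'n \<Rightarrow> real) \<in> borel_measurable borel"
    by (rule borel_measurable_continuous_onI[OF jbr_continuous])
  have wl: "l2 (IFT (free_evol t b))" for t by (rule IFT_isometry(1)[OF nice_cc[OF ec] nice_cc[OF ec]])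
  note [measurable] = l2_borel_measurable[OF wl]
  have wn: "(\<integral>x. (cmod (IFT (free_evol t b) x))\<^sup>2 \<partial>lborel) = (l2norm b)\<^sup>2" for t
    using l2norm_IFT[OF nice_cc[OF ec]] free_evol_l2(2)[OF l2_cc[OF b]] by (simp flip: l2norm_sq)
  have bb: "cmod (\<integral>x. cis (- (y \<bullet> v x)) * of_real ((cmod (IFT (free_evol t b) x))\<^sup>2) \<partial>lborel) \<le> (l2norm b)\<^sup>2" for y t and v :: "real^'n \<Rightarrow> real^'n"
    unfolding wn[of t, symmetric] by (rule order_trans[OF integral_norm_bound]) (simp add: norm_power)
  have "(\<lambda>n. \<integral>y. k y * (\<integral>x. cis (- (y \<bullet> ((1 / X n) *\<^sub>R x))) * of_real ((cmod (IFT (free_evol (X n) b) x))\<^sup>2) \<partial>lborel) \<partial>lborel)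
      \<longlonglongrightarrow> (\<integral>y. k y * (\<integral>\<xi>. cis (- (y \<bullet> ((1 / jbr \<xi>) *\<^sub>R \<xi>))) * of_real ((cmod (b \<xi>))\<^sup>2) \<partial>lborel) \<partial>lborel)"
  proof (rule integral_dominated_convergence[where w = "\<lambda>y. cmod (k y) * (l2norm b)\<^sup>2"])
    show "(\<lambda>y. k y * (\<integral>\<xi>. cis (- (y \<bullet> ((1 / jbr \<xi>) *\<^sub>R \<xi>))) * complex_of_real ((cmod (b \<xi>))\<^sup>2) \<partial>lborel)) \<in> borel_measurable lborel"
      by measurable
    show "(\<lambda>y. k y * (\<integral>x. cis (- (y \<bullet> ((1 / X n) *\<^sub>R x))) * complex_of_real ((cmod (IFT (free_evol (X n) b) x))\<^sup>2) \<partial>lborel)) \<in> borel_measurable lborel" for n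
      by measurable
    show "integrable lborel (\<lambda>y. cmod (k y) * (l2norm b)\<^sup>2)" using k by simp
    show "AE y in lborel. norm (k y * (\<integral>x. cis (- (y \<bullet> ((1 / X n) *\<^sub>R x))) * complex_of_real ((cmod (IFT (free_evol (X n) b) x))\<^sup>2) \<partial>lborel))
        \<le> cmod (k y) * (l2norm b)\<^sup>2" for n
      using bb[of _ "\<lambda>x. (1 / X n) *\<^sub>R x" "X n"] by (intro AE_I2) (simp add: norm_mult mult_left_mono)
    show "AE y in lborel. (\<lambda>n. k y * (\<integral>x. cis (- (y \<bullet> ((1 / X n) *\<^sub>R x))) * complex_of_real ((cmod (IFT (free_evol (X n) b) x))\<^sup>2) \<partial>lborel))
        \<longlonglongrightarrow> k y * (\<integral>\<xi>. cis (- (y \<bullet> ((1 / jbr \<xi>) *\<^sub>R \<xi>))) * complex_of_real ((cmod (b \<xi>))\<^sup>2) \<partial>lborel)"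
    proof (intro AE_I2 tendsto_mult tendsto_const)
      fix y :: "real^'n"
      have 1: "x \<bullet> ((1 / X n) *\<^sub>R (- y)) = - (y \<bullet> ((1 / X n) *\<^sub>R x))" for x n
        by (simp add: inner_commute)
      have 2: "((1 / jbr \<xi>) *\<^sub>R \<xi>) \<bullet> (- y) = - (y \<bullet> ((1 / jbr \<xi>) *\<^sub>R \<xi>))" for \<xi>
        by (simp add: inner_commute)
      show "(\<lambda>n. \<integral>x. cis (- (y \<bullet> ((1 / X n) *\<^sub>R x))) * complex_of_real ((cmod (IFT (free_evol (X n) b) x))\<^sup>2) \<partial>lborel)
        \<longlonglongrightarrow> (\<integral>\<xi>. cis (- (y \<bullet> ((1 / jbr \<xi>) *\<^sub>R \<xi>))) * complex_of_real ((cmod (b \<xi>))\<^sup>2) \<partial>lborel)"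
        using velocity_char_limit[OF b X, of "- y"] unfolding 1 2 .
    qed
  qed
  then show ?thesis
    by (subst FT_superposition[OF k l2_integrable[OF wl]], measurable)
       (subst FT_superposition[OF k l2_integrable[OF l2_cc[OF b]]], measurable, intro tendsto_mult tendsto_const)
qed

section \<open>From characters to continuous observables of bounded support\<close>

lemma cc_uniformly_continuous:
  fixes Q :: "real^'n::finite \<Rightarrow> complex"
  assumes Q: "continuous_on UNIV Q" "bounded {x. Q x \<noteq> 0}" and e: "0 < e"
  obtains d where "0 < d" "\<And>v h. norm h < d \<Longrightarrow> cmod (Q (v + h) - Q v) < e"
proof -
  obtain R where R: "\<And>x. Q x \<noteq> 0 \<Longrightarrow> norm x \<le> R" "0 < R" using cc_bound[OF Q] by metis
  have "uniformly_continuous_on (cball 0 (R + 2)) Q"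
    by (rule compact_uniformly_continuous[OF continuous_on_subset[OF Q(1)]]) auto
  then obtain d where d: "0 < d" "\<And>x x'. x \<in> cball 0 (R + 2) \<Longrightarrow> x' \<in> cball 0 (R + 2) \<Longrightarrow> dist x' x < d \<Longrightarrow> dist (Q x') (Q x) < e"
    using e unfolding uniformly_continuous_on_def by metis
  have "cmod (Q (v + h) - Q v) < e" if h: "norm h < min d 1" for v h
  proof (cases "norm v \<le> R + 1")
    case True
    have "norm (v + h) \<le> R + 2" using norm_triangle_ineq[of v h] True h by simp
    then have "v + h \<in> cball 0 (R + 2)" "v \<in> cball 0 (R + 2)" using True by simp_all
    moreover have "dist (v + h) v < d" using h by (simp add: dist_norm)
    ultimately have "dist (Q (v + h)) (Q v) < e" by (intro d(2))
    then show ?thesis by (simp only: dist_norm)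
  next
    case False
    have "norm v \<le> norm (v + h) + norm h" using norm_triangle_ineq4[of "v + h" h] by simp
    then have "\<not> norm (v + h) \<le> R" "\<not> norm v \<le> R" using False h by auto
    then have "Q (v + h) = 0" "Q v = 0" using R(1) by blast+
    then show ?thesis using e by simp
  qed
  then show thesis using that[of "min d 1"] d(1) by simp
qed

text \<open>Displacements \<delta> z shorter than \<open>d\<close> are controlled by uniform
  continuity, the others by the Gaussian tail.\<close>

lemma gauss_smooth_uniform:
  fixes Q :: "real^'n::finite \<Rightarrow> complex"
  assumes Q: "continuous_on UNIV Q" "bounded {x. Q x \<noteq> 0}" and e: "0 < e"
  obtains \<delta> where "0 < \<delta>" "\<And>v. cmod (gauss_smooth \<delta> Q v - Q v) \<le> e"
proof -
  obtain B where B: "\<And>x. cmod (Q x) \<le> B" "0 \<le> B" using cc_bound[OF Q] by metis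
  have [measurable]: "Q \<in> borel_measurable borel" using borel_measurable_cont[OF Q(1)] by simp
  obtain d where d: "0 < d" "\<And>v h. norm h < d \<Longrightarrow> cmod (Q (v + h) - Q v) < e / 2"
    using cc_uniformly_continuous[OF Q, of "e / 2"] e by auto
  \<comment> \<open>With \<delta> = 1 / (n + 1) the displacement \<delta> z reaches length
    \<open>d\<close> exactly where this indicator switches on.\<close>
  define tail where "tail n z = gauss z * indicator {z. real (Suc n) * d \<le> norm z} z" for n and z :: "real^'n"
  have tm [measurable]: "tail n \<in> borel_measurable borel" for n unfolding tail_def by measurable
  have tb: "norm (tail n z) \<le> gauss z" for n z using gauss_nonneg[of z] by (simp add: tail_def indicator_def)
  have ti: "integrable lborel (tail n)" for n
    by (rule Bochner_Integration.integrable_bound[OF gauss_integrable])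
       (use order_trans[OF tb abs_ge_self] in \<open>auto intro!: AE_I2\<close>)
  have "(\<lambda>n. \<integral>z. tail n z \<partial>lborel) \<longlonglongrightarrow> (\<integral>z. 0 \<partial>(lborel :: (real^'n) measure))"
  proof (rule integral_dominated_convergence[OF _ _ gauss_integrable])
    show "AE z in lborel. (\<lambda>n. tail n z) \<longlonglongrightarrow> 0"
    proof (rule AE_I2, rule tendsto_eventually)
      fix z :: "real^'n"
      obtain N where N: "norm z / d < real N" using reals_Archimedean2 by blast
      show "\<forall>\<^sub>F n in sequentially. tail n z = 0"
        using eventually_ge_at_top[of N]
      proof eventually_elim
        case (elim n)
        have "norm z < real N * d" using N d(1) by (simp add: pos_divide_less_eq)
        also have "\<dots> \<le> real (Suc n) * d" using elim d(1) by (intro mult_right_mono) auto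
        finally show ?case by (simp add: tail_def)
      qed
    qed
    show "AE z in lborel. norm (tail n z) \<le> gauss z" for n using tb by simp
  qed auto
  then have lim: "(\<lambda>n. \<integral>z. tail n z \<partial>lborel) \<longlonglongrightarrow> 0" by simp
  \<comment> \<open>The oscillation of \<open>Q\<close> is at most 2 B, so this tail mass costs at
    most e / 2; the summand 1 covers B = 0.\<close>
  have "0 < e / (4 * (B + 1))" using e B(2) by simp
  from eventually_happens'[OF sequentially_bot order_tendstoD(2)[OF lim this]]
  obtain n where n: "(\<integral>z. tail n z \<partial>lborel) < e / (4 * (B + 1))" by blast
  define \<delta> where "\<delta> = 1 / real (Suc n)"
  have \<delta>: "0 < \<delta>" by (simp add: \<delta>_def)
  have "cmod (gauss_smooth \<delta> Q v - Q v) \<le> e" for v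
  proof -
    have i1: "integrable lborel (\<lambda>z. complex_of_real (gauss z) * Q (v + \<delta> *\<^sub>R z))"
      by (rule gauss_mult_integrable[where B = B]) (use B in auto)
    have i2: "integrable lborel (\<lambda>z::real^'n. complex_of_real (gauss z) * Q v)"
      by (intro integrable_mult_left integrable_of_real gauss_integrable)
    have "(\<integral>z. complex_of_real (gauss z) * Q v \<partial>(lborel :: (real^'n) measure)) = Q v"
      using gauss_integral[where 'n = 'n] by simp
    then have "gauss_smooth \<delta> Q v - Q v = (\<integral>z. complex_of_real (gauss z) * Q (v + \<delta> *\<^sub>R z) - complex_of_real (gauss z) * Q v \<partial>lborel)"
      using i1 i2 by (simp add: gauss_smooth_def)
    then have "cmod (gauss_smooth \<delta> Q v - Q v) \<le> (\<integral>z. cmod (complex_of_real (gauss z) * Q (v + \<delta> *\<^sub>R z) - complex_of_real (gauss z) * Q v) \<partial>lborel)"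
      by (simp only: integral_norm_bound)
    also have "\<dots> \<le> (\<integral>z. e / 2 * gauss z + 2 * B * tail n z \<partial>(lborel :: (real^'n) measure))"
    proof (rule integral_mono)
      show "integrable lborel (\<lambda>z. cmod (complex_of_real (gauss z) * Q (v + \<delta> *\<^sub>R z) - complex_of_real (gauss z) * Q v))"
        using i1 i2 by (intro integrable_norm Bochner_Integration.integrable_diff)
      show "integrable lborel (\<lambda>z::real^'n. e / 2 * gauss z + 2 * B * tail n z)"
        by (intro Bochner_Integration.integrable_add integrable_mult_right ti gauss_integrable)
      fix z :: "real^'n"
      have eq: "cmod (complex_of_real (gauss z) * Q (v + \<delta> *\<^sub>R z) - complex_of_real (gauss z) * Q v) = gauss z * cmod (Q (v + \<delta> *\<^sub>R z) - Q v)"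
        unfolding right_diff_distrib[symmetric] using gauss_nonneg[of z] by (simp add: norm_mult)
      show "cmod (complex_of_real (gauss z) * Q (v + \<delta> *\<^sub>R z) - complex_of_real (gauss z) * Q v) \<le> e / 2 * gauss z + 2 * B * tail n z"
      proof (cases "norm z < real (Suc n) * d")
        case True
        then have "norm (\<delta> *\<^sub>R z) < d" by (simp add: \<delta>_def pos_divide_less_eq mult.commute del: of_nat_Suc)
        then have "gauss z * cmod (Q (v + \<delta> *\<^sub>R z) - Q v) \<le> gauss z * (e / 2)"
          using d(2)[of "\<delta> *\<^sub>R z" v] gauss_nonneg[of z] by (intro mult_left_mono) auto
        moreover have "0 \<le> 2 * B * tail n z" using B(2) gauss_nonneg[of z] by (simp add: tail_def)
        ultimately show ?thesis unfolding eq by (simp only: mult.commute[of "gauss z" "e / 2"])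
      next
        case False
        have "cmod (Q (v + \<delta> *\<^sub>R z) - Q v) \<le> 2 * B"
          using norm_triangle_ineq4[of "Q (v + \<delta> *\<^sub>R z)" "Q v"] B(1)[of "v + \<delta> *\<^sub>R z"] B(1)[of v] by linarith
        then have "gauss z * cmod (Q (v + \<delta> *\<^sub>R z) - Q v) \<le> gauss z * (2 * B)"
          using gauss_nonneg[of z] by (intro mult_left_mono) auto
        moreover have "tail n z = gauss z" using False by (simp add: tail_def)
        moreover have "0 \<le> e / 2 * gauss z" using e gauss_nonneg[of z] by simp
        ultimately show ?thesis unfolding eq by (simp only: mult.commute[of "gauss z" "2 * B"]) 
      qed
    qed
    also have "\<dots> = (\<integral>z. e / 2 * gauss z \<partial>(lborel :: (real^'n) measure)) + (\<integral>z. 2 * B * tail n z \<partial>lborel)"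
      by (intro Bochner_Integration.integral_add integrable_mult_right ti gauss_integrable)
    also have "\<dots> = e / 2 + 2 * B * (\<integral>z. tail n z \<partial>lborel)"
      unfolding integral_mult_right_zero gauss_integral by simp
    also have "\<dots> \<le> e / 2 + 2 * B * (e / (4 * (B + 1)))"
      using n B(2) by (intro add_left_mono mult_left_mono) auto
    also have "2 * B * (e / (4 * (B + 1))) \<le> e / 2"
    proof -
      have "2 * B * (e / (4 * (B + 1))) = e / 2 * (B / (B + 1))"
        using B(2) by (simp add: field_simps)
      also have "\<dots> \<le> e / 2 * 1" using e B(2) by (intro mult_left_mono) auto
      finally show ?thesis by simp
    qed
    finally show ?thesis by simp
  qed
  then show thesis using that \<delta> by blast
qed

lemma bounded_mult_integrable:
  fixes \<rho> :: "real^'n::finite \<Rightarrow> real"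
  assumes f: "f \<in> borel_measurable borel" "\<And>x. cmod (f x) \<le> B" and \<rho>: "integrable lborel \<rho>" "\<And>x. 0 \<le> \<rho> x"
  shows "integrable lborel (\<lambda>x. f x * complex_of_real (\<rho> x))"
    and "cmod (\<integral>x. f x * complex_of_real (\<rho> x) \<partial>lborel) \<le> B * (\<integral>x. \<rho> x \<partial>lborel)"
proof -
  have le: "cmod (f x * complex_of_real (\<rho> x)) \<le> B * \<rho> x" for x
    using f(2)[of x] \<rho>(2)[of x] by (simp add: norm_mult mult_right_mono)
  have B\<rho>: "integrable lborel (\<lambda>x. B * \<rho> x)" using \<rho>(1) by simp
  show i: "integrable lborel (\<lambda>x. f x * complex_of_real (\<rho> x))"
  proof (rule Bochner_Integration.integrable_bound[OF B\<rho>])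
    show "(\<lambda>x. f x * complex_of_real (\<rho> x)) \<in> borel_measurable lborel" using f(1) \<rho>(1) by simp
    show "AE x in lborel. norm (f x * complex_of_real (\<rho> x)) \<le> norm (B * \<rho> x)"
      using order_trans[OF le abs_ge_self] by (intro AE_I2) simp
  qed
  have "cmod (\<integral>x. f x * complex_of_real (\<rho> x) \<partial>lborel) \<le> (\<integral>x. cmod (f x * complex_of_real (\<rho> x)) \<partial>lborel)"
    by (rule integral_norm_bound)
  also have "\<dots> \<le> (\<integral>x. B * \<rho> x \<partial>lborel)"
    by (rule integral_mono[OF integrable_norm[OF i] B\<rho> le])
  finally show "cmod (\<integral>x. f x * complex_of_real (\<rho> x) \<partial>lborel) \<le> B * (\<integral>x. \<rho> x \<partial>lborel)" by simp
qed

text \<open>\<open>Q\<close> is replaced by its Gaussian average. This average is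
  \<open>FT k\<close> for the damped inverse transform \<open>k\<close>, which is integrable even
  though \<open>IFT Q\<close> itself need not be. The error is \<epsilon> times the conserved mass,
  both along the evolution and in the limit, where \<open>Q\<close> contributes nothing.\<close>

lemma velocity_support_vanish:
  fixes b Q :: "real^'n::finite \<Rightarrow> complex"
  assumes b: "continuous_on UNIV b" "bounded {x. b x \<noteq> 0}" and Q: "continuous_on UNIV Q" "bounded {x. Q x \<noteq> 0}"
    and X: "filterlim X at_top sequentially" and 0: "\<And>\<xi>. Q ((1 / jbr \<xi>) *\<^sub>R \<xi>) * b \<xi> = 0"
  shows "(\<lambda>n. \<integral>x. Q ((1 / X n) *\<^sub>R x) * of_real ((cmod (IFT (free_evol (X n) b) x))\<^sup>2) \<partial>lborel) \<longlonglongrightarrow> 0"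
proof (rule LIMSEQ_I)
  fix e :: real assume e: "0 < e"
  define N where "N = (l2norm b)\<^sup>2"
  have N0: "0 \<le> N" by (simp add: N_def)
  \<comment> \<open>The limit integral is at most \<epsilon> N <= e / 4, hence the integrals are
    eventually below e / 2; replacing \<open>FT k\<close> by \<open>Q\<close> costs another e /
    4.\<close>
  define \<epsilon> where "\<epsilon> = e / (4 * (N + 1))"
  have \<epsilon>: "0 < \<epsilon>" using e N0 by (simp add: \<epsilon>_def)
  have \<epsilon>N: "\<epsilon> * N \<le> e / 4"
  proof -
    have "\<epsilon> * N = e / 4 * (N / (N + 1))" using N0 by (simp add: \<epsilon>_def field_simps)
    also have "\<dots> \<le> e / 4 * 1" using e N0 by (intro mult_left_mono) auto
    finally show ?thesis by simp
  qed
  obtain \<delta> where \<delta>: "0 < \<delta>" "\<And>v. cmod (gauss_smooth \<delta> Q v - Q v) \<le> \<epsilon>"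
    using gauss_smooth_uniform[OF Q \<epsilon>] by metis
  have Qi: "integrable lborel Q" by (rule integrable_cc[OF Q])
  have [measurable]: "Q \<in> borel_measurable borel" using Qi by simp
  have [measurable]: "(jbr :: real^'n \<Rightarrow> real) \<in> borel_measurable borel"
    by (rule borel_measurable_continuous_onI[OF jbr_continuous])
  obtain B where B: "\<And>x. cmod (Q x) \<le> B" using cc_bound[OF Q] by metis
  define k where "k x = IFT Q x * complex_of_real (gauss_reg \<delta> x)" for x
  have ki: "integrable lborel k"
  proof (rule Bochner_Integration.integrable_bound)
    show "integrable lborel (\<lambda>x::real^'n. fourier_const TYPE('n) * (\<integral>\<xi>. cmod (Q \<xi>) \<partial>lborel) * gauss_reg \<delta> x)"
      using \<delta> by (intro integrable_mult_right gauss_reg_integrable) simp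
    show "k \<in> borel_measurable lborel" unfolding k_def by measurable
    show "AE x in lborel. norm (k x) \<le> norm (fourier_const TYPE('n) * (\<integral>\<xi>. cmod (Q \<xi>) \<partial>lborel) * gauss_reg \<delta> x)"
      using gauss_reg_bounds[of \<delta>] order_trans[OF IFT_bound[of Q] abs_ge_self]
      by (intro AE_I2) (auto simp: k_def norm_mult abs_mult intro!: mult_right_mono)
  qed
  have FTk: "FT k v = gauss_smooth \<delta> Q v" for v
    unfolding k_def[abs_def] by (rule FT_IFT_gauss_reg[OF Qi \<delta>(1)])
  have FTm [measurable]: "FT k \<in> borel_measurable borel" using ki by (intro FT_measurable) simp
  define w where "w n x = (cmod (IFT (free_evol (X n) b) x))\<^sup>2" for n x
  note ec = free_evol_cc[OF b]
  have wl: "l2 (IFT (free_evol t b))" for t by (rule IFT_isometry(1)[OF nice_cc[OF ec] nice_cc[OF ec]])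
  have wi: "integrable lborel (w n)" "\<And>x. 0 \<le> w n x" for n
    unfolding w_def using l2_integrable[OF wl] by auto
  have wn: "(\<integral>x. w n x \<partial>lborel) = N" for n
    unfolding w_def N_def
    using l2norm_IFT[OF nice_cc[OF ec]] free_evol_l2(2)[OF l2_cc[OF b]] by (simp flip: l2norm_sq)
  have bi: "integrable lborel (\<lambda>\<xi>. (cmod (b \<xi>))\<^sup>2)" "\<And>\<xi>. 0 \<le> (cmod (b \<xi>))\<^sup>2"
    using l2_integrable[OF l2_cc[OF b]] by auto
  have lim: "(\<lambda>n. \<integral>x. FT k ((1 / X n) *\<^sub>R x) * of_real (w n x) \<partial>lborel) \<longlonglongrightarrow>
      (\<integral>\<xi>. FT k ((1 / jbr \<xi>) *\<^sub>R \<xi>) * of_real ((cmod (b \<xi>))\<^sup>2) \<partial>lborel)"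
    unfolding w_def by (rule velocity_FT_limit[OF b X ki])
  have lim0: "cmod (\<integral>\<xi>. FT k ((1 / jbr \<xi>) *\<^sub>R \<xi>) * of_real ((cmod (b \<xi>))\<^sup>2) \<partial>lborel) \<le> \<epsilon> * N"
  proof -
    \<comment> \<open>Wherever \<open>b\<close> is nonzero \<open>Q\<close> vanishes at the
      corresponding velocity, so it can be subtracted without changing the integrand, leaving only
      the uniform error.\<close>
    have eq: "FT k ((1 / jbr \<xi>) *\<^sub>R \<xi>) * complex_of_real ((cmod (b \<xi>))\<^sup>2) =
       (FT k ((1 / jbr \<xi>) *\<^sub>R \<xi>) - Q ((1 / jbr \<xi>) *\<^sub>R \<xi>)) * complex_of_real ((cmod (b \<xi>))\<^sup>2)" for \<xi>
    proof -
      have "Q ((1 / jbr \<xi>) *\<^sub>R \<xi>) * complex_of_real ((cmod (b \<xi>))\<^sup>2) = 0" using 0[of \<xi>] by auto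
      then show ?thesis by (simp only: left_diff_distrib diff_zero)
    qed
    show ?thesis
      unfolding eq N_def l2norm_sq
      by (rule bounded_mult_integrable(2)[OF _ _ bi]) (use \<delta>(2) in \<open>auto simp: FTk[symmetric]\<close>)
  qed
  have diff: "cmod (\<integral>x. Q ((1 / X n) *\<^sub>R x) * of_real (w n x) \<partial>lborel) \<le> cmod (\<integral>x. FT k ((1 / X n) *\<^sub>R x) * of_real (w n x) \<partial>lborel) + \<epsilon> * N" for n
  proof -
    have FTb: "cmod (FT k v) \<le> fourier_const TYPE('n) * (\<integral>\<xi>. cmod (k \<xi>) \<partial>lborel)" for v by (rule FT_bound)
    have i1: "integrable lborel (\<lambda>x. FT k ((1 / X n) *\<^sub>R x) * complex_of_real (w n x))"
      by (rule bounded_mult_integrable(1)[OF _ FTb wi]) measurable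
    have i2: "integrable lborel (\<lambda>x. Q ((1 / X n) *\<^sub>R x) * complex_of_real (w n x))"
      by (rule bounded_mult_integrable(1)[OF _ B wi]) measurable
    have "cmod (\<integral>x. (FT k ((1 / X n) *\<^sub>R x) - Q ((1 / X n) *\<^sub>R x)) * of_real (w n x) \<partial>lborel) \<le> \<epsilon> * (\<integral>x. w n x \<partial>lborel)"
      by (rule bounded_mult_integrable(2)[OF _ _ wi]) (use \<delta>(2) in \<open>auto simp: FTk[symmetric]\<close>)
    then have "cmod ((\<integral>x. FT k ((1 / X n) *\<^sub>R x) * of_real (w n x) \<partial>lborel) - (\<integral>x. Q ((1 / X n) *\<^sub>R x) * of_real (w n x) \<partial>lborel)) \<le> \<epsilon> * N"
      using i1 i2 by (simp add: left_diff_distrib wn)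
    then show ?thesis
      using norm_triangle_ineq2[of "\<integral>x. Q ((1 / X n) *\<^sub>R x) * of_real (w n x) \<partial>lborel" "\<integral>x. FT k ((1 / X n) *\<^sub>R x) * of_real (w n x) \<partial>lborel"]
      by (simp add: norm_minus_commute)
  qed
  have "\<forall>\<^sub>F n in sequentially. cmod (\<integral>x. FT k ((1 / X n) *\<^sub>R x) * of_real (w n x) \<partial>lborel) < e / 2"
  proof (rule order_tendstoD(2)[OF tendsto_norm[OF lim]])
    show "cmod (\<integral>\<xi>. FT k ((1 / jbr \<xi>) *\<^sub>R \<xi>) * of_real ((cmod (b \<xi>))\<^sup>2) \<partial>lborel) < e / 2"
      using lim0 \<epsilon>N e by linarith
  qed
  then obtain n0 where n0: "\<And>n. n \<ge> n0 \<Longrightarrow> cmod (\<integral>x. FT k ((1 / X n) *\<^sub>R x) * of_real (w n x) \<partial>lborel) < e / 2"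
    unfolding eventually_sequentially by blast
  have "norm ((\<integral>x. Q ((1 / X n) *\<^sub>R x) * of_real (w n x) \<partial>lborel) - 0) < e" if "n \<ge> n0" for n
    using diff[of n] n0[OF that] \<epsilon>N e unfolding diff_zero by linarith
  then show "\<exists>no. \<forall>n\<ge>no. norm ((\<integral>x. Q ((1 / X n) *\<^sub>R x) * of_real ((cmod (IFT (free_evol (X n) b) x))\<^sup>2) \<partial>lborel) - 0) < e"
    unfolding w_def by blast
qed

lemma bounded_norm_sq_support:
  fixes g :: "real \<Rightarrow> complex"
  assumes "bounded {s. g s \<noteq> 0}"
  shows "bounded {x :: 'a::real_normed_vector. g ((norm x)\<^sup>2) \<noteq> 0}"
proof -
  obtain R where R: "\<And>s. g s \<noteq> 0 \<Longrightarrow> \<bar>s\<bar> \<le> R" using assms by (auto simp: bounded_iff)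
  have "norm x \<le> sqrt R" if "g ((norm x)\<^sup>2) \<noteq> 0" for x :: 'a
    using R[OF that] by (intro real_le_rsqrt) simp
  then show ?thesis by (auto simp: bounded_iff)
qed

text \<open>The squared norm is the average of |g(|v|^2)|^2 over the law of x / t. At the velocity
  \<xi> / \<open>jbr \<xi>\<close> the argument of \<open>g\<close> becomes the symbol of
  \<Theta>^2, which links the two cutoffs.\<close>

lemma velocity_localization_free:
  fixes b :: "real^'n::finite \<Rightarrow> complex" and g :: "real \<Rightarrow> complex"
  assumes b: "continuous_on UNIV b" "bounded {x. b x \<noteq> 0}" and g: "continuous_on UNIV g" "bounded {s. g s \<noteq> 0}"
    and X: "filterlim X at_top sequentially"
    and 0: "\<And>\<xi>. g ((norm \<xi>)\<^sup>2 / (1 + (norm \<xi>)\<^sup>2)) * b \<xi> = 0"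
  shows "(\<lambda>n. l2norm (\<lambda>x. g ((norm x)\<^sup>2 / (X n)\<^sup>2) * IFT (free_evol (X n) b) x)) \<longlonglongrightarrow> 0"
proof -
  define Q where "Q v = complex_of_real ((cmod (g ((norm v)\<^sup>2)))\<^sup>2)" for v :: "real^'n"
  have Q: "continuous_on UNIV Q" "bounded {x. Q x \<noteq> 0}"
  proof -
    have "continuous_on UNIV (\<lambda>v::real^'n. g ((norm v)\<^sup>2))"
      by (rule continuous_on_compose2[OF g(1)]) (auto intro: continuous_intros)
    then show "continuous_on UNIV Q" unfolding Q_def by (intro continuous_intros)
    show "bounded {x. Q x \<noteq> 0}"
      using bounded_norm_sq_support[OF g(2)] by (simp add: Q_def)
  qed
  have Q0: "Q ((1 / jbr \<xi>) *\<^sub>R \<xi>) * b \<xi> = 0" for \<xi>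
  proof -
    have "(norm ((1 / jbr \<xi>) *\<^sub>R \<xi>))\<^sup>2 = (norm \<xi>)\<^sup>2 / (1 + (norm \<xi>)\<^sup>2)"
      by (simp add: power_divide jbr_sq)
    then show ?thesis using 0[of \<xi>] by (auto simp: Q_def)
  qed
  have eq: "complex_of_real ((l2norm (\<lambda>x. g ((norm x)\<^sup>2 / t\<^sup>2) * IFT (free_evol t b) x))\<^sup>2)
      = (\<integral>x. Q ((1 / t) *\<^sub>R x) * of_real ((cmod (IFT (free_evol t b) x))\<^sup>2) \<partial>lborel)" for t
    unfolding l2norm_sq integral_complex_of_real[symmetric]
    by (intro Bochner_Integration.integral_cong refl) (simp add: Q_def norm_mult power_mult_distrib power_divide)
  have "(\<lambda>n. complex_of_real ((l2norm (\<lambda>x. g ((norm x)\<^sup>2 / (X n)\<^sup>2) * IFT (free_evol (X n) b) x))\<^sup>2)) \<longlonglongrightarrow> complex_of_real 0"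
    unfolding eq using velocity_support_vanish[OF b Q X Q0] by simp
  then have "(\<lambda>n. (l2norm (\<lambda>x. g ((norm x)\<^sup>2 / (X n)\<^sup>2) * IFT (free_evol (X n) b) x))\<^sup>2) \<longlonglongrightarrow> 0"
    by (simp only: tendsto_of_real_iff)
  then have "(\<lambda>n. sqrt ((l2norm (\<lambda>x. g ((norm x)\<^sup>2 / (X n)\<^sup>2) * IFT (free_evol (X n) b) x))\<^sup>2)) \<longlonglongrightarrow> sqrt 0"
    by (rule tendsto_real_sqrt)
  then show ?thesis by simp
qed

text \<open>Boundedness of \<open>m\<close> and \<open>g\<close> allows the profile to be replaced
  by a test function \<open>a\<close>. The product \<open>m \<xi> * a \<xi>\<close> stays continuous
  with bounded support and inherits the disjointness from \<open>g\<close>, so the free result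
  applies to it.\<close>

lemma velocity_localization:
  fixes \<Psi> W :: "real \<Rightarrow> real^'n::finite \<Rightarrow> complex" and g :: "real \<Rightarrow> complex"
  assumes \<Psi>: "\<And>t. 0 \<le> t \<Longrightarrow> l2 (\<Psi> t)"
    and asym: "\<And>\<epsilon>. 0 < \<epsilon> \<Longrightarrow> \<exists>a T. test_fun a \<and> 0 \<le> T \<and> (\<forall>t\<ge>T. l2norm (\<lambda>\<xi>. \<Psi> t \<xi> - free_evol t a \<xi>) \<le> \<epsilon>)"
    and m: "continuous_on UNIV m" "\<And>\<xi>. cmod (m \<xi>) \<le> Bm"
    and W: "\<And>t. 0 \<le> t \<Longrightarrow> ftpair (W t) (\<lambda>\<xi>. m \<xi> * \<Psi> t \<xi>)"
    and g: "continuous_on UNIV g" "bounded {s. g s \<noteq> 0}" "\<And>s. cmod (g s) \<le> Bg"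
    and 0: "\<And>\<xi>. g ((norm \<xi>)\<^sup>2 / (1 + (norm \<xi>)\<^sup>2)) * m \<xi> = 0"
  shows "((\<lambda>t. l2norm (\<lambda>x. g ((norm x)\<^sup>2 / t\<^sup>2) * W t x)) \<longlongrightarrow> 0) at_top"
\<comment> \<open>Dominated convergence speaks of sequences, so the limit in t is tested along
  arbitrary sequences tending to infinity.\<close>
proof (rule tendsto_at_topI_sequentially)
  fix X :: "nat \<Rightarrow> real" assume X: "filterlim X at_top sequentially"
  have Bm0: "0 \<le> Bm" using order_trans[OF norm_ge_zero m(2)[of 0]] .
  have Bg0: "0 \<le> Bg" using order_trans[OF norm_ge_zero g(3)[of 0]] .
  have gm [measurable]: "g \<in> borel_measurable borel" by (rule borel_measurable_continuous_onI[OF g(1)])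
  show "(\<lambda>n. l2norm (\<lambda>x. g ((norm x)\<^sup>2 / (X n)\<^sup>2) * W (X n) x)) \<longlonglongrightarrow> 0"
  proof (rule LIMSEQ_I)
    fix e :: real assume e: "0 < e"
    \<comment> \<open>Chosen so that passing the error through both cutoffs costs at most e / 2; the
      summand 1 covers the case that a bound is 0.\<close>
    define \<epsilon> where "\<epsilon> = e / (2 * (Bg * Bm + 1))"
    have BB: "0 \<le> Bg * Bm" using Bg0 Bm0 by simp
    have \<epsilon>: "0 < \<epsilon>" using e BB by (simp add: \<epsilon>_def)
    have \<epsilon>B: "Bg * (Bm * \<epsilon>) \<le> e / 2"
    proof -
      have "Bg * (Bm * \<epsilon>) = e / 2 * (Bg * Bm / (Bg * Bm + 1))" using BB by (simp add: \<epsilon>_def field_simps)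
      also have "\<dots> \<le> e / 2 * 1" using e BB by (intro mult_left_mono) auto
      finally show ?thesis by simp
    qed
    obtain a T where a: "test_fun a" "0 \<le> T" "\<And>t. t \<ge> T \<Longrightarrow> l2norm (\<lambda>\<xi>. \<Psi> t \<xi> - free_evol t a \<xi>) \<le> \<epsilon>"
      using asym[OF \<epsilon>] by blast
    define b where "b \<xi> = m \<xi> * a \<xi>" for \<xi>
    have b: "continuous_on UNIV b" "bounded {x. b x \<noteq> 0}"
    proof -
      show "continuous_on UNIV b" unfolding b_def by (intro continuous_on_mult m(1) test_fun_cont a(1))
      show "bounded {x. b x \<noteq> 0}" by (rule bounded_subset[OF test_fun_cc(2)[OF a(1)]]) (auto simp: b_def)
    qed
    note ec = free_evol_cc[OF b]
    have b0: "g ((norm \<xi>)\<^sup>2 / (1 + (norm \<xi>)\<^sup>2)) * b \<xi> = 0" for \<xi>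
      using 0[of \<xi>] by (auto simp: b_def)
    define u where "u t = IFT (free_evol t b)" for t
    have up: "ftpair (u t) (free_evol t b)" for t unfolding u_def by (rule ftpair_IFT[OF nice_cc[OF ec]])
    have ul: "l2 (u t)" for t by (rule ftpair_l2(1)[OF up])
    have main: "l2norm (\<lambda>x. g ((norm x)\<^sup>2 / t\<^sup>2) * W t x) \<le> l2norm (\<lambda>x. g ((norm x)\<^sup>2 / t\<^sup>2) * u t x) + e / 2"
      if t: "T \<le> t" for t
    proof -
      have t0: "0 \<le> t" using t a(2) by simp
      have Wl: "l2 (W t)" by (rule ftpair_l2(1)[OF W[OF t0]])
      have "l2norm (\<lambda>x. W t x - u t x) = l2norm (\<lambda>\<xi>. m \<xi> * \<Psi> t \<xi> - free_evol t b \<xi>)"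
        by (rule ftpair_norm[OF ftpair_diff[OF W[OF t0] up]])
      \<comment> \<open>The multiplier commutes with the free evolution, so it factors out of the
        error.\<close>
      also have "(\<lambda>\<xi>. m \<xi> * \<Psi> t \<xi> - free_evol t b \<xi>) = (\<lambda>\<xi>. m \<xi> * (\<Psi> t \<xi> - free_evol t a \<xi>))"
        by (rule ext) (simp add: b_def free_evol_def algebra_simps)
      also have "l2norm \<dots> \<le> Bm * l2norm (\<lambda>\<xi>. \<Psi> t \<xi> - free_evol t a \<xi>)"
      proof (rule l2norm_mono_AE)
        show lD: "l2 (\<lambda>\<xi>. \<Psi> t \<xi> - free_evol t a \<xi>)"
          by (intro l2_diff \<Psi>[OF t0] free_evol_l2(1) test_fun_l2 a(1))
        show "(\<lambda>\<xi>. m \<xi> * (\<Psi> t \<xi> - free_evol t a \<xi>)) \<in> borel_measurable lborel"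
          using borel_measurable_cont[OF m(1)] l2_measurable[OF lD] by measurable
        show "AE \<xi> in lborel. cmod (m \<xi> * (\<Psi> t \<xi> - free_evol t a \<xi>)) \<le> Bm * cmod (\<Psi> t \<xi> - free_evol t a \<xi>)"
          using m(2) by (intro AE_I2) (simp add: norm_mult mult_right_mono)
      qed (rule Bm0)
      also have "\<dots> \<le> Bm * \<epsilon>" by (rule mult_left_mono[OF a(3)[OF t] Bm0])
      finally have d: "l2norm (\<lambda>x. W t x - u t x) \<le> Bm * \<epsilon>" .
      let ?g = "\<lambda>x::real^'n. g ((norm x)\<^sup>2 / t\<^sup>2)"
      have gbm: "?g \<in> borel_measurable lborel" by simp
      have gm2: "l2 (\<lambda>x. ?g x * v x)" if "l2 v" for v
        by (rule l2_bounded_mult[OF that gbm g(3)])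
      have lWu: "l2 (\<lambda>x. W t x - u t x)" by (intro l2_diff Wl ul)
      have "l2norm (\<lambda>x. ?g x * u t x + ?g x * (W t x - u t x)) \<le> l2norm (\<lambda>x. ?g x * u t x) + l2norm (\<lambda>x. ?g x * (W t x - u t x))"
        by (intro l2norm_triangle gm2 ul lWu)
      also have "l2norm (\<lambda>x. ?g x * (W t x - u t x)) \<le> Bg * l2norm (\<lambda>x. W t x - u t x)"
        by (rule l2norm_mono_AE[OF lWu l2_measurable[OF gm2[OF lWu]] _ Bg0])
           (use g(3) in \<open>auto intro!: AE_I2 mult_right_mono simp: norm_mult\<close>)
      also have "\<dots> \<le> Bg * (Bm * \<epsilon>)" by (rule mult_left_mono[OF d Bg0])
      also have "\<dots> \<le> e / 2" by (rule \<epsilon>B)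
      finally show ?thesis by (simp add: algebra_simps)
    qed
    have "(\<lambda>n. l2norm (\<lambda>x. g ((norm x)\<^sup>2 / (X n)\<^sup>2) * u (X n) x)) \<longlonglongrightarrow> 0"
      unfolding u_def by (rule velocity_localization_free[OF b g(1,2) X b0])
    then have "\<forall>\<^sub>F n in sequentially. l2norm (\<lambda>x. g ((norm x)\<^sup>2 / (X n)\<^sup>2) * u (X n) x) < e / 2"
      by (rule order_tendstoD(2)) (use e in simp)
    moreover have "\<forall>\<^sub>F n in sequentially. T \<le> X n" using X by (simp add: filterlim_at_top)
    ultimately have "\<forall>\<^sub>F n in sequentially. norm (l2norm (\<lambda>x. g ((norm x)\<^sup>2 / (X n)\<^sup>2) * W (X n) x) - 0) < e"
    proof eventually_elim
      case (elim n)
      then show ?case using main[of "X n"] by simp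
    qed
    then show "\<exists>no. \<forall>n\<ge>no. norm (l2norm (\<lambda>x. g ((norm x)\<^sup>2 / (X n)\<^sup>2) * W (X n) x) - 0) < e"
      unfolding eventually_sequentially .
  qed
qed

section \<open>Scattering and the proof of the theorem\<close>

lemma l2inner_free_evol: "l2inner (free_evol t a) b = l2inner a (free_evol (- t) b)"
  unfolding l2inner_def free_evol_def by (simp add: cis_cnj mult_ac)

text \<open>Transforms of test functions are dense because the transform is isometric: it is enough
  to approximate an inverse transform of \<open>C\<close>.\<close>

lemma l2_FT_test_fun_seq:
  assumes C: "l2 C"
  obtains \<phi> where "\<And>n. test_fun (\<phi> n)" "(\<lambda>n. l2norm (\<lambda>\<xi>. FT (\<phi> n) \<xi> - C \<xi>)) \<longlonglongrightarrow> 0"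
proof -
  obtain v where v: "ftpair v C" using ftpair_inverse_exists[OF C] by blast
  obtain \<phi> where \<phi>: "\<And>n. test_fun (\<phi> n)" "(\<lambda>n. l2norm (\<lambda>x. \<phi> n x - v x)) \<longlonglongrightarrow> 0"
    using l2_test_fun_seq[OF ftpair_l2(1)[OF v]] by blast
  have "l2norm (\<lambda>\<xi>. FT (\<phi> n) \<xi> - C \<xi>) = l2norm (\<lambda>x. \<phi> n x - v x)" for n
    by (rule ftpair_norm[OF ftpair_diff[OF ftpair_FT(1)[OF nice_test_fun[OF \<phi>(1)]] v], symmetric])
  then have "(\<lambda>n. l2norm (\<lambda>\<xi>. FT (\<phi> n) \<xi> - C \<xi>)) \<longlonglongrightarrow> 0"
    using \<phi>(2) by (simp only:)
  then show thesis by (rule that[OF \<phi>(1)])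
qed

lemma tempered_cis_jbr: "tempered (\<lambda>\<xi>::real^'n::finite. cis (t * jbr \<xi>))"
  by (rule tempered_bounded[where C = 1]) (auto intro!: cis_cont continuous_on_mult continuous_on_const jbr_continuous)

text \<open>Parseval moves the propagator to the frequency side, and taking its adjoint reverses the
  sign of time.\<close>

lemma U_test_inner:
  assumes u: "ftpair u U" and \<phi>: "test_fun \<phi>"
  shows "(\<integral>x. cnj (U_test t \<phi> x) * u x \<partial>lborel) = l2inner (FT \<phi>) (free_evol (- t) U)"
proof -
  have n: "nice (\<lambda>\<xi>. cis (- t * jbr \<xi>) * FT \<phi> \<xi>)"
    by (rule nice_tempered_FT[OF tempered_cis_jbr \<phi>])
  have "(\<integral>x. cnj (U_test t \<phi> x) * u x \<partial>lborel) = l2inner (free_evol t (FT \<phi>)) U"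
    using ftpair_inner[OF u n] by (simp add: U_test_def mult_test_def l2inner_def free_evol_def)
  then show ?thesis by (simp add: l2inner_free_evol)
qed

text \<open>The Duhamel identity, tested in Fourier space after removing the free evolution, extends from
  test functions to all of \<open>L\<^sup>2\<close> by density.\<close>

lemma duhamel_l2:
  fixes \<Psi> NN :: "real \<Rightarrow> real^'n::finite \<Rightarrow> complex"
  assumes \<Psi>: "\<And>t. 0 \<le> t \<Longrightarrow> ftpair (\<psi> t) (\<Psi> t)" and \<Psi>0: "ftpair \<psi>0 \<Psi>0"
    and NN: "\<And>t. 0 \<le> t \<Longrightarrow> ftpair (nl t) (NN t)"
    and bd: "\<And>t. 0 \<le> t \<Longrightarrow> l2norm (nl t) \<le> \<kappa>"
    and int: "\<And>\<phi>. test_fun \<phi> \<Longrightarrow> set_integrable lborel {0..t} (\<lambda>\<tau>. \<integral>x. cnj (U_test (\<tau> - t) \<phi> x) * nl \<tau> x \<partial>lborel)"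
    and duh: "\<And>\<phi>. test_fun \<phi> \<Longrightarrow> (\<integral>x. cnj (\<phi> x) * \<psi> t x \<partial>lborel) =
          (\<integral>x. cnj (U_test (- t) \<phi> x) * \<psi>0 x \<partial>lborel)
          - \<i> * (LINT \<tau>:{0..t}|lborel. \<integral>x. cnj (U_test (\<tau> - t) \<phi> x) * nl \<tau> x \<partial>lborel)"
    and t: "0 \<le> t" and C: "l2 C"
  shows "set_integrable lborel {0..t} (\<lambda>\<tau>. l2inner C (free_evol (- \<tau>) (NN \<tau>)))"
    and "l2inner C (free_evol (- t) (\<Psi> t)) = l2inner C \<Psi>0 - \<i> * (LINT \<tau>:{0..t}|lborel. l2inner C (free_evol (- \<tau>) (NN \<tau>)))"
proof -
  \<comment> \<open>The tested formula at time t carries the evolution by \<tau> - t. Approximating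
    the evolved \<open>C\<close> compensates the t part, so the vectors \<open>Cn\<close> converge
    to \<open>C\<close> itself.\<close>
  obtain \<phi> where \<phi>: "\<And>n. test_fun (\<phi> n)" "(\<lambda>n. l2norm (\<lambda>\<xi>. FT (\<phi> n) \<xi> - free_evol t C \<xi>)) \<longlonglongrightarrow> 0"
    using l2_FT_test_fun_seq[OF free_evol_l2(1)[OF C]] by blast
  define Cn where "Cn n = free_evol (- t) (FT (\<phi> n))" for n
  have lF: "l2 (FT (\<phi> n))" for n by (rule nice_l2[OF nice_FT[OF \<phi>(1)]])
  have lCn: "l2 (Cn n)" for n unfolding Cn_def by (rule free_evol_l2(1)[OF lF])
  have lim: "(\<lambda>n. l2norm (\<lambda>\<xi>. Cn n \<xi> - C \<xi>)) \<longlonglongrightarrow> 0"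
  proof -
    have "l2norm (\<lambda>\<xi>. Cn n \<xi> - C \<xi>) = l2norm (\<lambda>\<xi>. FT (\<phi> n) \<xi> - free_evol t C \<xi>)" for n
    proof -
      have "(\<lambda>\<xi>. Cn n \<xi> - C \<xi>) = free_evol (- t) (\<lambda>\<xi>. FT (\<phi> n) \<xi> - free_evol t C \<xi>)"
      proof
        fix \<xi> :: "real^'n"
        have "free_evol (- t) (free_evol t C) \<xi> = C \<xi>"
          unfolding free_evol_add by (simp add: free_evol_def)
        then show "Cn n \<xi> - C \<xi> = free_evol (- t) (\<lambda>\<xi>. FT (\<phi> n) \<xi> - free_evol t C \<xi>) \<xi>"
          by (simp add: Cn_def free_evol_diff)
      qed
      then show ?thesis
        using free_evol_l2(2)[OF l2_diff[OF lF free_evol_l2(1)[OF C]]] by simp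
    qed
    then show ?thesis using \<phi>(2) by simp
  qed
  define J where "J c \<tau> = l2inner c (free_evol (- \<tau>) (NN \<tau>))" for c \<tau>
  have lN: "l2 (free_evol (- \<tau>) (NN \<tau>))" "l2norm (free_evol (- \<tau>) (NN \<tau>)) \<le> \<kappa>" if "0 \<le> \<tau>" for \<tau>
  proof -
    have l: "l2 (NN \<tau>)" by (rule ftpair_l2(2)[OF NN[OF that]])
    show "l2 (free_evol (- \<tau>) (NN \<tau>))" by (rule free_evol_l2(1)[OF l])
    show "l2norm (free_evol (- \<tau>) (NN \<tau>)) \<le> \<kappa>"
      using free_evol_l2(2)[OF l] bd[OF that] ftpair_norm[OF NN[OF that]] by simp
  qed
  have inner: "(\<integral>x. cnj (U_test (\<tau> - t) (\<phi> n) x) * nl \<tau> x \<partial>lborel) = J (Cn n) \<tau>" if "0 \<le> \<tau>" for \<tau> n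
    unfolding U_test_inner[OF NN[OF that] \<phi>(1)] J_def Cn_def l2inner_free_evol free_evol_add by simp
  have E: "indicator {0..t} \<tau> *\<^sub>R (\<integral>x. cnj (U_test (\<tau> - t) (\<phi> n) x) * nl \<tau> x \<partial>lborel) = indicator {0..t} \<tau> *\<^sub>R J (Cn n) \<tau>" for \<tau> n
    by (cases "\<tau> \<in> {0..t}") (simp_all add: inner)
  have Ji: "integrable lborel (\<lambda>\<tau>. indicator {0..t} \<tau> *\<^sub>R J (Cn n) \<tau>)" for n
    using int[OF \<phi>(1)[of n]] unfolding set_integrable_def E .
  have JI: "(LINT \<tau>:{0..t}|lborel. \<integral>x. cnj (U_test (\<tau> - t) (\<phi> n) x) * nl \<tau> x \<partial>lborel) = (\<integral>\<tau>. indicator {0..t} \<tau> *\<^sub>R J (Cn n) \<tau> \<partial>lborel)" for n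
    unfolding set_lebesgue_integral_def E ..
  \<comment> \<open>Convergent norms are bounded, which gives a dominating constant independent of n
    and \<tau>.\<close>
  have "Bseq (\<lambda>n. l2norm (Cn n))"
    by (rule convergent_imp_Bseq[OF convergentI[OF l2norm_tendsto[OF lCn C lim]]])
  then obtain S where "\<And>n. norm (l2norm (Cn n)) \<le> S" unfolding Bseq_def by blast
  then have S: "\<And>n. l2norm (Cn n) \<le> S" by simp
  have S0: "0 \<le> S" using l2norm_nonneg S order_trans by blast
  have Jlim: "(\<lambda>n. indicator {0..t} \<tau> *\<^sub>R J (Cn n) \<tau>) \<longlonglongrightarrow> indicator {0..t} \<tau> *\<^sub>R J C \<tau>" for \<tau>
  proof (cases "\<tau> \<in> {0..t}")
    case True
    then have "0 \<le> \<tau>" by simp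
    from l2inner_tendsto_left[OF lCn C lN(1)[OF this] lim] show ?thesis
      unfolding J_def by (intro tendsto_scaleR tendsto_const)
  qed simp
  have Jbd: "norm (indicator {0..t} \<tau> *\<^sub>R J (Cn n) \<tau>) \<le> S * \<kappa> * indicator {0..t} \<tau>" for \<tau> n
  proof (cases "\<tau> \<in> {0..t}")
    case True
    then have \<tau>: "0 \<le> \<tau>" by simp
    have "norm (J (Cn n) \<tau>) \<le> l2norm (Cn n) * l2norm (free_evol (- \<tau>) (NN \<tau>))"
      unfolding J_def by (rule l2_cauchy_schwarz[OF lCn lN(1)[OF \<tau>]])
    also have "\<dots> \<le> S * \<kappa>" by (intro mult_mono S lN(2)[OF \<tau>] S0) simp
    finally show ?thesis using True by simp
  qed simp
  \<comment> \<open>Measurability in \<tau> for general \<open>C\<close> is inherited as a pointwise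
    limit from the integrability that the Duhamel formula provides for test functions.\<close>
  have Jm: "(\<lambda>\<tau>. indicator {0..t} \<tau> *\<^sub>R J C \<tau>) \<in> borel_measurable lborel"
    by (rule borel_measurable_LIMSEQ_metric[OF borel_measurable_integrable[OF Ji] Jlim])
  have wI: "integrable lborel (\<lambda>\<tau>. S * \<kappa> * indicator {0..t} \<tau>)"
    by (intro integrable_mult_right integrable_real_indicator) (auto simp: emeasure_lborel_Icc_eq)
  note dc = Jm borel_measurable_integrable[OF Ji] wI AE_I2[OF Jlim] AE_I2[OF Jbd]
  have JC: "integrable lborel (\<lambda>\<tau>. indicator {0..t} \<tau> *\<^sub>R J C \<tau>)"
    by (rule integrable_dominated_convergence[OF dc])
  have Jc: "(\<lambda>n. \<integral>\<tau>. indicator {0..t} \<tau> *\<^sub>R J (Cn n) \<tau> \<partial>lborel) \<longlonglongrightarrow> (\<integral>\<tau>. indicator {0..t} \<tau> *\<^sub>R J C \<tau> \<partial>lborel)"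
    by (rule integral_dominated_convergence[OF dc])
  show "set_integrable lborel {0..t} (\<lambda>\<tau>. l2inner C (free_evol (- \<tau>) (NN \<tau>)))"
    using JC by (simp add: set_integrable_def J_def)
  have l\<Psi>: "l2 (free_evol (- t) (\<Psi> t))" by (rule free_evol_l2(1)[OF ftpair_l2(2)[OF \<Psi>[OF t]]])
  have eqn: "l2inner (Cn n) (free_evol (- t) (\<Psi> t)) = l2inner (Cn n) \<Psi>0 - \<i> * (\<integral>\<tau>. indicator {0..t} \<tau> *\<^sub>R J (Cn n) \<tau> \<partial>lborel)" for n
  proof -
    have "(\<integral>x. cnj (\<phi> n x) * \<psi> t x \<partial>lborel) = l2inner (FT (\<phi> n)) (\<Psi> t)"
      using l2inner_test_fun_ftpair[OF \<Psi>[OF t] \<phi>(1)] by (simp add: l2inner_def)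
    also have "\<dots> = l2inner (Cn n) (free_evol (- t) (\<Psi> t))"
    proof -
      have "free_evol t (free_evol (- t) (\<Psi> t)) = \<Psi> t"
        unfolding free_evol_add by (rule ext) (simp add: free_evol_def)
      then show ?thesis unfolding Cn_def l2inner_free_evol by simp
    qed
    finally have 1: "(\<integral>x. cnj (\<phi> n x) * \<psi> t x \<partial>lborel) = l2inner (Cn n) (free_evol (- t) (\<Psi> t))" .
    have 2: "(\<integral>x. cnj (U_test (- t) (\<phi> n) x) * \<psi>0 x \<partial>lborel) = l2inner (Cn n) \<Psi>0"
      unfolding U_test_inner[OF \<Psi>0 \<phi>(1)] Cn_def l2inner_free_evol by simp
    show ?thesis using duh[OF \<phi>(1)[of n]] unfolding 1 2 JI .
  qed
  have "(\<lambda>n. l2inner (Cn n) \<Psi>0 - \<i> * (\<integral>\<tau>. indicator {0..t} \<tau> *\<^sub>R J (Cn n) \<tau> \<partial>lborel)) \<longlonglongrightarrow>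
      l2inner C \<Psi>0 - \<i> * (\<integral>\<tau>. indicator {0..t} \<tau> *\<^sub>R J C \<tau> \<partial>lborel)"
    by (intro tendsto_intros l2inner_tendsto_left[OF lCn C ftpair_l2(2)[OF \<Psi>0] lim] Jc)
  moreover have "(\<lambda>n. l2inner (Cn n) (free_evol (- t) (\<Psi> t))) \<longlonglongrightarrow> l2inner C (free_evol (- t) (\<Psi> t))"
    by (rule l2inner_tendsto_left[OF lCn C l\<Psi> lim])
  ultimately have "l2inner C (free_evol (- t) (\<Psi> t)) = l2inner C \<Psi>0 - \<i> * (\<integral>\<tau>. indicator {0..t} \<tau> *\<^sub>R J C \<tau> \<partial>lborel)"
    unfolding eqn by (rule LIMSEQ_unique[rotated])
  then show "l2inner C (free_evol (- t) (\<Psi> t)) = l2inner C \<Psi>0 - \<i> * (LINT \<tau>:{0..t}|lborel. l2inner C (free_evol (- \<tau>) (NN \<tau>)))"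
    by (simp add: set_lebesgue_integral_def J_def)
qed

lemma integral_powr_tail:
  fixes \<alpha> T t :: real
  assumes \<alpha>: "1 < \<alpha>" and T: "0 < T" "T \<le> t"
  shows "integrable lborel (\<lambda>\<tau>. \<tau> powr (- \<alpha>) * indicator {T..t} \<tau>)"
    and "(\<integral>\<tau>. \<tau> powr (- \<alpha>) * indicator {T..t} \<tau> \<partial>lborel) \<le> T powr (1 - \<alpha>) / (\<alpha> - 1)"
proof -
  have d: "DERIV (\<lambda>\<tau>. (- 1 / (\<alpha> - 1)) * \<tau> powr (1 - \<alpha>)) \<tau> :> \<tau> powr (- \<alpha>)" if "T \<le> \<tau>" for \<tau>
  proof -
    have "DERIV (\<lambda>\<tau>. (- 1 / (\<alpha> - 1)) * \<tau> powr (1 - \<alpha>)) \<tau> :> (- 1 / (\<alpha> - 1)) * ((1 - \<alpha>) * \<tau> powr (1 - \<alpha> - 1))"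
      using that T by (intro DERIV_cmult has_real_derivative_powr) simp
    moreover have "(- 1 / (\<alpha> - 1)) * ((1 - \<alpha>) * \<tau> powr (1 - \<alpha> - 1)) = ((- 1 / (\<alpha> - 1)) * (1 - \<alpha>)) * \<tau> powr (- \<alpha>)"
      by (simp only: mult.assoc) simp
    moreover have "(- 1 / (\<alpha> - 1)) * (1 - \<alpha>) = 1" using \<alpha> by (simp add: field_simps)
    ultimately show ?thesis by (simp only: mult_1_left)
  qed
  have c: "isCont (\<lambda>\<tau>. \<tau> powr (- \<alpha>)) \<tau>" if "T \<le> \<tau>" for \<tau>
    using that T by (intro continuous_intros) auto
  have "integrable lborel (\<lambda>\<tau>. indicator {T..t} \<tau> *\<^sub>R \<tau> powr (- \<alpha>))"
    using T by (intro borel_integrable_atLeastAtMost'[unfolded set_integrable_def] continuous_at_imp_continuous_on)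
      (auto intro: c)
  then show "integrable lborel (\<lambda>\<tau>. \<tau> powr (- \<alpha>) * indicator {T..t} \<tau>)"
    by (simp add: mult.commute)
  have "(\<integral>\<tau>. \<tau> powr (- \<alpha>) * indicator {T..t} \<tau> \<partial>lborel) = (- 1 / (\<alpha> - 1)) * t powr (1 - \<alpha>) - (- 1 / (\<alpha> - 1)) * T powr (1 - \<alpha>)"
    by (rule integral_FTC_Icc_real[OF T(2)]) (rule d c, assumption)+
  also have "\<dots> \<le> T powr (1 - \<alpha>) / (\<alpha> - 1)" using \<alpha> by (simp add: divide_nonneg_pos)
  finally show "(\<integral>\<tau>. \<tau> powr (- \<alpha>) * indicator {T..t} \<tau> \<partial>lborel) \<le> T powr (1 - \<alpha>) / (\<alpha> - 1)" .
qed

text \<open>The interaction-picture profiles \<open>F t\<close> are Cauchy, and a test function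
  close to \<open>F T\<close> at one late time serves for all later ones. Only scalar integrals
  appear: each difference is paired with a fixed vector before Duhamel is used, so no vector-valued
  integral is needed.\<close>

lemma duhamel_asymptotic:
  fixes \<psi> :: "real \<Rightarrow> real^'n::finite \<Rightarrow> complex"
  assumes \<Psi>: "\<And>t. 0 \<le> t \<Longrightarrow> ftpair (\<psi> t) (\<Psi> t)"
    and \<psi>0: "l2 \<psi>0" and nl: "\<And>t. 0 \<le> t \<Longrightarrow> l2 (nl t)"
    and K: "0 \<le> K" and \<alpha>: "1 < \<alpha>" and dec: "\<And>t. 0 \<le> t \<Longrightarrow> l2norm (nl t) \<le> K * jbr t powr (- \<alpha>)"
    and int: "\<And>t \<phi>. 0 \<le> t \<Longrightarrow> test_fun \<phi> \<Longrightarrow> set_integrable lborel {0..t} (\<lambda>\<tau>. \<integral>x. cnj (U_test (\<tau> - t) \<phi> x) * nl \<tau> x \<partial>lborel)"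
    and duh: "\<And>t \<phi>. 0 \<le> t \<Longrightarrow> test_fun \<phi> \<Longrightarrow> (\<integral>x. cnj (\<phi> x) * \<psi> t x \<partial>lborel) =
          (\<integral>x. cnj (U_test (- t) \<phi> x) * \<psi>0 x \<partial>lborel)
          - \<i> * (LINT \<tau>:{0..t}|lborel. \<integral>x. cnj (U_test (\<tau> - t) \<phi> x) * nl \<tau> x \<partial>lborel)"
    and \<epsilon>: "0 < \<epsilon>"
  shows "\<exists>a T. test_fun a \<and> 0 \<le> T \<and> (\<forall>t\<ge>T. l2norm (\<lambda>\<xi>. \<Psi> t \<xi> - free_evol t a \<xi>) \<le> \<epsilon>)"
proof -
  obtain \<Psi>0 where \<Psi>0: "ftpair \<psi>0 \<Psi>0" using ftpair_exists[OF \<psi>0] by blast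
  have "\<forall>t. \<exists>N. 0 \<le> t \<longrightarrow> ftpair (nl t) N"
    using ftpair_exists[OF nl] by metis
  then obtain NN where "\<forall>t. 0 \<le> t \<longrightarrow> ftpair (nl t) (NN t)"
    by metis
  then have NN: "\<And>t. 0 \<le> t \<Longrightarrow> ftpair (nl t) (NN t)" by blast
  have decK: "l2norm (nl t) \<le> K" if "0 \<le> t" for t
  proof -
    have "jbr t powr (- \<alpha>) \<le> jbr t powr 0" using \<alpha> jbr_ge_1 by (intro powr_mono) auto
    then have "K * jbr t powr (- \<alpha>) \<le> K * 1" using jbr_pos[of t] K by (intro mult_left_mono) auto
    then show ?thesis using dec[OF that] by linarith
  qed
  define J where "J C \<tau> = l2inner C (free_evol (- \<tau>) (NN \<tau>))" for C \<tau>
  define F where "F t = free_evol (- t) (\<Psi> t)" for t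
  have lF: "l2 (F t)" if "0 \<le> t" for t
    unfolding F_def by (rule free_evol_l2(1)[OF ftpair_l2(2)[OF \<Psi>[OF that]]])
  have Ji: "integrable lborel (\<lambda>\<tau>. indicator {0..t} \<tau> *\<^sub>R J C \<tau>)"
    and Jeq: "l2inner C (F t) = l2inner C \<Psi>0 - \<i> * (\<integral>\<tau>. indicator {0..t} \<tau> *\<^sub>R J C \<tau> \<partial>lborel)"
    if t: "0 \<le> t" and C: "l2 C" for t C
    using duhamel_l2[where \<psi> = \<psi> and \<Psi> = \<Psi> and ?\<psi>0.0 = \<psi>0 and nl = nl and NN = NN and \<kappa> = K and t = t and C = C,
        OF \<Psi> \<Psi>0 NN decK int[OF t] duh[OF t] t C]
    unfolding set_integrable_def set_lebesgue_integral_def J_def F_def by blast+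
  have Jbd: "cmod (J C \<tau>) \<le> l2norm C * K * \<tau> powr (- \<alpha>)" if C: "l2 C" and \<tau>: "0 < \<tau>" for C \<tau>
  proof -
    have \<tau>0: "0 \<le> \<tau>" using \<tau> by simp
    have lN: "l2 (NN \<tau>)" by (rule ftpair_l2(2)[OF NN[OF \<tau>0]])
    have "cmod (J C \<tau>) \<le> l2norm C * l2norm (free_evol (- \<tau>) (NN \<tau>))"
      unfolding J_def by (rule l2_cauchy_schwarz[OF C free_evol_l2(1)[OF lN]])
    also have "l2norm (free_evol (- \<tau>) (NN \<tau>)) = l2norm (nl \<tau>)"
      using free_evol_l2(2)[OF lN] ftpair_norm[OF NN[OF \<tau>0]] by simp
    also have "l2norm C * l2norm (nl \<tau>) \<le> l2norm C * (K * \<tau> powr (- \<alpha>))"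
    proof (intro mult_left_mono order_trans[OF dec[OF \<tau>0]] K l2norm_nonneg)
      have "\<tau> \<le> jbr \<tau>" unfolding jbr_def using \<tau> by (intro real_le_rsqrt) simp
      then show "jbr \<tau> powr (- \<alpha>) \<le> \<tau> powr (- \<alpha>)" using \<alpha> \<tau> by (intro powr_mono2') auto
    qed
    finally show ?thesis by (simp add: mult.assoc)
  qed
  have diff: "l2norm (\<lambda>\<xi>. F t \<xi> - F T \<xi>) \<le> K * (T powr (1 - \<alpha>) / (\<alpha> - 1))" if T: "0 < T" "T \<le> t" for T t
  proof -
    \<comment> \<open>Testing the difference against itself turns the scalar identity into a bound
      for its squared norm, from which one factor cancels.\<close>
    define D where "D \<xi> = F t \<xi> - F T \<xi>" for \<xi>
    have t0: "0 \<le> t" "0 \<le> T" using T by auto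
    have lD: "l2 D" unfolding D_def by (intro l2_diff lF t0)
    have "l2inner D D = l2inner D (F t) - l2inner D (F T)"
      using l2inner_diff_right[OF lD lF[OF t0(1)] lF[OF t0(2)]] unfolding D_def[symmetric] .
    also have "\<dots> = - \<i> * ((\<integral>\<tau>. indicator {0..t} \<tau> *\<^sub>R J D \<tau> \<partial>lborel) - (\<integral>\<tau>. indicator {0..T} \<tau> *\<^sub>R J D \<tau> \<partial>lborel))"
      unfolding Jeq[OF t0(1) lD] Jeq[OF t0(2) lD] by (simp add: algebra_simps)
    also have "(\<integral>\<tau>. indicator {0..t} \<tau> *\<^sub>R J D \<tau> \<partial>lborel) - (\<integral>\<tau>. indicator {0..T} \<tau> *\<^sub>R J D \<tau> \<partial>lborel)
        = (\<integral>\<tau>. indicator {0..t} \<tau> *\<^sub>R J D \<tau> - indicator {0..T} \<tau> *\<^sub>R J D \<tau> \<partial>lborel)"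
      by (rule Bochner_Integration.integral_diff[symmetric, OF Ji[OF t0(1) lD] Ji[OF t0(2) lD]])
    finally have "cmod (l2inner D D) = cmod (\<integral>\<tau>. indicator {0..t} \<tau> *\<^sub>R J D \<tau> - indicator {0..T} \<tau> *\<^sub>R J D \<tau> \<partial>lborel)"
      by (simp add: norm_mult)
    also have "\<dots> \<le> (\<integral>\<tau>. cmod (indicator {0..t} \<tau> *\<^sub>R J D \<tau> - indicator {0..T} \<tau> *\<^sub>R J D \<tau>) \<partial>lborel)"
      by (rule integral_norm_bound)
    also have "\<dots> \<le> (\<integral>\<tau>. l2norm D * K * (\<tau> powr (- \<alpha>) * indicator {T..t} \<tau>) \<partial>lborel)"
    proof (rule integral_mono)
      show "integrable lborel (\<lambda>\<tau>. cmod (indicator {0..t} \<tau> *\<^sub>R J D \<tau> - indicator {0..T} \<tau> *\<^sub>R J D \<tau>))"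
        by (intro integrable_norm Bochner_Integration.integrable_diff Ji lD t0)
      show "integrable lborel (\<lambda>\<tau>. l2norm D * K * (\<tau> powr (- \<alpha>) * indicator {T..t} \<tau>))"
        by (rule integrable_mult_right[OF integral_powr_tail(1)[OF \<alpha> T]])
      fix \<tau> :: real
      consider "\<tau> \<in> {0..T}" | "\<tau> \<in> {T<..t}" | "\<tau> \<notin> {0..t}" using T by fastforce
      then show "cmod (indicator {0..t} \<tau> *\<^sub>R J D \<tau> - indicator {0..T} \<tau> *\<^sub>R J D \<tau>) \<le> l2norm D * K * (\<tau> powr (- \<alpha>) * indicator {T..t} \<tau>)"
      proof cases
        case 1
        then show ?thesis using T K by simp
      next
        case 2
        then have "cmod (indicator {0..t} \<tau> *\<^sub>R J D \<tau> - indicator {0..T} \<tau> *\<^sub>R J D \<tau>) = cmod (J D \<tau>)"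
          using T by simp
        then show ?thesis using Jbd[OF lD, of \<tau>] 2 T by simp
      next
        case 3
        then have "\<tau> \<notin> {0..T}" "\<tau> \<notin> {T..t}" using T by auto
        then have "indicator {0..t} \<tau> = (0::real)" "indicator {0..T} \<tau> = (0::real)" "indicator {T..t} \<tau> = (0::real)"
          using 3 unfolding indicator_eq_0_iff by simp_all
        then show ?thesis by simp
      qed
    qed
    also have "\<dots> = l2norm D * K * (\<integral>\<tau>. \<tau> powr (- \<alpha>) * indicator {T..t} \<tau> \<partial>lborel)"
      by (rule integral_mult_right_zero)
    also have "\<dots> \<le> l2norm D * K * (T powr (1 - \<alpha>) / (\<alpha> - 1))"
      using K by (intro mult_left_mono integral_powr_tail(2)[OF \<alpha> T]) simp
    finally have le: "l2norm D * l2norm D \<le> l2norm D * (K * (T powr (1 - \<alpha>) / (\<alpha> - 1)))"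
      by (simp add: l2inner_self[OF lD] power2_eq_square norm_mult mult.assoc)
    have "l2norm D \<le> K * (T powr (1 - \<alpha>) / (\<alpha> - 1))"
    proof (cases "l2norm D = 0")
      case True
      then show ?thesis using K \<alpha> by simp
    next
      case False
      then have "0 < l2norm D" using l2norm_nonneg[of D] by linarith
      then show ?thesis using le by (rule mult_left_le_imp_le[rotated])
    qed
    then show ?thesis unfolding D_def .
  qed
  have "((\<lambda>T. K * (T powr (1 - \<alpha>) / (\<alpha> - 1))) \<longlongrightarrow> K * (0 / (\<alpha> - 1))) at_top"
    using \<alpha> by (intro tendsto_intros tendsto_neg_powr filterlim_ident) auto
  then have "\<forall>\<^sub>F T in at_top. K * (T powr (1 - \<alpha>) / (\<alpha> - 1)) < \<epsilon> / 2"
    by (rule order_tendstoD(2)) (use \<epsilon> in simp)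
  then have "\<forall>\<^sub>F T in at_top. K * (T powr (1 - \<alpha>) / (\<alpha> - 1)) < \<epsilon> / 2 \<and> 0 < T"
    using eventually_gt_at_top[of 0] by (rule eventually_conj)
  then obtain T where T: "K * (T powr (1 - \<alpha>) / (\<alpha> - 1)) < \<epsilon> / 2" "0 < T"
    using eventually_happens'[OF trivial_limit_at_top_linorder] by blast
  have T0: "0 \<le> T" using T by simp
  \<comment> \<open>The profile at time \<open>T\<close> plays the role of the scattering state,
    with half of the error left for its approximation.\<close>
  obtain a where a: "test_fun a" "l2norm (\<lambda>\<xi>. F T \<xi> - a \<xi>) < \<epsilon> / 2"
    using l2_approx_all[OF lF[OF T0]] \<epsilon> unfolding l2_approx_def by (meson half_gt_zero)
  have "l2norm (\<lambda>\<xi>. \<Psi> t \<xi> - free_evol t a \<xi>) \<le> \<epsilon>" if t: "T \<le> t" for t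
  proof -
    have t0: "0 \<le> t" using t T0 by simp
    have la: "l2 a" by (rule test_fun_l2[OF a(1)])
    have "(\<lambda>\<xi>. F t \<xi> - a \<xi>) = free_evol (- t) (\<lambda>\<xi>. \<Psi> t \<xi> - free_evol t a \<xi>)"
    proof
      fix \<xi> :: "real^'n"
      have "free_evol (- t) (free_evol t a) \<xi> = a \<xi>"
        unfolding free_evol_add by (simp add: free_evol_def)
      then show "F t \<xi> - a \<xi> = free_evol (- t) (\<lambda>\<xi>. \<Psi> t \<xi> - free_evol t a \<xi>) \<xi>"
        by (simp add: F_def free_evol_diff)
    qed
    then have "l2norm (\<lambda>\<xi>. \<Psi> t \<xi> - free_evol t a \<xi>) = l2norm (\<lambda>\<xi>. F t \<xi> - a \<xi>)"
      using free_evol_l2(2)[OF l2_diff[OF ftpair_l2(2)[OF \<Psi>[OF t0]] free_evol_l2(1)[OF la]]] by simp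
    also have "\<dots> \<le> l2norm (\<lambda>\<xi>. F t \<xi> - F T \<xi>) + l2norm (\<lambda>\<xi>. F T \<xi> - a \<xi>)"
      by (rule l2norm_diff_triangle[OF lF[OF t0] lF[OF T0] la])
    also have "\<dots> \<le> \<epsilon>" using diff[OF T(2) t] T(1) a(2) by linarith
    finally show ?thesis .
  qed
  then show ?thesis using a(1) T0 by blast
qed

lemma Cc_inf_R_continuous: "Cc_inf_R f \<Longrightarrow> continuous_on UNIV f"
proof -
  assume f: "Cc_inf_R f"
  have c: "continuous_on UNIV u" if "smooth_R u" for u
  proof -
    have "u differentiable (at x)" for x
      using that[unfolded smooth_R_def, rule_format, of 0 x] by simp
    then show ?thesis
      by (simp add: continuous_at_imp_continuous_on differentiable_imp_continuous_within)
  qed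
  have "continuous_on UNIV (\<lambda>x. complex_of_real (Re (f x)) + \<i> * complex_of_real (Im (f x)))"
    using f by (intro continuous_intros c) (auto simp: Cc_inf_R_def)
  then show ?thesis by (simp add: complex_eq[symmetric])
qed

lemma Cc_inf_R_bounded_support: "Cc_inf_R f \<Longrightarrow> bounded {x. f x \<noteq> 0}"
  by (simp add: Cc_inf_R_def tsupport_bounded_iff)

lemma Cc_inf_R_bounded:
  assumes "Cc_inf_R f"
  obtains B where "\<And>x. cmod (f x) \<le> B"
proof -
  obtain R where R: "\<And>s. f s \<noteq> 0 \<Longrightarrow> \<bar>s\<bar> \<le> R"
    using Cc_inf_R_bounded_support[OF assms] by (auto simp: bounded_iff)
  have "bounded (f ` {- R..R})"
    by (intro compact_imp_bounded compact_continuous_image continuous_on_subset[OF Cc_inf_R_continuous[OF assms]]) auto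
  then obtain B where B: "\<And>x. x \<in> {- R..R} \<Longrightarrow> cmod (f x) \<le> B" unfolding bounded_iff by blast
  have "cmod (f x) \<le> max B 0" for x
  proof (cases "f x = 0")
    case False
    then have "x \<in> {- R..R}" using R[of x] by auto
    then show ?thesis using B by (meson max.coboundedI1)
  qed simp
  then show thesis by (rule that)
qed

theorem theorem2p10:
  fixes s r :: real and q p p' :: ereal
  assumes d3: "CARD('n::finite) \<ge> 3"
    and hs: "s \<ge> real CARD('n) / 2 + 1"
    and hr: "1 \<le> r" "r < real CARD('n)"
    and hq: "1 \<le> q" "q < ereal (2 * real CARD('n) / 3)"
    and hqr: "1 / real CARD('n) + 1 / (2 * r) < real_of_ereal (inverse q)"
    and hp: "1 = ereal (1 / r) + 2 * inverse p"
    and hp': "inverse p + inverse p' = 1"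
  shows "\<exists>\<epsilon>0>0. \<forall>(w :: (real^'n \<Rightarrow> real) \<Rightarrow> real) (\<psi>0 :: real^'n \<Rightarrow> complex) \<psi>.
     in_MLq q w \<and> in_Hsp s 2 \<psi>0 \<and> in_Hsp s p' \<psi>0 \<and>
     MLq_norm q w * (Hsp_norm s 2 \<psi>0 + Hsp_norm s p' \<psi>0)\<^sup>2 \<le> \<epsilon>0 \<and>
     in_Lp 2 (\<lambda>x. complex_of_real (jbr x) * \<psi>0 x) \<and>
     in_S s r p \<psi> \<and> duhamel_sol q w \<psi>0 \<psi>
     \<longrightarrow> (\<forall>f g. Cc_inf_R f \<and> Cc_inf_R g \<and> tsupport f \<inter> tsupport g = {} \<longrightarrow>
           ((\<lambda>t. lp_norm 2 (\<lambda>x. g ((norm x)\<^sup>2 / t\<^sup>2) * f_Theta2 f (\<psi> t) x)) \<longlongrightarrow> 0) at_top)"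
proof (intro exI[of _ 1] conjI allI impI; (elim conjE)?)
  show "(0::real) < 1" by simp
next
  fix w :: "(real^'n \<Rightarrow> real) \<Rightarrow> real" and \<psi>0 :: "real^'n \<Rightarrow> complex" and \<psi> f g
  assume H0: "in_Hsp s 2 \<psi>0" and S: "in_S s r p \<psi>" and duh: "duhamel_sol q w \<psi>0 \<psi>"
    and f: "Cc_inf_R f" and g: "Cc_inf_R g" and fg: "tsupport f \<inter> tsupport g = {}"
  obtain q' where q': "q = ereal q'"
    using hq by (cases q) auto
  \<comment> \<open>Since 2 d / 3 lies below d, the exponent d / q in the decay rate of the
    potential exceeds 1.\<close>
  have q1: "1 \<le> q'" "q' < real CARD('n)"
    using hq d3 by (auto simp: q' one_ereal_def)
  have s0: "0 \<le> s" 
  proof -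
    have "0 \<le> real CARD('n) / 2" by simp
    then show ?thesis using hs by linarith
  qed
  obtain \<mu>1 \<mu>2 h where dec: "decomp q w \<mu>1 \<mu>2 h"
    and int: "\<And>t \<phi>. 0 \<le> t \<Longrightarrow> test_fun \<phi> \<Longrightarrow> set_integrable lborel {0..t}
        (\<lambda>\<tau>. \<integral>x. cnj (U_test (\<tau> - t) \<phi> x) * nonlin \<mu>1 \<mu>2 h (\<psi> \<tau>) x \<partial>lborel)"
    and eq: "\<And>t \<phi>. 0 \<le> t \<Longrightarrow> test_fun \<phi> \<Longrightarrow> (\<integral>x. cnj (\<phi> x) * \<psi> t x \<partial>lborel) =
        (\<integral>x. cnj (U_test (- t) \<phi> x) * \<psi>0 x \<partial>lborel)
        - \<i> * (LINT \<tau>:{0..t}|lborel. \<integral>x. cnj (U_test (\<tau> - t) \<phi> x) * nonlin \<mu>1 \<mu>2 h (\<psi> \<tau>) x \<partial>lborel)"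
    using duh unfolding duhamel_sol_def by (elim exE conjE) (rule that, assumption, blast, blast)
  obtain K \<alpha> where K: "0 \<le> K" "1 < \<alpha>" "\<And>t. 0 \<le> t \<Longrightarrow> l2 (\<psi> t)"
      "\<And>t. 0 \<le> t \<Longrightarrow> l2 (nonlin \<mu>1 \<mu>2 h (\<psi> t))"
      "\<And>t. 0 \<le> t \<Longrightarrow> l2norm (nonlin \<mu>1 \<mu>2 h (\<psi> t)) \<le> K * jbr t powr (- \<alpha>)"
    by (rule nonlin_decay[OF S s0 hr q1 hp dec[unfolded q']]) (rule that)
  have "\<forall>t. \<exists>U. 0 \<le> t \<longrightarrow> ftpair (\<psi> t) U" using ftpair_exists[OF K(3)] by metis
  then obtain \<Psi> where "\<forall>t. 0 \<le> t \<longrightarrow> ftpair (\<psi> t) (\<Psi> t)" by metis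
  then have \<Psi>: "\<And>t. 0 \<le> t \<Longrightarrow> ftpair (\<psi> t) (\<Psi> t)" by blast
  define m where "m \<xi> = f ((norm \<xi>)\<^sup>2 / (1 + (norm \<xi>)\<^sup>2))" for \<xi> :: "real^'n"
  obtain Bf where Bf: "\<And>x. cmod (f x) \<le> Bf" using Cc_inf_R_bounded[OF f] by blast
  obtain Bg where Bg: "\<And>x. cmod (g x) \<le> Bg" using Cc_inf_R_bounded[OF g] by blast
  have mc: "continuous_on UNIV m"
  proof -
    have "1 + (norm \<xi>)\<^sup>2 \<noteq> 0" for \<xi> :: "real^'n" using zero_le_power2[of "norm \<xi>"] by linarith
    then show ?thesis
      unfolding m_def by (intro continuous_on_compose2[OF Cc_inf_R_continuous[OF f]] continuous_intros) auto
  qed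
  have mb: "cmod (m \<xi>) \<le> Bf" for \<xi> unfolding m_def by (rule Bf)
  have Th: "f_Theta2 f = L2_mult m" unfolding f_Theta2_def m_def ..
  \<comment> \<open>Both functions are evaluated at the same real number, which cannot lie in both
    supports.\<close>
  have zero: "g ((norm \<xi>)\<^sup>2 / (1 + (norm \<xi>)\<^sup>2)) * m \<xi> = 0" for \<xi>
  proof -
    have "x \<in> tsupport u" if "u x \<noteq> 0" for u :: "real \<Rightarrow> complex" and x
      using that closure_subset[of "{x. u x \<noteq> 0}"] by (auto simp: tsupport_def)
    then show ?thesis using fg unfolding m_def by (metis disjoint_iff mult_eq_0_iff)
  qed
  have "((\<lambda>t. l2norm (\<lambda>x. g ((norm x)\<^sup>2 / t\<^sup>2) * f_Theta2 f (\<psi> t) x)) \<longlongrightarrow> 0) at_top"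
  proof (rule velocity_localization[OF _ _ mc mb _ Cc_inf_R_continuous[OF g] Cc_inf_R_bounded_support[OF g] Bg zero])
    show "l2 (\<Psi> t)" if "0 \<le> t" for t by (rule ftpair_l2(2)[OF \<Psi>[OF that]])
    show "\<exists>a T. test_fun a \<and> 0 \<le> T \<and> (\<forall>t\<ge>T. l2norm (\<lambda>\<xi>. \<Psi> t \<xi> - free_evol t a \<xi>) \<le> \<epsilon>)" if "0 < \<epsilon>" for \<epsilon>
      by (rule duhamel_asymptotic[OF \<Psi> l2norm_le_Hsp_norm(1)[OF H0 s0] K(4,1,2,5) int eq that])
    show "ftpair (f_Theta2 f (\<psi> t)) (\<lambda>\<xi>. m \<xi> * \<Psi> t \<xi>)" if "0 \<le> t" for t
      unfolding Th by (rule L2_mult_ftpair[OF mc mb \<Psi>[OF that]])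
  qed
  then show "((\<lambda>t. lp_norm 2 (\<lambda>x. g ((norm x)\<^sup>2 / t\<^sup>2) * f_Theta2 f (\<psi> t) x)) \<longlongrightarrow> 0) at_top"
    by (simp only: lp_norm_2)
qed

end
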